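(* For $n\ge 1$ let $\mathrm{den}_n$ denote the proportion of pairs $(v,w)\in S_n\times S_n$ whose Kazhdan--Lusztig polynomial $P_{v,w}$ is nonzero, i.e. $$\mathrm{den}_n=\frac{\#\{(v,w)\in S_n\times S_n : P_{v,w}\neq 0\}}{(n!)^2}.$$ Put $\rho=\sqrt[11]{25497938851324213335/22!}=0.708\ldots$. Then $\mathrm{den}_n\in O(n^{-2})$, and $\mathrm{den}_n\in\Omega\big((\rho-\epsilon)^n\big)$ for every $\epsilon\in(0,\rho)$.
   Context: $S_n$ is the symmetric group on $\{1,\dots,n\}$ with Coxeter generators the simple transpositions $s_i=(i,i+1)$, $1\le i\le n-1$; $\ell$ is the length function and $\leq_B$ the Bruhat order ($v\leq_B w$ if some subword of some reduced word for $w$ is a reduced word for $v$). Kazhdan--Lusztig polynomials: let $H$ be the Hecke algebra of $S_n$ over $\mathbb{Z}[q^{1/2},q^{-1/2}]$ with standard basis $(T_w)_{w\in S_n}$, where $T_vT_w=T_{vw}$ if $\ell(vw)=\ell(v)+\ell(w)$ and $T_{s_i}^2=(q-1)T_{s_i}+q$. Let the bar involution be the ring automorphism with $q^{1/2}\mapsto q^{-1/2}$, $T_w\mapsto (T_{w^{-1}})^{-1}$. The polynomials $P_{v,w}\in\mathbb{Z}[q]$ are the unique ones such that $P_{w,w}=1$, $P_{v,w}=0$ unless $v\leq_B w$, $\deg P_{v,w}\le\frac12(\ell(w)-\ell(v)-1)$ for $v<_B w$, and $q^{-\ell(w)/2}\sum_{v\leq_B w}P_{v,w}T_v$ is bar invariant.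 It is known that $P_{v,w}\neq 0$ if and only if $v\leq_B w$. For functions $f,g$ from the positive integers to $\mathbb{R}_{>0}$: $f\in\Omega(g)$ means there are $C>0$ and $n_0$ with $f(n)\ge C g(n)$ for all $n>n_0$; $f\in O(g)$ means there are $C>0$ and $n_0$ with $f(n)\le C g(n)$ for all $n>n_0$. *)

theory Defs
  imports
    "HOL-Combinatorics.Permutations"
    "HOL-Library.Sublist"
    "HOL-Library.Poly_Mapping"
    "HOL-Library.Landau_Symbols"
    "HOL-Computational_Algebra.Polynomial"
    "HOL-Algebra.QuotRing"
begin

type_synonym perm = "nat \<Rightarrow> nat"

definition sym_grp :: "nat \<Rightarrow> perm set" where
  "sym_grp n = {w. w permutes {1..n}}"

definition simple_refl :: "nat \<Rightarrow> perm" where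
  "simple_refl i = transpose i (i + 1)"

definition is_word :: "nat \<Rightarrow> nat list \<Rightarrow> bool" where
  "is_word n a \<longleftrightarrow> set a \<subseteq> {1..<n}"

text \<open>The word \<open>[i\<^sub>1, \<dots>, i\<^sub>k]\<close> stands for the product \<open>s\<^bsub>i\<^sub>1\<^esub> \<circ> \<dots> \<circ> s\<^bsub>i\<^sub>k\<^esub>\<close>.\<close>

definition word_prod :: "nat list \<Rightarrow> perm" where
  "word_prod a = foldr (\<lambda>i w. simple_refl i \<circ> w) a id"

definition perm_length :: "nat \<Rightarrow> perm \<Rightarrow> nat" where
  "perm_length n w = (LEAST k. \<exists>a. is_word n a \<and> word_prod a = w \<and> length a = k)"

definition reduced_word :: "nat \<Rightarrow> nat list \<Rightarrow> perm \<Rightarrow> bool" where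
  "reduced_word n a w \<longleftrightarrow> is_word n a \<and> word_prod a = w \<and> length a = perm_length n w"

text \<open>This forces both arguments to lie in \<^term>\<open>sym_grp n\<close>.\<close>

definition bruhat_le :: "nat \<Rightarrow> perm \<Rightarrow> perm \<Rightarrow> bool" where
  "bruhat_le n v w \<longleftrightarrow> (\<exists>a b. reduced_word n a w \<and> subseq b a \<and> reduced_word n b v)"

text \<open>
  Laurent polynomials in \<open>q\<^sup>1\<^sup>/\<^sup>2\<close> with integer coefficients are the finitely supported
  functions from exponents to coefficients, with the convolution product; \<open>qhalf k\<close> is
  \<open>(q\<^sup>1\<^sup>/\<^sup>2)\<^sup>k\<close>.
\<close>

type_synonym laurent = "int \<Rightarrow>\<^sub>0 int"

definition qhalf :: "int \<Rightarrow> laurent" where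
  "qhalf k = Poly_Mapping.single k 1"

definition laurent_of_poly :: "int poly \<Rightarrow> laurent" where
  "laurent_of_poly p = poly (map_poly of_int p) (qhalf 2)"

text \<open>
  An element of the Hecke algebra is the function giving its coefficients with respect to the
  standard basis; it vanishes outside \<^term>\<open>sym_grp n\<close>.
\<close>

type_synonym hecke = "perm \<Rightarrow> laurent"

definition T_basis :: "perm \<Rightarrow> hecke" where
  "T_basis w = (\<lambda>u. if u = w then 1 else 0)"

definition hscale :: "laurent \<Rightarrow> hecke \<Rightarrow> hecke" where
  "hscale c h = (\<lambda>u. c * h u)"

definition hadd :: "hecke \<Rightarrow> hecke \<Rightarrow> hecke" where
  "hadd g h = (\<lambda>u. g u + h u)"

definition is_hecke_algebra :: "nat \<Rightarrow> hecke ring \<Rightarrow> bool" where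
  "is_hecke_algebra n R \<longleftrightarrow>
     ring R \<and>
     carrier R = {h. \<forall>u. u \<notin> sym_grp n \<longrightarrow> h u = 0} \<and>
     add R = hadd \<and>
     zero R = (\<lambda>u. 0) \<and>
     one R = T_basis id \<and>
     (\<forall>c. \<forall>g\<in>carrier R. \<forall>h\<in>carrier R.
        mult R (hscale c g) h = hscale c (mult R g h) \<and>
        mult R g (hscale c h) = hscale c (mult R g h)) \<and>
     (\<forall>v\<in>sym_grp n. \<forall>w\<in>sym_grp n.
        perm_length n (v \<circ> w) = perm_length n v + perm_length n w \<longrightarrow>
        mult R (T_basis v) (T_basis w) = T_basis (v \<circ> w)) \<and>
     (\<forall>i\<in>{1..<n}.
        mult R (T_basis (simple_refl i)) (T_basis (simple_refl i)) =
          hadd (hscale (qhalf 2 - 1) (T_basis (simple_refl i)))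
               (hscale (qhalf 2) (T_basis id)))"

text \<open>
  The conditions determine the ring on its carrier; only the values of the multiplication
  outside the carrier are left open, hence the choice operator. The same remark applies to the
  bar involution.
\<close>

definition hecke_algebra :: "nat \<Rightarrow> hecke ring" where
  "hecke_algebra n = (SOME R. is_hecke_algebra n R)"

definition is_bar_involution :: "nat \<Rightarrow> (hecke \<Rightarrow> hecke) \<Rightarrow> bool" where
  "is_bar_involution n \<phi> \<longleftrightarrow>
     \<phi> \<in> ring_iso (hecke_algebra n) (hecke_algebra n) \<and>
     \<phi> (hscale (qhalf 1) (T_basis id)) = hscale (qhalf (- 1)) (T_basis id) \<and>
     (\<forall>w\<in>sym_grp n. T_basis (inv_into UNIV w) \<in> Units (hecke_algebra n) \<and>
        \<phi> (T_basis w) = m_inv (hecke_algebra n) (T_basis (inv_into UNIV w)))"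

definition bar_involution :: "nat \<Rightarrow> hecke \<Rightarrow> hecke" where
  "bar_involution n = (SOME \<phi>. is_bar_involution n \<phi>)"

text \<open>The element \<open>q\<^bsup>-l(w)/2\<^esup> \<Sum>\<^bsub>v \<le> w\<^esub> P\<^bsub>v,w\<^esub> T\<^sub>v\<close>, given by its coefficients.\<close>

definition kl_element :: "nat \<Rightarrow> (perm \<Rightarrow> perm \<Rightarrow> int poly) \<Rightarrow> perm \<Rightarrow> hecke" where
  "kl_element n P w =
     (\<lambda>v. if bruhat_le n v w
          then qhalf (- int (perm_length n w)) * laurent_of_poly (P v w) else 0)"

definition is_kl_family :: "nat \<Rightarrow> (perm \<Rightarrow> perm \<Rightarrow> int poly) \<Rightarrow> bool" where
  "is_kl_family n P \<longleftrightarrow>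
     (\<forall>w\<in>sym_grp n. P w w = 1) \<and>
     (\<forall>v w. \<not> bruhat_le n v w \<longrightarrow> P v w = 0) \<and>
     (\<forall>v w. bruhat_le n v w \<and> v \<noteq> w \<longrightarrow>
        real (degree (P v w)) \<le> (real (perm_length n w) - real (perm_length n v) - 1) / 2) \<and>
     (\<forall>w\<in>sym_grp n. bar_involution n (kl_element n P w) = kl_element n P w)"

definition kl_poly :: "nat \<Rightarrow> perm \<Rightarrow> perm \<Rightarrow> int poly" where
  "kl_poly n = (THE P. is_kl_family n P)"

definition den :: "nat \<Rightarrow> real" where
  "den n = real (card {(v, w). v \<in> sym_grp n \<and> w \<in> sym_grp n \<and> kl_poly n v w \<noteq> 0})
             / (fact n)\<^sup>2"

end

(*
  The polynomial P_{v,w} is nonzero exactly when v \<le> w in the Bruhat order (its constant term is then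
  1), and Bruhat comparability is the entrywise comparison of rank matrices.

  Lower bound: insert k new last values into two comparable permutations of {1..n}. The results are
  comparable as soon as, for every suffix, the sorted new values of the smaller permutation dominate
  those of the larger one. For fixed large k and n \<rightarrow> \<infinity> this happens for a proportion of more than
  0.709^k of the choices, so den (n + k) is at least 0.709^k den n, and \<rho> < 0.709. Domination is
  forced by grouping the values into ten cells, shifting by one cell, and using only the extreme cells
  in a few of the k steps; a Chernoff bound controls the fluctuations in the remaining steps.

  Upper bound: for m = n div 2, compare only the sets of values in the first m positions and the sets
  of positions of the first m values. Given the sizes a and b of the intersections with {1..m}, this
  is four independent ballot events, each of probability O((a - b + 1) / m). As a - b is of order
  sqrt n in the fourth mean, the product is O(n^-2).
*)

theory Submission
  imports Defs "HOL-Library.Infinite_Set" "HOL-Real_Asymp.Real_Asymp"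
begin

text \<open>The objects are given by \<open>SOME\<close> and \<open>THE\<close>, so nothing is known
  about \<open>kl_poly\<close> until the Hecke algebra, the bar involution and the Kazhdan--Lusztig
  family are shown to exist and to be determined by their conditions. The constant term 1 is an
  invariant of the inductive construction of the basis: every correction term is divisible by q.

  In the lower bound, 50 steps out of 51 cost a factor (9/10)^2 for the avoided cells and one costs
  (1/10)^2, both values being confined to a single cell. The base left over is ((81/100)^50 /
  100)^(1/51) = 0.743..., which leaves room above 0.709.

  In the upper bound, the four ballot events arise because the set of values and the set of
  positions are each split at m into a lower and an upper part. The ballot estimate has denominators
  a + 1 and m - b + 1, which degenerate when a or b is far from m / 2. It is therefore capped at 1,
  and such a and b are charged to the fourth moments of 2 a - m and 2 b - m. These are of order m^2,
  and the four factors 1 / m then leave m^(-2).\<close>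

declare o_apply [simp del] id_apply [simp del]

subsection \<open>Length and reduced words\<close>

abbreviation asc :: "perm \<Rightarrow> nat \<Rightarrow> bool" where
  "asc w i \<equiv> w i < w (Suc i)"

lemma simple_refl_apply [simp]:
  "simple_refl i i = Suc i" "simple_refl i (Suc i) = i"
  "j \<noteq> i \<Longrightarrow> j \<noteq> Suc i \<Longrightarrow> simple_refl i j = j"
  by (simp_all add: simple_refl_def)

lemma comp_simple_refl_apply [simp]:
  "(w \<circ> simple_refl i) i = w (Suc i)" "(w \<circ> simple_refl i) (Suc i) = w i"
  "j \<noteq> i \<Longrightarrow> j \<noteq> Suc i \<Longrightarrow> (w \<circ> simple_refl i) j = w j"
  by (simp_all add: o_apply)

lemma simple_refl_simple_refl [simp]: "simple_refl i (simple_refl i j) = j"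
  by (simp add: simple_refl_def)

lemma simple_refl_comp_self [simp]: "simple_refl i \<circ> simple_refl i = id"
  by (auto simp: fun_eq_iff o_apply id_apply)

lemma comp_simple_refl_twice [simp]: "w \<circ> simple_refl i \<circ> simple_refl i = w"
  by (auto simp: fun_eq_iff o_apply id_apply)

lemma simple_refl_twice_comp [simp]: "simple_refl i \<circ> (simple_refl i \<circ> w) = w"
  by (auto simp: fun_eq_iff o_apply id_apply)

lemma bij_simple_refl [simp]: "bij (simple_refl i)"
  by (simp add: simple_refl_def)

lemma inj_simple_refl [simp]: "inj (simple_refl i)"
  by (simp add: bij_is_inj)

lemma inv_simple_refl [simp]: "inv_into UNIV (simple_refl i) = simple_refl i"
  by (rule inv_unique_comp) simp_all

lemma simple_refl_in_sym_grp: "i \<in> {1..<n} \<Longrightarrow> simple_refl i \<in> sym_grp n"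
  unfolding sym_grp_def simple_refl_def by (auto intro!: permutes_swap_id)

lemma id_in_sym_grp [simp]: "id \<in> sym_grp n"
  by (simp add: sym_grp_def permutes_id)

lemma comp_in_sym_grp: "v \<in> sym_grp n \<Longrightarrow> w \<in> sym_grp n \<Longrightarrow> v \<circ> w \<in> sym_grp n"
  by (simp add: sym_grp_def permutes_compose)

lemma inv_in_sym_grp: "w \<in> sym_grp n \<Longrightarrow> inv_into UNIV w \<in> sym_grp n"
  by (simp add: sym_grp_def permutes_inv)

lemma finite_sym_grp [simp]: "finite (sym_grp n)"
  by (simp add: sym_grp_def finite_permutations)

lemma sym_grp_inj: "w \<in> sym_grp n \<Longrightarrow> inj w"
  by (simp add: sym_grp_def permutes_inj)

lemma sym_grp_bij: "w \<in> sym_grp n \<Longrightarrow> bij w"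
  by (simp add: sym_grp_def permutes_bij)

lemma comp_simple_refl_iff:
  assumes "i \<in> {1..<n}"
  shows "w \<circ> simple_refl i \<in> sym_grp n \<longleftrightarrow> w \<in> sym_grp n"
  using comp_in_sym_grp simple_refl_in_sym_grp[OF assms] comp_simple_refl_twice by metis

lemma simple_refl_comp_iff:
  assumes "i \<in> {1..<n}"
  shows "simple_refl i \<circ> w \<in> sym_grp n \<longleftrightarrow> w \<in> sym_grp n"
  using comp_in_sym_grp simple_refl_in_sym_grp[OF assms] simple_refl_twice_comp by metis

lemma not_asc_iff: "inj w \<Longrightarrow> \<not> asc w i \<longleftrightarrow> w (Suc i) < w i"
  by (metis injD linorder_neqE_nat n_not_Suc_n not_less_iff_gr_or_eq)

lemma asc_comp_simple_refl: "inj w \<Longrightarrow> asc (w \<circ> simple_refl i) i \<longleftrightarrow> \<not> asc w i"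
  by (simp add: not_asc_iff)

definition inversions :: "nat \<Rightarrow> perm \<Rightarrow> (nat \<times> nat) set" where
  "inversions n w = {(a, b). 1 \<le> a \<and> a < b \<and> b \<le> n \<and> w b < w a}"

lemma finite_inversions [simp]: "finite (inversions n w)"
  by (rule finite_subset[of _ "{1..n} \<times> {1..n}"]) (auto simp: inversions_def)

text \<open>Exchanging two adjacent entries relabels the positions of all other inversions and
  creates the single new inversion \<open>(i, Suc i)\<close>.\<close>

lemma card_inversions_asc:
  assumes i: "i \<in> {1..<n}" and "asc w i"
  shows "card (inversions n (w \<circ> simple_refl i)) = Suc (card (inversions n w))"
proof -
  let ?s = "simple_refl i"
  have s_cases: "?s x = (if x = i then Suc i else if x = Suc i then i else x)" for x
    by auto
  have "inversions n (w \<circ> ?s) = insert (i, Suc i) (map_prod ?s ?s ` inversions n w)"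
  proof -
    have "(a, b) \<in> inversions n (w \<circ> ?s) \<longleftrightarrow>
        (a, b) \<in> insert (i, Suc i) (map_prod ?s ?s ` inversions n w)" for a b
    proof -
    have "(a, b) \<in> map_prod ?s ?s ` inversions n w \<longleftrightarrow> (?s a, ?s b) \<in> inversions n w"
    proof
      assume "(?s a, ?s b) \<in> inversions n w"
      then have "map_prod ?s ?s (?s a, ?s b) \<in> map_prod ?s ?s ` inversions n w"
        by (rule imageI)
      then show "(a, b) \<in> map_prod ?s ?s ` inversions n w" by simp
    qed auto
    moreover have "(a, b) \<in> inversions n (w \<circ> ?s) \<longleftrightarrow>
        (a, b) = (i, Suc i) \<or> (?s a, ?s b) \<in> inversions n w"
      using assms by (auto simp: inversions_def s_cases o_apply split: if_splits)
    ultimately show "(a, b) \<in> inversions n (w \<circ> ?s) \<longleftrightarrow>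
        (a, b) \<in> insert (i, Suc i) (map_prod ?s ?s ` inversions n w)" by simp
    qed
    then show ?thesis by (intro Set.set_eqI) (metis surj_pair)
  qed
  moreover have "(i, Suc i) \<notin> map_prod ?s ?s ` inversions n w"
  proof
    assume "(i, Suc i) \<in> map_prod ?s ?s ` inversions n w"
    then obtain a b where "(a, b) \<in> inversions n w" "?s a = i" "?s b = Suc i"
      by auto
    then show False
      by (auto simp: inversions_def s_cases o_apply split: if_splits)
  qed
  moreover have "inj_on (map_prod ?s ?s) (inversions n w)"
    by (intro inj_on_subset[OF prod.inj_map]) auto
  ultimately show ?thesis
    by (simp add: card_image)
qed

lemma card_inversions_desc:
  assumes "i \<in> {1..<n}" and "w \<in> sym_grp n" and "\<not> asc w i"
  shows "card (inversions n w) = Suc (card (inversions n (w \<circ> simple_refl i)))"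
  using card_inversions_asc[of i n "w \<circ> simple_refl i"] assms
    asc_comp_simple_refl[OF sym_grp_inj] by simp

lemma card_inversions_id [simp]: "card (inversions n id) = 0"
proof -
  have "inversions n id = {}"
    by (auto simp: inversions_def id_apply)
  then show ?thesis by simp
qed

text \<open>Without descents the values increase on \<open>{1..n}\<close>, so each is at least its
  position, which forces the identity.\<close>

lemma ex_descent:
  assumes "w \<in> sym_grp n" "w \<noteq> id"
  shows "\<exists>i\<in>{1..<n}. \<not> asc w i"
proof (rule ccontr)
  assume "\<not> ?thesis"
  then have asc: "asc w i" if "1 \<le> i" "i < n" for i
    using that by auto
  have "w permutes {1..n}"
    using assms by (simp add: sym_grp_def)
  moreover have "i \<le> n \<longrightarrow> i \<le> w i" for i
  proof (induction i)
    case (Suc i)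
    show ?case
    proof (cases "i = 0")
      case True
      then show ?thesis
        using permutes_in_image[OF \<open>w permutes {1..n}\<close>, of 1] by auto
    next
      case False
      then show ?thesis
        using Suc asc[of i] by auto
    qed
  qed simp
  ultimately have "w = id"
    by (intro permutes_natset_ge) auto
  with assms show False by simp
qed

text \<open>Removing a descent from the right lowers the number of inversions. This is induction on
  the length without choosing a reduced word.\<close>

lemma sym_grp_induct [consumes 1, case_names id asc]:
  assumes "w \<in> sym_grp n"
    and "P id"
    and "\<And>w i. w \<in> sym_grp n \<Longrightarrow> i \<in> {1..<n} \<Longrightarrow> asc w i \<Longrightarrow> P w \<Longrightarrow> P (w \<circ> simple_refl i)"
  shows "P w"
  using assms(1)
proof (induction "card (inversions n w)" arbitrary: w rule: less_induct)
  case less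
  show ?case
  proof (cases "w = id")
    case True
    then show ?thesis using assms(2) by simp
  next
    case False
    then obtain i where i: "i \<in> {1..<n}" "\<not> asc w i"
      using ex_descent less.prems by blast
    let ?v = "w \<circ> simple_refl i"
    have v: "?v \<in> sym_grp n"
      using less.prems i by (simp add: comp_simple_refl_iff)
    have "P (?v \<circ> simple_refl i)"
    proof (rule assms(3)[OF v i(1)])
      show "asc ?v i"
        using i asc_comp_simple_refl[OF sym_grp_inj[OF less.prems]] by blast
      show "P ?v"
        using card_inversions_desc[OF i(1) less.prems i(2)] v less.hyps by simp
    qed
    then show ?thesis
      by simp
  qed
qed

lemma word_prod_Nil [simp]: "word_prod [] = id"
  by (simp add: word_prod_def id_apply)

lemma word_prod_Cons [simp]: "word_prod (i # a) = simple_refl i \<circ> word_prod a"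
  by (simp add: word_prod_def o_apply)

lemma word_prod_append: "word_prod (a @ b) = word_prod a \<circ> word_prod b"
  by (induction a) (auto simp: comp_assoc)

lemma word_prod_snoc [simp]: "word_prod (a @ [i]) = word_prod a \<circ> simple_refl i"
  by (simp add: word_prod_append)

lemma is_word_simps [simp]:
  "is_word n []" "is_word n (i # a) \<longleftrightarrow> i \<in> {1..<n} \<and> is_word n a"
  "is_word n (a @ b) \<longleftrightarrow> is_word n a \<and> is_word n b" "is_word n (rev a) \<longleftrightarrow> is_word n a"
  by (auto simp: is_word_def)

lemma word_prod_in_sym_grp: "is_word n a \<Longrightarrow> word_prod a \<in> sym_grp n"
  by (induction a) (auto intro!: comp_in_sym_grp simple_refl_in_sym_grp)

lemma inv_word_prod: "is_word n a \<Longrightarrow> inv_into UNIV (word_prod a) = word_prod (rev a)"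
proof (induction a)
  case (Cons i a)
  then have "inv_into UNIV (simple_refl i \<circ> word_prod a) = inv_into UNIV (word_prod a) \<circ> simple_refl i"
    using o_inv_distrib[OF bij_simple_refl sym_grp_bij[OF word_prod_in_sym_grp], of n a i] by simp
  then show ?case
    using Cons by (simp add: word_prod_append)
qed (simp add: inv_id)

lemma card_inversions_word_prod: "is_word n a \<Longrightarrow> card (inversions n (word_prod a)) \<le> length a"
proof (induction a rule: rev_induct)
  case (snoc i a)
  then have "card (inversions n (word_prod a)) \<le> length a" "i \<in> {1..<n}" "word_prod a \<in> sym_grp n"
    by (auto intro: word_prod_in_sym_grp)
  then show ?case
    using card_inversions_asc[of i n "word_prod a"] card_inversions_desc[of i n "word_prod a"]
    by (cases "asc (word_prod a) i") auto
qed simp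

lemma ex_word_inversions:
  assumes "w \<in> sym_grp n"
  shows "\<exists>a. is_word n a \<and> word_prod a = w \<and> length a = card (inversions n w)"
  using assms
proof (induction rule: sym_grp_induct)
  case id
  show ?case by (rule exI[of _ "[]"]) (simp only: is_word_simps word_prod_Nil card_inversions_id list.size)
next
  case (asc w i)
  then obtain a where "is_word n a" "word_prod a = w" "length a = card (inversions n w)"
    by blast
  with asc show ?case
    by (intro exI[of _ "a @ [i]"]) (simp add: card_inversions_asc)
qed

text \<open>Each letter changes the number of inversions by one, so no word is shorter than this
  number; stripping descents produces a word that attains it.\<close>

lemma perm_length_eq:
  assumes "w \<in> sym_grp n"
  shows "perm_length n w = card (inversions n w)"
  unfolding perm_length_def
proof (rule Least_equality)
  show "\<exists>a. is_word n a \<and> word_prod a = w \<and> length a = card (inversions n w)"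
    by (rule ex_word_inversions[OF assms])
qed (use card_inversions_word_prod in blast)

lemma perm_length_id [simp]: "perm_length n id = 0"
  by (simp only: perm_length_eq[OF id_in_sym_grp] card_inversions_id)

lemma perm_length_asc:
  "w \<in> sym_grp n \<Longrightarrow> i \<in> {1..<n} \<Longrightarrow> asc w i \<Longrightarrow>
    perm_length n (w \<circ> simple_refl i) = Suc (perm_length n w)"
  by (simp add: perm_length_eq comp_simple_refl_iff card_inversions_asc)

lemma perm_length_desc:
  "w \<in> sym_grp n \<Longrightarrow> i \<in> {1..<n} \<Longrightarrow> \<not> asc w i \<Longrightarrow>
    perm_length n w = Suc (perm_length n (w \<circ> simple_refl i))"
  by (simp add: perm_length_eq comp_simple_refl_iff card_inversions_desc)

lemma perm_length_word_prod: "is_word n a \<Longrightarrow> perm_length n (word_prod a) \<le> length a"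
  by (simp add: perm_length_eq word_prod_in_sym_grp card_inversions_word_prod)

lemma perm_length_simple_refl: "i \<in> {1..<n} \<Longrightarrow> perm_length n (simple_refl i) = 1"
  using perm_length_asc[of id n i] by (simp add: id_apply)

lemma perm_length_comp_simple_refl_le:
  "w \<in> sym_grp n \<Longrightarrow> i \<in> {1..<n} \<Longrightarrow> perm_length n (w \<circ> simple_refl i) \<le> Suc (perm_length n w)"
  using perm_length_asc[of w n i] perm_length_desc[of w n i] by fastforce

lemma ex_reduced_word: "w \<in> sym_grp n \<Longrightarrow> \<exists>a. reduced_word n a w"
  using ex_word_inversions[of w n] by (auto simp: reduced_word_def perm_length_eq)

lemma reduced_word_in_sym_grp: "reduced_word n a w \<Longrightarrow> w \<in> sym_grp n"
  by (auto simp: reduced_word_def word_prod_in_sym_grp)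

lemma reduced_word_Nil: "reduced_word n [] id"
  by (simp add: reduced_word_def)

lemma reduced_word_snoc:
  "reduced_word n a w \<Longrightarrow> i \<in> {1..<n} \<Longrightarrow> asc w i \<Longrightarrow> reduced_word n (a @ [i]) (w \<circ> simple_refl i)"
  using reduced_word_in_sym_grp[of n a w] by (auto simp: reduced_word_def perm_length_asc)

text \<open>If the last letter did not raise the length, the product of the remaining letters would
  be longer than their number.\<close>

lemma reduced_word_snocD:
  assumes "reduced_word n (a @ [i]) w"
  shows "i \<in> {1..<n}" "reduced_word n a (w \<circ> simple_refl i)" "\<not> asc w i"
    "w = word_prod a \<circ> simple_refl i" "asc (word_prod a) i"
proof -
  let ?v = "word_prod a"
  have *: "is_word n a" "i \<in> {1..<n}" "?v \<circ> simple_refl i = w" "perm_length n w = Suc (length a)"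
    using assms by (auto simp: reduced_word_def)
  have v: "?v \<in> sym_grp n"
    using * by (simp add: word_prod_in_sym_grp)
  have le: "perm_length n ?v \<le> length a"
    using * by (simp add: perm_length_word_prod)
  show asc: "asc ?v i"
    using perm_length_desc[OF v *(2)] * le by fastforce
  show "reduced_word n a (w \<circ> simple_refl i)"
    using * perm_length_asc[OF v *(2) asc] *(3)[symmetric] by (simp add: reduced_word_def)
  show "\<not> asc w i"
    using asc asc_comp_simple_refl[OF sym_grp_inj[OF v], of i] *(3) by blast
qed (use assms in \<open>auto simp: reduced_word_def\<close>)

lemma perm_length_inv_le:
  assumes "w \<in> sym_grp n"
  shows "perm_length n (inv_into UNIV w) \<le> perm_length n w"
proof -
  obtain a where "reduced_word n a w"
    using ex_reduced_word[OF assms] by blast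
  then show ?thesis
    using perm_length_word_prod[of n "rev a"] inv_word_prod[of n a] by (auto simp: reduced_word_def)
qed

lemma perm_length_inv:
  assumes "w \<in> sym_grp n"
  shows "perm_length n (inv_into UNIV w) = perm_length n w"
  using perm_length_inv_le[OF assms] perm_length_inv_le[OF inv_in_sym_grp[OF assms]]
    inv_inv_eq[OF sym_grp_bij[OF assms]] by simp

lemma reduced_word_rev: "reduced_word n a w \<Longrightarrow> reduced_word n (rev a) (inv_into UNIV w)"
  using perm_length_inv[OF reduced_word_in_sym_grp, of n a w] by (auto simp: reduced_word_def inv_word_prod)

subsection \<open>The Bruhat order and rank matrices\<close>

definition rank_mat :: "perm \<Rightarrow> nat \<Rightarrow> nat \<Rightarrow> nat" where
  "rank_mat w i j = card {l \<in> {1..i}. w l \<le> j}"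

text \<open>The order is reversed: smaller permutations have larger rank matrices, and the identity
  has the largest one.\<close>

definition rank_le :: "perm \<Rightarrow> perm \<Rightarrow> bool" where
  "rank_le v w \<longleftrightarrow> (\<forall>i j. rank_mat w i j \<le> rank_mat v i j)"

lemma rank_le_refl [simp]: "rank_le w w"
  by (simp add: rank_le_def)

lemma rank_le_trans: "rank_le u v \<Longrightarrow> rank_le v w \<Longrightarrow> rank_le u w"
  unfolding rank_le_def using order_trans by blast

lemma rank_mat_0 [simp]: "rank_mat w 0 j = 0"
  by (simp add: rank_mat_def)

lemma rank_mat_Suc: "rank_mat w (Suc i) j = rank_mat w i j + (if w (Suc i) \<le> j then 1 else 0)"
proof -
  have "{l \<in> {1..Suc i}. w l \<le> j} =
      (if w (Suc i) \<le> j then insert (Suc i) {l \<in> {1..i}. w l \<le> j} else {l \<in> {1..i}. w l \<le> j})"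
    by (auto simp: le_Suc_eq)
  then show ?thesis
    by (simp add: rank_mat_def)
qed

text \<open>The reflection maps every prefix \<open>{1..k}\<close> to itself except the one with k =
  i. In the recursion over rows, row i + 1 is reached from row i - 1 by adding the two exchanged
  contributions.\<close>

lemma rank_mat_comp_simple_refl:
  assumes "i \<ge> 1" "k \<noteq> i"
  shows "rank_mat (w \<circ> simple_refl i) k j = rank_mat w k j"
  using assms(2)
proof (induction k rule: less_induct)
  case (less k)
  show ?case
  proof (cases k)
    case (Suc k')
    show ?thesis
    proof (cases "k' = i")
      case True
      obtain l where l: "i = Suc l"
        using assms(1) by (cases i) auto
      have "rank_mat (w \<circ> simple_refl i) l j = rank_mat w l j"
        using less Suc True l by simp
      then show ?thesis
        unfolding Suc True by (simp add: rank_mat_Suc l)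
    next
      case False
      then show ?thesis
        using less Suc by (simp add: rank_mat_Suc)
    qed
  qed simp
qed

lemma rank_mat_le: "rank_mat w i j \<le> i"
proof -
  have "rank_mat w i j \<le> card {1..i}"
    unfolding rank_mat_def by (rule card_mono) auto
  then show ?thesis by simp
qed

lemma rank_mat_id: "rank_mat id i j = min i j"
proof -
  have "{l \<in> {1..i}. id l \<le> j} = {1..min i j}"
    by (auto simp: id_apply)
  then show ?thesis
    by (simp add: rank_mat_def)
qed

lemma rank_mat_asc:
  "asc w (Suc i) \<Longrightarrow> rank_mat w (Suc i) j = min (Suc (rank_mat w i j)) (rank_mat w (Suc (Suc i)) j)"
  by (auto simp: rank_mat_Suc)

lemma rank_mat_desc:
  "w (Suc (Suc i)) \<le> w (Suc i) \<Longrightarrow>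
    rank_mat w (Suc i) j = max (rank_mat w i j) (rank_mat w (Suc (Suc i)) j - 1)"
  by (auto simp: rank_mat_Suc)

lemma rank_le_cong_row:
  assumes "i \<ge> 1" "rank_le v w"
    and "\<And>k j. k \<noteq> i \<Longrightarrow> rank_mat v' k j = rank_mat v k j"
    and "\<And>k j. k \<noteq> i \<Longrightarrow> rank_mat w' k j = rank_mat w k j"
    and "\<And>j. rank_mat w' i j \<le> rank_mat v' i j"
  shows "rank_le v' w'"
  using assms unfolding rank_le_def by metis

text \<open>
  Row \<open>i\<close> of a rank matrix is the largest one compatible with its two neighbours if \<open>i\<close> is an
  ascent and the smallest one if \<open>i\<close> is a descent; multiplication by the \<open>i\<close>-th reflection changes
  only this row. This is why the lifting property holds for the comparison of rank matrices.
\<close>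

lemma rank_le_both:
  assumes v: "v \<in> sym_grp n" and w: "w \<in> sym_grp n" and i: "i \<in> {1..<n}" and "rank_le v w"
    and "asc v i \<longleftrightarrow> asc w i"
  shows "rank_le (v \<circ> simple_refl i) (w \<circ> simple_refl i)"
proof (rule rank_le_cong_row[OF _ \<open>rank_le v w\<close>])
  obtain l where l: "i = Suc l" using i by (cases i) auto
  fix j
  have *: "rank_mat (u \<circ> simple_refl i) l j = rank_mat u l j"
    "rank_mat (u \<circ> simple_refl i) (Suc i) j = rank_mat u (Suc i) j" for u
    using i l by (auto intro: rank_mat_comp_simple_refl)
  have le: "rank_mat w l j \<le> rank_mat v l j" "rank_mat w (Suc i) j \<le> rank_mat v (Suc i) j"
    using \<open>rank_le v w\<close> by (auto simp: rank_le_def)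
  show "rank_mat (w \<circ> simple_refl i) i j \<le> rank_mat (v \<circ> simple_refl i) i j"
  proof (cases "asc w i")
    case True
    then have "\<not> asc (w \<circ> simple_refl i) i" "\<not> asc (v \<circ> simple_refl i) i"
      using assms by (auto simp: not_asc_iff[OF sym_grp_inj])
    then show ?thesis
      using le * unfolding l by (auto simp: rank_mat_desc)
  next
    case False
    then have "asc (w \<circ> simple_refl i) i" "asc (v \<circ> simple_refl i) i"
      using assms by (auto simp: not_asc_iff[OF sym_grp_inj])
    then show ?thesis
      using le * unfolding l by (auto simp: rank_mat_asc)
  qed
qed (use i in \<open>auto intro: rank_mat_comp_simple_refl\<close>)

lemma rank_le_lift:
  assumes "v \<in> sym_grp n" "w \<in> sym_grp n" and i: "i \<in> {1..<n}" and "rank_le v w"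
    and "asc v i" and "\<not> asc w i"
  shows "rank_le v (w \<circ> simple_refl i)" "rank_le (v \<circ> simple_refl i) w"
proof -
  obtain l where l: "i = Suc l" using i by (cases i) auto
  have *: "rank_mat (u \<circ> simple_refl i) l j = rank_mat u l j"
    "rank_mat (u \<circ> simple_refl i) (Suc i) j = rank_mat u (Suc i) j" for u j
    using i l by (auto intro: rank_mat_comp_simple_refl)
  have le: "rank_mat w l j \<le> rank_mat v l j" "rank_mat w (Suc i) j \<le> rank_mat v (Suc i) j" for j
    using \<open>rank_le v w\<close> by (auto simp: rank_le_def)
  have "asc (w \<circ> simple_refl i) i" "\<not> asc (v \<circ> simple_refl i) i"
    using assms by (auto simp: not_asc_iff[OF sym_grp_inj])
  then have "rank_mat (w \<circ> simple_refl i) i j \<le> rank_mat v i j"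
    "rank_mat w i j \<le> rank_mat (v \<circ> simple_refl i) i j" for j
    using le[of j] *[of _ j] assms(5,6) unfolding l
    by (auto simp: rank_mat_asc rank_mat_desc)
  then show "rank_le v (w \<circ> simple_refl i)" "rank_le (v \<circ> simple_refl i) w"
    using i by (auto intro!: rank_le_cong_row[of i, OF _ \<open>rank_le v w\<close>] rank_mat_comp_simple_refl)
qed

lemma rank_le_asc:
  assumes "w \<in> sym_grp n" "i \<in> {1..<n}" "asc w i"
  shows "rank_le w (w \<circ> simple_refl i)"
proof -
  have w: "w \<circ> simple_refl i \<in> sym_grp n" "\<not> asc (w \<circ> simple_refl i) i"
    using assms by (auto simp: comp_simple_refl_iff asc_comp_simple_refl[OF sym_grp_inj])
  obtain l where l: "i = Suc l" using assms(2) by (cases i) auto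
  show ?thesis
  proof (rule rank_le_cong_row[of i w w])
    show "rank_mat (w \<circ> simple_refl i) i j \<le> rank_mat w i j" for j
      using assms(3) rank_mat_comp_simple_refl[of i l w j] l
      by (simp add: rank_mat_Suc)
  qed (use assms in \<open>auto intro: rank_mat_comp_simple_refl\<close>)
qed

lemma rank_le_desc:
  assumes "w \<in> sym_grp n" "i \<in> {1..<n}" "\<not> asc w i"
  shows "rank_le (w \<circ> simple_refl i) w"
  using rank_le_asc[of "w \<circ> simple_refl i" n i] assms
  by (simp add: comp_simple_refl_iff not_asc_iff[OF sym_grp_inj])

text \<open>The subword \<open>b\<close> may be non-reduced, which keeps the induction simple. If
  the last letter is kept, either it is an ascent for both shortened products and multiplication
  preserves the comparison, or it lowers the product of \<open>b\<close>, which only helps.\<close>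

lemma rank_le_subword:
  assumes "reduced_word n a w" "subseq b a"
  shows "rank_le (word_prod b) w"
  using assms
proof (induction a arbitrary: b w rule: rev_induct)
  case Nil
  then have "b = []" "w = id"
    by (auto simp: reduced_word_def)
  then show ?case
    by (simp only: word_prod_Nil rank_le_refl)
next
  case (snoc i a)
  let ?w = "word_prod a"
  note D = reduced_word_snocD[OF snoc.prems(1)]
  have red: "reduced_word n a ?w"
    using D(2,4) by simp
  have w: "?w \<in> sym_grp n"
    using red by (rule reduced_word_in_sym_grp)
  have ww: "rank_le ?w w"
    using rank_le_asc[OF w D(1,5)] D(4) by simp
  obtain b1 b2 where b12: "b = b1 @ b2" "subseq b1 a" "subseq b2 [i]"
    using snoc.prems(2) by (rule subseq_appendE)
  then have "b2 = [] \<or> b2 = [i]"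
    by (cases b2) (auto split: if_splits)
  then consider "subseq b a" | b' where "b = b' @ [i]" "subseq b' a"
    using b12 by auto
  then show ?case
  proof cases
    case 1
    then show ?thesis
      using snoc.IH[OF red] ww rank_le_trans by blast
  next
    case 2
    let ?v = "word_prod b'"
    have "is_word n a"
      using red by (simp add: reduced_word_def)
    then have v: "?v \<in> sym_grp n"
      using 2(2) list_emb_set[OF 2(2)] by (intro word_prod_in_sym_grp) (auto simp: is_word_def)
    have le: "rank_le ?v ?w"
      using snoc.IH[OF red] 2 by blast
    show ?thesis
    proof (cases "asc ?v i")
      case True
      then show ?thesis
        using rank_le_both[OF v w D(1) le] D(4,5) 2 by simp
    next
      case False
      then have "rank_le (?v \<circ> simple_refl i) ?v"
        using rank_le_desc[OF v D(1)] by simp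
      then show ?thesis
        using le ww rank_le_trans 2 by (metis word_prod_snoc)
    qed
  qed
qed

text \<open>Every reduced word of \<open>w\<close> contains a reduced word of \<open>v\<close>: its
  last letter is used exactly if it is a descent of \<open>v\<close>, and the lifting property
  provides the comparison with the shortened word.\<close>

lemma subword_rank_le:
  assumes "reduced_word n a w" "v \<in> sym_grp n" "rank_le v w"
  shows "\<exists>b. subseq b a \<and> reduced_word n b v"
  using assms
proof (induction a arbitrary: v w rule: rev_induct)
  case Nil
  then have w: "w = id" by (simp add: reduced_word_def)
  \<comment> \<open>The diagonal entry of the rank matrix of the identity is already maximal, so
    \<open>v\<close> maps each \<open>{1..j}\<close> into values at most j.\<close>
  have "v j \<le> j" if "j \<in> {1..n}" for j
  proof -
    have "rank_mat id j j \<le> rank_mat v j j"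
      using Nil(3) unfolding rank_le_def w by blast
    then have "card {1..j} \<le> card {l \<in> {1..j}. v l \<le> j}"
      unfolding rank_mat_id unfolding rank_mat_def by simp
    then have eq: "{l \<in> {1..j}. v l \<le> j} = {1..j}"
      by (intro card_seteq) auto
    have "j \<in> {l \<in> {1..j}. v l \<le> j}"
      unfolding eq using that by simp
    then show ?thesis
      by simp
  qed
  then have "v = id"
    using Nil(2) by (intro permutes_natset_le[of _ "{1..n}"]) (auto simp: sym_grp_def)
  then show ?case
    using reduced_word_Nil by auto
next
  case (snoc i a)
  let ?w = "w \<circ> simple_refl i"
  note D = reduced_word_snocD[OF snoc.prems(1)]
  have w: "w \<in> sym_grp n"
    using snoc.prems(1) by (rule reduced_word_in_sym_grp)
  show ?case
  proof (cases "asc v i")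
    case True
    then have "rank_le v ?w"
      using rank_le_lift[OF snoc.prems(2) w D(1)] snoc.prems(3) D(3) by blast
    then show ?thesis
      using snoc.IH[OF D(2) snoc.prems(2)] by auto
  next
    case False
    let ?v = "v \<circ> simple_refl i"
    have "rank_le ?v ?w"
      using rank_le_both[OF snoc.prems(2) w D(1) snoc.prems(3)] False D(3) by blast
    moreover have v: "?v \<in> sym_grp n" "asc ?v i"
      using snoc.prems(2) D(1) False
      by (auto simp: comp_simple_refl_iff not_asc_iff[OF sym_grp_inj])
    ultimately obtain b where b: "subseq b a" "reduced_word n b ?v"
      using snoc.IH[OF D(2)] by blast
    have "reduced_word n (b @ [i]) v"
      using reduced_word_snoc[OF b(2) D(1) v(2)] by simp
    moreover have "subseq (b @ [i]) (a @ [i])"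
      using b(1) by simp
    ultimately show ?thesis by blast
  qed
qed

lemma bruhat_le_iff:
  "bruhat_le n v w \<longleftrightarrow> v \<in> sym_grp n \<and> w \<in> sym_grp n \<and> rank_le v w"
proof
  assume "bruhat_le n v w"
  then show "v \<in> sym_grp n \<and> w \<in> sym_grp n \<and> rank_le v w"
    using rank_le_subword reduced_word_in_sym_grp unfolding bruhat_le_def reduced_word_def by metis
next
  assume *: "v \<in> sym_grp n \<and> w \<in> sym_grp n \<and> rank_le v w"
  then obtain a where "reduced_word n a w"
    using ex_reduced_word by blast
  then show "bruhat_le n v w"
    using * subword_rank_le unfolding bruhat_le_def by blast
qed

section \<open>Laurent polynomials in q^(1/2) and the substitution q^(1/2) -> q^(-1/2)\<close>

declare fold.simps [simp del] fold_append [simp del] fold_simps [simp]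

lemma fold_snoc [simp]: "fold f (a @ [x]) s = f x (fold f a s)"
  by (simp add: fold_append o_apply)

lemma qhalf_mult [simp]: "qhalf a * qhalf b = qhalf (a + b)"
  by (simp add: qhalf_def mult_single)

lemma qhalf_mult_left [simp]: "qhalf a * (qhalf b * c) = qhalf (a + b) * c"
  by (simp flip: mult.assoc)

lemma qhalf_0 [simp]: "qhalf 0 = 1"
  by (simp add: qhalf_def)

definition laurent_bar :: "laurent \<Rightarrow> laurent" where
  "laurent_bar c = Poly_Mapping.map_key uminus c"

lemma lookup_laurent_bar [simp]: "Poly_Mapping.lookup (laurent_bar c) k = Poly_Mapping.lookup c (- k)"
proof -
  have "inj (uminus :: int \<Rightarrow> int)" by simp
  then show ?thesis
    by (simp add: laurent_bar_def map_key.rep_eq o_apply)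
qed

lemma laurent_bar_add [simp]: "laurent_bar (c + d) = laurent_bar c + laurent_bar d"
  by (rule poly_mapping_eqI) (simp add: lookup_add)

lemma laurent_bar_single: "laurent_bar (Poly_Mapping.single k x) = Poly_Mapping.single (- k) x"
  by (rule poly_mapping_eqI) (auto simp: lookup_single when_def)

lemma laurent_bar_0 [simp]: "laurent_bar 0 = 0"
  by (rule poly_mapping_eqI) simp

lemma laurent_bar_bar [simp]: "laurent_bar (laurent_bar c) = c"
  by (rule poly_mapping_eqI) simp

lemma laurent_bar_uminus [simp]: "laurent_bar (- c) = - laurent_bar c"
  by (rule poly_mapping_eqI) simp

lemma laurent_bar_diff [simp]: "laurent_bar (c - d) = laurent_bar c - laurent_bar d"
  by (rule poly_mapping_eqI) (simp add: lookup_minus)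

lemma laurent_induct [case_names zero add]:
  fixes c :: laurent
  assumes "P 0" and "\<And>c k x. P c \<Longrightarrow> P (c + Poly_Mapping.single k x)"
  shows "P c"
proof (induction c rule: update_induct)
  case (update c k x)
  have "Poly_Mapping.update k x c = c + Poly_Mapping.single k x"
    using update(1)
    by (intro poly_mapping_eqI) (auto simp: lookup_update lookup_add lookup_single in_keys_iff when_def)
  with update assms(2) show ?case by simp
qed (rule assms(1))

lemma laurent_bar_mult [simp]: "laurent_bar (c * d) = laurent_bar c * laurent_bar d"
proof (induction c rule: laurent_induct)
  case (add c k x)
  have "laurent_bar (Poly_Mapping.single k x * d) = laurent_bar (Poly_Mapping.single k x) * laurent_bar d"
    by (induction d rule: laurent_induct) (simp_all add: laurent_bar_single mult_single distrib_left)
  with add show ?case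
    by (simp add: distrib_right)
qed simp

lemma laurent_bar_qhalf [simp]: "laurent_bar (qhalf k) = qhalf (- k)"
  by (simp add: qhalf_def laurent_bar_single)

lemma laurent_bar_1 [simp]: "laurent_bar 1 = 1"
  using laurent_bar_qhalf[of 0] by simp

subsection \<open>The Hecke algebra\<close>

definition hecke_carrier :: "nat \<Rightarrow> hecke set" where
  "hecke_carrier n = {h. \<forall>u. u \<notin> sym_grp n \<longrightarrow> h u = 0}"

definition hsum :: "nat \<Rightarrow> (perm \<Rightarrow> laurent) \<Rightarrow> (perm \<Rightarrow> hecke) \<Rightarrow> hecke" where
  "hsum n c h = (\<lambda>u. \<Sum>v\<in>sym_grp n. c v * h v u)"

text \<open>The twist \<sigma> is the identity for multiplication operators and
  \<open>laurent_bar\<close> for the bar involution, so both kinds of maps are compared on the basis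
  by the same lemmas.\<close>

definition semilinear :: "(laurent \<Rightarrow> laurent) \<Rightarrow> (hecke \<Rightarrow> hecke) \<Rightarrow> bool" where
  "semilinear \<sigma> X \<longleftrightarrow> (\<forall>g h. X (hadd g h) = hadd (X g) (X h)) \<and> (\<forall>c h. X (hscale c h) = hscale (\<sigma> c) (X h))"

lemma T_basis_carrier [simp]: "w \<in> sym_grp n \<Longrightarrow> T_basis w \<in> hecke_carrier n"
  by (auto simp: hecke_carrier_def T_basis_def)

lemma hadd_carrier [simp]: "g \<in> hecke_carrier n \<Longrightarrow> h \<in> hecke_carrier n \<Longrightarrow> hadd g h \<in> hecke_carrier n"
  by (auto simp: hecke_carrier_def hadd_def)

lemma hscale_carrier [simp]: "h \<in> hecke_carrier n \<Longrightarrow> hscale c h \<in> hecke_carrier n"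
  by (auto simp: hecke_carrier_def hscale_def)

lemma hsum_carrier: "(\<And>v. v \<in> sym_grp n \<Longrightarrow> h v \<in> hecke_carrier n) \<Longrightarrow> hsum n c h \<in> hecke_carrier n"
  by (auto simp: hecke_carrier_def hsum_def)

lemma hscale_hscale [simp]: "hscale c (hscale d h) = hscale (c * d) h"
  by (simp add: hscale_def mult.assoc)

lemma hscale_1 [simp]: "hscale 1 h = h"
  by (simp add: hscale_def)

lemma hsum_expand: "h \<in> hecke_carrier n \<Longrightarrow> hsum n h T_basis = h"
  by (rule ext) (auto simp: hsum_def T_basis_def hecke_carrier_def if_distrib cong: if_cong)

lemma hsum_T_basis: "w \<in> sym_grp n \<Longrightarrow> hsum n (T_basis w) h = h w"
  by (rule ext) (simp add: hsum_def T_basis_def if_distrib[of "\<lambda>x. x * _"] cong: if_cong)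

lemma hsum_cong: "(\<And>v. v \<in> sym_grp n \<Longrightarrow> g v = h v) \<Longrightarrow> hsum n c g = hsum n c h"
  by (simp add: hsum_def)

lemma semilinear_hadd: "semilinear \<sigma> X \<Longrightarrow> X (hadd g h) = hadd (X g) (X h)"
  by (simp add: semilinear_def)

lemma semilinear_hscale: "semilinear \<sigma> X \<Longrightarrow> X (hscale c h) = hscale (\<sigma> c) (X h)"
  by (simp add: semilinear_def)

lemma semilinear_hsum:
  assumes X: "semilinear \<sigma> X"
  shows "X (hsum n c h) = hsum n (\<lambda>v. \<sigma> (c v)) (\<lambda>v. X (h v))"
proof -
  have X0: "X (\<lambda>u. 0) = (\<lambda>u. 0)"
  proof -
    have "hadd (\<lambda>u. 0) (\<lambda>u. 0) = (\<lambda>u. 0)"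
      by (simp add: hadd_def)
    then have "hadd (X (\<lambda>u. 0)) (X (\<lambda>u. 0)) = X (\<lambda>u. 0)"
      using semilinear_hadd[OF X, of "\<lambda>u. 0" "\<lambda>u. 0"] by simp
    then show ?thesis
      by (simp add: hadd_def fun_eq_iff)
  qed
  have "X (\<lambda>u. \<Sum>v\<in>A. c v * h v u) = (\<lambda>u. \<Sum>v\<in>A. \<sigma> (c v) * X (h v) u)" if "finite A" for A
    using that
  proof (induction A rule: finite_induct)
    case (insert v A)
    have *: "(\<lambda>u. \<Sum>v\<in>insert v A. c v * h v u) = hadd (hscale (c v) (h v)) (\<lambda>u. \<Sum>v\<in>A. c v * h v u)"
      using insert by (simp add: hadd_def hscale_def)
    then show ?case
      unfolding * semilinear_hadd[OF X] semilinear_hscale[OF X] using insert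
      by (simp add: hadd_def hscale_def)
  qed (simp add: X0)
  then show ?thesis
    by (simp add: hsum_def)
qed

lemma semilinear_eqI:
  assumes "semilinear \<sigma> X" "semilinear \<sigma> Y" "h \<in> hecke_carrier n"
    and "\<And>v. v \<in> sym_grp n \<Longrightarrow> X (T_basis v) = Y (T_basis v)"
  shows "X h = Y h"
proof -
  have "X (hsum n h T_basis) = Y (hsum n h T_basis)"
    unfolding semilinear_hsum[OF assms(1)] semilinear_hsum[OF assms(2)]
    using assms(4) by (intro hsum_cong) simp
  then show ?thesis
    using assms(3) by (simp add: hsum_expand)
qed

text \<open>The chosen ring and the chosen involution are specified on the carrier only.
  Precomposing with the truncation to the carrier yields a map that is semilinear everywhere and
  agrees with the given one where it matters.\<close>

lemma semilinear_on_eqI: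
  assumes add: "\<And>g h. g \<in> hecke_carrier n \<Longrightarrow> h \<in> hecke_carrier n \<Longrightarrow> X (hadd g h) = hadd (X g) (X h)"
    and scale: "\<And>c h. h \<in> hecke_carrier n \<Longrightarrow> X (hscale c h) = hscale (\<sigma> c) (X h)"
    and Y: "semilinear \<sigma> Y" and h: "h \<in> hecke_carrier n"
    and basis: "\<And>v. v \<in> sym_grp n \<Longrightarrow> X (T_basis v) = Y (T_basis v)"
  shows "X h = Y h"
proof -
  let ?r = "\<lambda>x u. if u \<in> sym_grp n then x u else (0 :: laurent)"
  have r: "?r (hadd x y) = hadd (?r x) (?r y)" "?r (hscale c x) = hscale c (?r x)"
    "?r x \<in> hecke_carrier n" for x y c
    by (auto simp: hadd_def hscale_def hecke_carrier_def)
  have restrict: "?r x = x" if "x \<in> hecke_carrier n" for x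
    using that by (auto simp: hecke_carrier_def)
  have "semilinear \<sigma> (\<lambda>x. X (?r x))"
    unfolding semilinear_def r using r by (simp add: add scale)
  then have "X (?r h) = Y h"
    by (rule semilinear_eqI[OF _ Y h]) (simp add: restrict basis)
  then show ?thesis
    using h by (simp add: restrict)
qed

lemma semilinear_comp:
  "semilinear \<sigma> X \<Longrightarrow> semilinear \<tau> Y \<Longrightarrow> semilinear (\<lambda>c. \<sigma> (\<tau> c)) (\<lambda>h. X (Y h))"
  by (simp add: semilinear_def)

lemma semilinear_ident: "semilinear (\<lambda>c. c) (\<lambda>h. h)"
  by (simp add: semilinear_def)

lemma semilinear_fold:
  "(\<And>i. semilinear (\<lambda>c. c) (X i)) \<Longrightarrow> semilinear (\<lambda>c. c) (fold X a)"
proof (induction a)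
  case (Cons i a)
  have "semilinear (\<lambda>c. c) (\<lambda>h. fold X a (X i h))"
    by (rule semilinear_comp[OF Cons.IH[OF Cons.prems] Cons.prems])
  then show ?case
    by (simp add: o_def)
qed (simp add: semilinear_def)

text \<open>
  The coefficients of \<open>h T\<^sub>s\<close>, \<open>T\<^sub>s h\<close> and \<open>h T\<^sub>s\<^sup>-\<^sup>1\<close> for the \<open>i\<close>-th
  reflection \<open>s\<close>, read off from the quadratic relation.
\<close>

definition right_mult :: "nat \<Rightarrow> hecke \<Rightarrow> hecke" where
  "right_mult i h = (\<lambda>u. if asc u i then qhalf 2 * h (u \<circ> simple_refl i)
     else h (u \<circ> simple_refl i) + (qhalf 2 - 1) * h u)"

definition left_mult :: "nat \<Rightarrow> hecke \<Rightarrow> hecke" where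
  "left_mult i h = (\<lambda>u. if asc (inv_into UNIV u) i then qhalf 2 * h (simple_refl i \<circ> u)
     else h (simple_refl i \<circ> u) + (qhalf 2 - 1) * h u)"

definition right_mult_inv :: "nat \<Rightarrow> hecke \<Rightarrow> hecke" where
  "right_mult_inv i h = (\<lambda>u. if asc u i then h (u \<circ> simple_refl i) + (qhalf (- 2) - 1) * h u
     else qhalf (- 2) * h (u \<circ> simple_refl i))"

lemma semilinear_right_mult [simp]: "semilinear (\<lambda>c. c) (right_mult i)"
  by (auto simp: semilinear_def right_mult_def hadd_def hscale_def fun_eq_iff algebra_simps)

lemma semilinear_right_mult_inv [simp]: "semilinear (\<lambda>c. c) (right_mult_inv i)"
  by (auto simp: semilinear_def right_mult_inv_def hadd_def hscale_def fun_eq_iff algebra_simps)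

lemma right_mult_carrier:
  "i \<in> {1..<n} \<Longrightarrow> h \<in> hecke_carrier n \<Longrightarrow> right_mult i h \<in> hecke_carrier n"
  using comp_simple_refl_iff by (auto simp: hecke_carrier_def right_mult_def)

lemma left_mult_carrier:
  "i \<in> {1..<n} \<Longrightarrow> h \<in> hecke_carrier n \<Longrightarrow> left_mult i h \<in> hecke_carrier n"
  using simple_refl_comp_iff by (auto simp: hecke_carrier_def left_mult_def)

lemma right_mult_inv_carrier:
  "i \<in> {1..<n} \<Longrightarrow> h \<in> hecke_carrier n \<Longrightarrow> right_mult_inv i h \<in> hecke_carrier n"
  using comp_simple_refl_iff by (auto simp: hecke_carrier_def right_mult_inv_def)

lemma fold_right_mult_carrier:
  "is_word n a \<Longrightarrow> h \<in> hecke_carrier n \<Longrightarrow> fold right_mult a h \<in> hecke_carrier n"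
  by (induction a arbitrary: h) (auto simp: right_mult_carrier)

lemma fold_right_mult_inv_carrier:
  "is_word n a \<Longrightarrow> h \<in> hecke_carrier n \<Longrightarrow> fold right_mult_inv a h \<in> hecke_carrier n"
  by (induction a arbitrary: h) (auto simp: right_mult_inv_carrier)

lemma comp_simple_refl_eq_iff: "u \<circ> simple_refl i = w \<longleftrightarrow> u = w \<circ> simple_refl i"
  by (metis comp_simple_refl_twice)

lemma simple_refl_comp_eq_iff: "simple_refl i \<circ> u = w \<longleftrightarrow> u = simple_refl i \<circ> w"
  by (metis simple_refl_twice_comp)

lemma right_mult_T_asc:
  assumes "w \<in> sym_grp n" "asc w i"
  shows "right_mult i (T_basis w) = T_basis (w \<circ> simple_refl i)"
proof
  fix u
  have "\<not> asc (w \<circ> simple_refl i) i"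
    using assms by simp
  then show "right_mult i (T_basis w) u = T_basis (w \<circ> simple_refl i) u"
    using assms(2) unfolding right_mult_def T_basis_def comp_simple_refl_eq_iff
    by (cases "u = w \<circ> simple_refl i"; cases "u = w") auto
qed

lemma right_mult_T_desc:
  assumes "w \<in> sym_grp n" "\<not> asc w i"
  shows "right_mult i (T_basis w) =
    hadd (hscale (qhalf 2) (T_basis (w \<circ> simple_refl i))) (hscale (qhalf 2 - 1) (T_basis w))"
proof
  fix u
  have *: "asc (w \<circ> simple_refl i) i"
    using assms by (simp add: not_asc_iff[OF sym_grp_inj])
  show "right_mult i (T_basis w) u = hadd (hscale (qhalf 2) (T_basis (w \<circ> simple_refl i))) (hscale (qhalf 2 - 1) (T_basis w)) u"
    using * assms(2) unfolding right_mult_def T_basis_def comp_simple_refl_eq_iff hadd_def hscale_def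
    by (cases "u = w \<circ> simple_refl i"; cases "u = w") auto
qed

lemma inv_simple_refl_comp:
  "w \<in> sym_grp n \<Longrightarrow> inv_into UNIV (simple_refl i \<circ> w) = inv_into UNIV w \<circ> simple_refl i"
  using o_inv_distrib[OF bij_simple_refl sym_grp_bij] by simp

lemma inv_comp_simple_refl:
  "w \<in> sym_grp n \<Longrightarrow> inv_into UNIV (w \<circ> simple_refl i) = simple_refl i \<circ> inv_into UNIV w"
  using o_inv_distrib[OF sym_grp_bij bij_simple_refl] by simp

lemma left_mult_T_asc:
  assumes "w \<in> sym_grp n" "asc (inv_into UNIV w) i"
  shows "left_mult i (T_basis w) = T_basis (simple_refl i \<circ> w)"
proof
  fix u
  have "\<not> asc (inv_into UNIV (simple_refl i \<circ> w)) i"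
    using assms by (simp add: inv_simple_refl_comp)
  then show "left_mult i (T_basis w) u = T_basis (simple_refl i \<circ> w) u"
    using assms(2) unfolding left_mult_def T_basis_def simple_refl_comp_eq_iff
    by (cases "u = simple_refl i \<circ> w"; cases "u = w") auto
qed

lemma right_mult_quadratic:
  assumes "i \<in> {1..<n}" "h \<in> hecke_carrier n"
  shows "right_mult i (right_mult i h) = hadd (hscale (qhalf 2) h) (hscale (qhalf 2 - 1) (right_mult i h))"
proof
  fix u
  show "right_mult i (right_mult i h) u = hadd (hscale (qhalf 2) h) (hscale (qhalf 2 - 1) (right_mult i h)) u"
  proof (cases "u \<in> sym_grp n")
    case True
    then show ?thesis
      using not_asc_iff[OF sym_grp_inj[OF True], of i]
      by (auto simp: right_mult_def hadd_def hscale_def algebra_simps)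
  next
    case False
    then have "u \<circ> simple_refl i \<notin> sym_grp n"
      using comp_simple_refl_iff[OF assms(1)] by simp
    with False assms(2) show ?thesis
      by (simp add: right_mult_def hadd_def hscale_def hecke_carrier_def)
  qed
qed

lemma right_mult_inv_quadratic:
  assumes "i \<in> {1..<n}" "h \<in> hecke_carrier n"
  shows "right_mult_inv i (right_mult_inv i h) =
    hadd (hscale (qhalf (- 2)) h) (hscale (qhalf (- 2) - 1) (right_mult_inv i h))"
proof
  fix u
  show "right_mult_inv i (right_mult_inv i h) u =
    hadd (hscale (qhalf (- 2)) h) (hscale (qhalf (- 2) - 1) (right_mult_inv i h)) u"
  proof (cases "u \<in> sym_grp n")
    case True
    then show ?thesis
      using not_asc_iff[OF sym_grp_inj[OF True], of i]
      by (auto simp: right_mult_inv_def hadd_def hscale_def algebra_simps)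
  next
    case False
    then have "u \<circ> simple_refl i \<notin> sym_grp n"
      using comp_simple_refl_iff[OF assms(1)] by simp
    with False assms(2) show ?thesis
      by (simp add: right_mult_inv_def hadd_def hscale_def hecke_carrier_def)
  qed
qed

lemma right_mult_inverse:
  assumes "i \<in> {1..<n}" "h \<in> hecke_carrier n"
  shows "right_mult i (right_mult_inv i h) = h" "right_mult_inv i (right_mult i h) = h"
proof -
  have *: "h u = 0 \<and> h (u \<circ> simple_refl i) = 0" if "u \<notin> sym_grp n" for u
    using that assms comp_simple_refl_iff[OF assms(1)] by (auto simp: hecke_carrier_def)
  show "right_mult i (right_mult_inv i h) = h"
  proof
    fix u
    show "right_mult i (right_mult_inv i h) u = h u"
      using *[of u] not_asc_iff[OF sym_grp_inj, of u n i]
      by (cases "u \<in> sym_grp n") (auto simp: right_mult_def right_mult_inv_def algebra_simps)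
  qed
  show "right_mult_inv i (right_mult i h) = h"
  proof
    fix u
    show "right_mult_inv i (right_mult i h) u = h u"
      using *[of u] not_asc_iff[OF sym_grp_inj, of u n i]
      by (cases "u \<in> sym_grp n") (auto simp: right_mult_def right_mult_inv_def algebra_simps)
  qed
qed

section \<open>Left and right multiplication by generators commute\<close>

lemma simple_refl_less_iff:
  assumes "a \<noteq> b" "\<not> (a = i \<and> b = Suc i)" "\<not> (a = Suc i \<and> b = i)"
  shows "simple_refl i a < simple_refl i b \<longleftrightarrow> a < b"
proof -
  have "simple_refl i x = (if x = i then Suc i else if x = Suc i then i else x)" for x
    by auto
  with assms show ?thesis
    by auto
qed

text \<open>Exchanging the values i and i + 1 alters the order of \<open>u j\<close> and
  \<open>u (Suc j)\<close> only if these are the two values exchanged, and then both products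
  coincide.\<close>

lemma asc_simple_refl_comp:
  assumes "inj u" "simple_refl i \<circ> u \<noteq> u \<circ> simple_refl j"
  shows "asc (simple_refl i \<circ> u) j \<longleftrightarrow> asc u j"
proof -
  have "u j \<noteq> u (Suc j)"
    using assms(1) by (simp add: inj_eq)
  moreover have "\<not> (u j = i \<and> u (Suc j) = Suc i)" "\<not> (u j = Suc i \<and> u (Suc j) = i)"
  proof -
    have "simple_refl i \<circ> u = u \<circ> simple_refl j" if *: "{u j, u (Suc j)} = {i, Suc i}"
    proof
      fix x
      have "x \<noteq> j \<Longrightarrow> x \<noteq> Suc j \<Longrightarrow> u x \<noteq> u j \<and> u x \<noteq> u (Suc j)"
        using assms(1) by (simp add: inj_eq)
      then show "(simple_refl i \<circ> u) x = (u \<circ> simple_refl j) x"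
        using * by (cases "x = j"; cases "x = Suc j") (auto simp: o_apply doubleton_eq_iff)
    qed
    with assms(2) show "\<not> (u j = i \<and> u (Suc j) = Suc i)" "\<not> (u j = Suc i \<and> u (Suc j) = i)"
      by (auto simp: insert_commute)
  qed
  ultimately show ?thesis
    by (simp add: o_apply simple_refl_less_iff)
qed

text \<open>For fixed u there are two cases. If s u = u t, both operators mix the same two
  coefficients and the left and right ascent conditions agree. Otherwise multiplication on one side
  leaves the ascent condition of the other side unchanged, so the two operators act
  independently.\<close>

lemma left_right_mult_commute:
  assumes i: "i \<in> {1..<n}" and j: "j \<in> {1..<n}" and h: "h \<in> hecke_carrier n"
  shows "left_mult i (right_mult j h) = right_mult j (left_mult i h)"
proof
  fix u
  let ?s = "simple_refl i" and ?t = "simple_refl j" and ?inv = "inv_into UNIV :: perm \<Rightarrow> perm"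
  show "left_mult i (right_mult j h) u = right_mult j (left_mult i h) u"
  proof (cases "u \<in> sym_grp n")
    case False
    then have "left_mult i (right_mult j h) u = 0" "right_mult j (left_mult i h) u = 0"
      using left_mult_carrier[OF i right_mult_carrier[OF j h]]
        right_mult_carrier[OF j left_mult_carrier[OF i h]] by (auto simp: hecke_carrier_def)
    then show ?thesis by simp
  next
    case u: True
    note inj = sym_grp_inj[OF u]
    have inv_l: "?inv (?s \<circ> u) = ?inv u \<circ> ?s" and inv_r: "?inv (u \<circ> ?t) = ?t \<circ> ?inv u"
      using u by (simp_all add: inv_simple_refl_comp inv_comp_simple_refl)
    show ?thesis
    proof (cases "?s \<circ> u = u \<circ> ?t")
      case True
      have ut: "?s \<circ> (u \<circ> ?t) = u"
        using True by (metis simple_refl_twice_comp)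
      have su: "?s \<circ> u \<circ> ?t = u"
        using True by simp
      have "?s (u j) = u (Suc j)" "u j \<noteq> u (Suc j)"
        using fun_cong[OF True, of j] inj by (auto simp: o_apply inj_eq)
      then have "(u j = i \<and> u (Suc j) = Suc i) \<or> (u j = Suc i \<and> u (Suc j) = i)"
        by (metis simple_refl_apply)
      \<comment> \<open>Both sides say that u sends j to i and j + 1 to i + 1, rather than
        exchanging the two images.\<close>
      then have asc: "asc (?inv u) i \<longleftrightarrow> asc u j"
        using inv_f_f[OF inj] by (metis lessI less_not_refl less_trans)
      show ?thesis
        using asc not_asc_iff[OF inj, of j] not_asc_iff[OF sym_grp_inj[OF inv_in_sym_grp[OF u]], of i]
        by (auto simp: left_mult_def right_mult_def ut su inv_l inv_l[unfolded True] True
            algebra_simps)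
    next
      case False
      have *: "?t \<circ> ?inv u \<noteq> ?inv u \<circ> ?s"
      proof
        assume "?t \<circ> ?inv u = ?inv u \<circ> ?s"
        then have "?inv (u \<circ> ?t) = ?inv (?s \<circ> u)"
          by (simp add: inv_l inv_r)
        then have "?inv (?inv (u \<circ> ?t)) = ?inv (?inv (?s \<circ> u))"
          by simp
        then show False
          using False u i j
          by (simp add: inv_inv_eq sym_grp_bij comp_simple_refl_iff simple_refl_comp_iff
              sym_grp_bij[of _ n])
      qed
      have "asc (?s \<circ> u) j \<longleftrightarrow> asc u j"
        using asc_simple_refl_comp[OF inj False] .
      moreover have "asc (?inv (u \<circ> ?t)) i \<longleftrightarrow> asc (?inv u) i"
        unfolding inv_r
        using asc_simple_refl_comp[OF sym_grp_inj[OF inv_in_sym_grp[OF u]] *] .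
      ultimately show ?thesis
        by (auto simp: left_mult_def right_mult_def comp_assoc algebra_simps)
    qed
  qed
qed


lemma sym_grp_left_induct [consumes 1, case_names id asc]:
  assumes "w \<in> sym_grp n"
    and "P id"
    and "\<And>w i. w \<in> sym_grp n \<Longrightarrow> i \<in> {1..<n} \<Longrightarrow> asc (inv_into UNIV w) i \<Longrightarrow> P w \<Longrightarrow> P (simple_refl i \<circ> w)"
  shows "P w"
proof -
  have "P (inv_into UNIV v)" if "v \<in> sym_grp n" for v
    using that
  proof (induction rule: sym_grp_induct)
    case id
    then show ?case
      using assms(2) by (simp only: inv_id)
  next
    case (asc v i)
    then show ?case
      using assms(3)[of "inv_into UNIV v" i]
      by (simp add: inv_comp_simple_refl inv_in_sym_grp inv_inv_eq sym_grp_bij)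
  qed
  from this[of "inv_into UNIV w"] show ?thesis
    using assms(1) by (simp add: inv_in_sym_grp inv_inv_eq sym_grp_bij)
qed

lemma fold_right_mult_T_id:
  "reduced_word n a w \<Longrightarrow> fold right_mult a (T_basis id) = T_basis w"
proof (induction a arbitrary: w rule: rev_induct)
  case Nil
  then show ?case
    by (simp add: reduced_word_def id_apply)
next
  case (snoc i a)
  note D = reduced_word_snocD[OF snoc.prems]
  have "asc (w \<circ> simple_refl i) i"
    using D(3) by (simp add: not_asc_iff[OF sym_grp_inj[OF reduced_word_in_sym_grp[OF snoc.prems]]])
  then show ?case
    using snoc.IH[OF D(2)] right_mult_T_asc[OF reduced_word_in_sym_grp[OF D(2)], of i]
    by simp
qed

lemma left_mult_fold_commute:
  "is_word n a \<Longrightarrow> i \<in> {1..<n} \<Longrightarrow> h \<in> hecke_carrier n \<Longrightarrow>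
    left_mult i (fold right_mult a h) = fold right_mult a (left_mult i h)"
  by (induction a arbitrary: h) (auto simp: right_mult_carrier left_right_mult_commute)

text \<open>
  Both sides commute with multiplication from the left and agree on the unit element; hence right
  multiplication by a reduced word depends only on the permutation, without using braid relations.
\<close>

lemma fold_right_mult_unique:
  assumes a: "reduced_word n a w" and b: "reduced_word n b w" and "h \<in> hecke_carrier n"
  shows "fold right_mult a h = fold right_mult b h"
proof (rule semilinear_eqI[OF _ _ assms(3)])
  show "semilinear (\<lambda>c. c) (fold right_mult a)" "semilinear (\<lambda>c. c) (fold right_mult b)"
    by (simp_all add: semilinear_fold)
  fix v assume "v \<in> sym_grp n"
  then show "fold right_mult a (T_basis v) = fold right_mult b (T_basis v)"
  proof (induction rule: sym_grp_left_induct)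
    case id
    then show ?case
      using fold_right_mult_T_id a b by simp
  next
    case (asc v i)
    have "is_word n a" "is_word n b"
      using a b by (auto simp: reduced_word_def)
    then show ?case
      using left_mult_fold_commute[of n a i "T_basis v"] left_mult_fold_commute[of n b i "T_basis v"]
        left_mult_T_asc[OF asc(1,3)] asc by simp
  qed
qed

section \<open>The product of the Hecke algebra\<close>

definition rword :: "nat \<Rightarrow> perm \<Rightarrow> nat list" where
  "rword n w = (SOME a. reduced_word n a w)"

lemma reduced_rword: "w \<in> sym_grp n \<Longrightarrow> reduced_word n (rword n w) w"
  unfolding rword_def using ex_reduced_word by (rule someI_ex)

lemma is_word_rword: "w \<in> sym_grp n \<Longrightarrow> is_word n (rword n w)"
  using reduced_rword by (auto simp: reduced_word_def)

text \<open>The right regular representation: each T_w acts through the letters of a reduced word of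
  w, whose choice is immaterial by \<open>fold_right_mult_unique\<close>. Linearity in the right
  factor is built in.\<close>

definition hmul :: "nat \<Rightarrow> hecke \<Rightarrow> hecke \<Rightarrow> hecke" where
  "hmul n g h = hsum n h (\<lambda>w. fold right_mult (rword n w) g)"

lemma hmul_carrier: "g \<in> hecke_carrier n \<Longrightarrow> hmul n g h \<in> hecke_carrier n"
  unfolding hmul_def by (intro hsum_carrier fold_right_mult_carrier is_word_rword)

lemma semilinear_hmul_right: "semilinear (\<lambda>c. c) (hmul n g)"
  by (auto simp: semilinear_def hmul_def hsum_def hadd_def hscale_def algebra_simps sum.distrib
      sum_distrib_left)

lemma semilinear_hmul_left: "semilinear (\<lambda>c. c) (\<lambda>g. hmul n g h)"
proof -
  have X: "semilinear (\<lambda>c. c) (fold right_mult a)" for a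
    by (simp add: semilinear_fold)
  show ?thesis
    unfolding semilinear_def hmul_def semilinear_hadd[OF X] semilinear_hscale[OF X]
    by (auto simp: hsum_def hadd_def hscale_def algebra_simps sum.distrib sum_distrib_left)
qed

lemma hmul_T:
  assumes "reduced_word n a w" "g \<in> hecke_carrier n"
  shows "hmul n g (T_basis w) = fold right_mult a g"
proof -
  have w: "w \<in> sym_grp n"
    using assms(1) by (rule reduced_word_in_sym_grp)
  show ?thesis
    using fold_right_mult_unique[OF reduced_rword[OF w] assms] w by (simp add: hmul_def hsum_T_basis)
qed

text \<open>Associativity with a generator as third factor. On a basis element with an ascent the
  letter extends a reduced word; with a descent the element is T_v T_s for a shorter v, and the
  quadratic relation holds on both sides. All of associativity then follows letter by
  letter.\<close>

lemma right_mult_hmul: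
  assumes i: "i \<in> {1..<n}" and g: "g \<in> hecke_carrier n" and h: "h \<in> hecke_carrier n"
  shows "hmul n g (right_mult i h) = right_mult i (hmul n g h)"
proof (rule semilinear_eqI[OF _ _ h])
  show "semilinear (\<lambda>c. c) (\<lambda>h. hmul n g (right_mult i h))" "semilinear (\<lambda>c. c) (\<lambda>h. right_mult i (hmul n g h))"
    using semilinear_comp[OF semilinear_hmul_right semilinear_right_mult]
      semilinear_comp[OF semilinear_right_mult semilinear_hmul_right] by auto
  fix w assume w: "w \<in> sym_grp n"
  show "hmul n g (right_mult i (T_basis w)) = right_mult i (hmul n g (T_basis w))"
  proof (cases "asc w i")
    case True
    then show ?thesis
      using hmul_T[OF reduced_word_snoc[OF reduced_rword[OF w] i True] g] hmul_T[OF reduced_rword[OF w] g]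
      by (simp add: right_mult_T_asc[OF w])
  next
    case False
    define v where "v = w \<circ> simple_refl i"
    have v: "v \<in> sym_grp n" "asc v i" "w = v \<circ> simple_refl i"
      using False w i by (auto simp: v_def comp_simple_refl_iff not_asc_iff[OF sym_grp_inj])
    let ?x = "fold right_mult (rword n v) g"
    have x: "?x \<in> hecke_carrier n"
      using g v by (simp add: fold_right_mult_carrier is_word_rword)
    have "hmul n g (T_basis v) = ?x"
      using hmul_T[OF reduced_rword[OF v(1)] g] .
    moreover have "hmul n g (T_basis w) = right_mult i ?x"
      using hmul_T[OF reduced_word_snoc[OF reduced_rword[OF v(1)] i v(2)] g] v by simp
    ultimately show ?thesis
      using right_mult_quadratic[OF i x] right_mult_T_desc[OF w False]
      by (simp add: semilinear_hadd[OF semilinear_hmul_right] semilinear_hscale[OF semilinear_hmul_right]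
          flip: v_def)
  qed
qed

lemma fold_right_mult_hmul:
  "is_word n a \<Longrightarrow> g \<in> hecke_carrier n \<Longrightarrow> h \<in> hecke_carrier n \<Longrightarrow>
    hmul n g (fold right_mult a h) = fold right_mult a (hmul n g h)"
  by (induction a arbitrary: h) (auto simp: right_mult_carrier right_mult_hmul)

lemma right_mult_inv_hmul:
  assumes "i \<in> {1..<n}" "g \<in> hecke_carrier n" "h \<in> hecke_carrier n"
  shows "hmul n g (right_mult_inv i h) = right_mult_inv i (hmul n g h)"
proof -
  have "hmul n g h = right_mult i (hmul n g (right_mult_inv i h))"
    using right_mult_hmul[OF assms(1,2) right_mult_inv_carrier[OF assms(1,3)]]
      right_mult_inverse[OF assms(1,3)] by simp
  then show ?thesis
    using right_mult_inverse(2)[OF assms(1), of "hmul n g (right_mult_inv i h)"] assms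
    by (simp add: hmul_carrier)
qed

lemma fold_right_mult_inv_hmul:
  "is_word n a \<Longrightarrow> g \<in> hecke_carrier n \<Longrightarrow> h \<in> hecke_carrier n \<Longrightarrow>
    hmul n g (fold right_mult_inv a h) = fold right_mult_inv a (hmul n g h)"
  by (induction a arbitrary: h) (auto simp: right_mult_inv_carrier right_mult_inv_hmul)

lemma hmul_T_id_right: "g \<in> hecke_carrier n \<Longrightarrow> hmul n g (T_basis id) = g"
  using hmul_T[OF reduced_word_Nil] by simp

lemma hmul_T_id_left:
  assumes "h \<in> hecke_carrier n"
  shows "hmul n (T_basis id) h = h"
proof (rule semilinear_eqI[OF semilinear_hmul_right semilinear_ident assms])
  fix v assume "v \<in> sym_grp n"
  then show "hmul n (T_basis id) (T_basis v) = T_basis v"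
    using hmul_T fold_right_mult_T_id reduced_rword T_basis_carrier[OF id_in_sym_grp] by metis
qed

lemma hmul_assoc:
  assumes "f \<in> hecke_carrier n" "g \<in> hecke_carrier n" "h \<in> hecke_carrier n"
  shows "hmul n (hmul n f g) h = hmul n f (hmul n g h)"
proof (rule semilinear_eqI[OF semilinear_hmul_right semilinear_comp[OF semilinear_hmul_right semilinear_hmul_right] assms(3)])
  fix v assume v: "v \<in> sym_grp n"
  show "hmul n (hmul n f g) (T_basis v) = hmul n f (hmul n g (T_basis v))"
    using hmul_T[OF reduced_rword[OF v]] assms fold_right_mult_hmul[OF is_word_rword[OF v] assms(1,2)]
    by (simp add: hmul_carrier)
qed

lemma perm_length_comp_word:
  "v \<in> sym_grp n \<Longrightarrow> is_word n a \<Longrightarrow> perm_length n (v \<circ> word_prod a) \<le> perm_length n v + length a"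
proof (induction a rule: rev_induct)
  case (snoc i a)
  then have "v \<circ> word_prod a \<in> sym_grp n" "i \<in> {1..<n}"
    by (auto intro: comp_in_sym_grp word_prod_in_sym_grp)
  from perm_length_comp_simple_refl_le[OF this] show ?case
    using snoc by (simp add: comp_assoc)
qed simp

text \<open>Additivity of the lengths leaves no slack: each letter raises the length by at most one,
  so all of them must be ascents.\<close>

lemma fold_right_mult_T:
  assumes "v \<in> sym_grp n" "reduced_word n a w" "perm_length n (v \<circ> w) = perm_length n v + perm_length n w"
  shows "fold right_mult a (T_basis v) = T_basis (v \<circ> w)"
  using assms(2,3)
proof (induction a arbitrary: w rule: rev_induct)
  case Nil
  then have "w = id"
    by (simp add: reduced_word_def)
  then show ?case
    by simp
next
  case (snoc i a)
  note D = reduced_word_snocD[OF snoc.prems(1)]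
  let ?w = "w \<circ> simple_refl i"
  have w: "?w \<in> sym_grp n" "v \<circ> ?w \<in> sym_grp n"
    using D(2) assms(1) by (auto intro: comp_in_sym_grp reduced_word_in_sym_grp)
  have a: "is_word n a" "word_prod a = ?w" "length a = perm_length n ?w" "perm_length n w = Suc (length a)"
    using D(2) snoc.prems(1) by (auto simp: reduced_word_def)
  have eq: "v \<circ> w = v \<circ> ?w \<circ> simple_refl i"
    by (simp add: comp_assoc)
  have "perm_length n (v \<circ> ?w) \<le> perm_length n v + length a"
    using perm_length_comp_word[OF assms(1) a(1)] a by simp
  moreover have "perm_length n (v \<circ> w) \<le> Suc (perm_length n (v \<circ> ?w))"
    unfolding eq using perm_length_comp_simple_refl_le[OF w(2) D(1)] .
  ultimately have len: "perm_length n (v \<circ> ?w) = perm_length n v + length a"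
    "perm_length n (v \<circ> w) = Suc (perm_length n (v \<circ> ?w))"
    using snoc.prems(2) a(4) by linarith+
  have "asc (v \<circ> ?w) i"
  proof (rule ccontr)
    assume "\<not> ?thesis"
    from perm_length_desc[OF w(2) D(1) this] len(2) show False
      unfolding eq by simp
  qed
  then have "right_mult i (T_basis (v \<circ> ?w)) = T_basis (v \<circ> w)"
    using right_mult_T_asc[OF w(2)] eq by simp
  then show ?case
    using snoc.IH[OF D(2)] len(1) a(3) by simp
qed

lemma hmul_T_T:
  assumes "v \<in> sym_grp n" "w \<in> sym_grp n" "perm_length n (v \<circ> w) = perm_length n v + perm_length n w"
  shows "hmul n (T_basis v) (T_basis w) = T_basis (v \<circ> w)"
  using fold_right_mult_T[OF assms(1) reduced_rword[OF assms(2)] assms(3)]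
    hmul_T[OF reduced_rword[OF assms(2)]] assms by simp

lemma reduced_word_single: "i \<in> {1..<n} \<Longrightarrow> reduced_word n [i] (simple_refl i)"
  using reduced_word_snoc[OF reduced_word_Nil, of i n] by (simp add: id_apply)

lemma hmul_T_simple_refl:
  "i \<in> {1..<n} \<Longrightarrow> g \<in> hecke_carrier n \<Longrightarrow> hmul n g (T_basis (simple_refl i)) = right_mult i g"
  using hmul_T[OF reduced_word_single] by simp

definition hecke_ring :: "nat \<Rightarrow> hecke ring" where
  "hecke_ring n = \<lparr>carrier = hecke_carrier n, mult = hmul n, one = T_basis id, zero = (\<lambda>u. 0), add = hadd\<rparr>"

lemma ring_hecke_ring: "ring (hecke_ring n)"
proof (rule ringI)
  show "abelian_group (hecke_ring n)"
  proof (rule abelian_groupI)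
    fix x assume "x \<in> carrier (hecke_ring n)"
    then show "\<exists>y\<in>carrier (hecke_ring n). y \<oplus>\<^bsub>hecke_ring n\<^esub> x = \<zero>\<^bsub>hecke_ring n\<^esub>"
      by (intro bexI[of _ "hscale (- 1) x"]) (auto simp: hecke_ring_def hadd_def hscale_def hecke_carrier_def)
  qed (auto simp: hecke_ring_def hadd_def hecke_carrier_def add.assoc add.commute)
  show "monoid (hecke_ring n)"
    by (rule monoidI) (auto simp: hecke_ring_def hmul_carrier hmul_assoc hmul_T_id_left hmul_T_id_right)
qed (auto simp: hecke_ring_def semilinear_hadd[OF semilinear_hmul_right]
    semilinear_hadd[OF semilinear_hmul_left])

lemma is_hecke_algebra_hecke_ring: "is_hecke_algebra n (hecke_ring n)"
proof -
  have "hmul n (T_basis (simple_refl i)) (T_basis (simple_refl i)) =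
      hadd (hscale (qhalf 2 - 1) (T_basis (simple_refl i))) (hscale (qhalf 2) (T_basis id))"
    if "i \<in> {1..<n}" for i
    using that right_mult_T_desc[OF simple_refl_in_sym_grp[OF that], of i]
    by (simp add: hmul_T_simple_refl simple_refl_in_sym_grp) (simp add: hadd_def add.commute)
  then show ?thesis
    unfolding is_hecke_algebra_def
    using ring_hecke_ring[of n] hmul_T_T semilinear_hscale[OF semilinear_hmul_right]
      semilinear_hscale[OF semilinear_hmul_left]
    by (simp add: hecke_ring_def hecke_carrier_def[symmetric])
qed

subsection \<open>Uniqueness of the Hecke algebra\<close>

text \<open>Right multiplication by a generator T_s is forced: at an ascent by additivity of
  lengths, at a descent by writing T_v = T_w T_s and using associativity and the quadratic relation.
  As every T_w is a product of generators, associativity forces all other products. Hence the choice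
  made in \<open>hecke_algebra\<close> is harmless.\<close>

lemma is_hecke_algebra_mult:
  assumes R: "is_hecke_algebra n R" and g: "g \<in> hecke_carrier n" and h: "h \<in> hecke_carrier n"
  shows "mult R g h = hmul n g h"
proof -
  interpret ring R
    using R by (simp add: is_hecke_algebra_def)
  have car: "carrier R = hecke_carrier n" and add: "add R = hadd" and one: "one R = T_basis id"
    using R by (simp_all add: is_hecke_algebra_def hecke_carrier_def)
  have scale: "mult R (hscale c x) y = hscale c (mult R x y)" "mult R x (hscale c y) = hscale c (mult R x y)"
    if "x \<in> hecke_carrier n" "y \<in> hecke_carrier n" for c x y
    using R that by (simp_all add: is_hecke_algebra_def hecke_carrier_def)
  have TT: "mult R (T_basis v) (T_basis w) = T_basis (v \<circ> w)"
    if "v \<in> sym_grp n" "w \<in> sym_grp n" "perm_length n (v \<circ> w) = perm_length n v + perm_length n w" for v w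
    using R that by (simp add: is_hecke_algebra_def)
  have TsTs: "mult R (T_basis (simple_refl i)) (T_basis (simple_refl i)) =
      hadd (hscale (qhalf 2 - 1) (T_basis (simple_refl i))) (hscale (qhalf 2) (T_basis id))"
    if "i \<in> {1..<n}" for i
    using R that by (simp add: is_hecke_algebra_def)
  have closed: "mult R x y \<in> hecke_carrier n" if "x \<in> hecke_carrier n" "y \<in> hecke_carrier n" for x y
    using m_closed that by (simp add: car)
  have distrib: "mult R (hadd x y) z = hadd (mult R x z) (mult R y z)"
    "mult R z (hadd x y) = hadd (mult R z x) (mult R z y)"
    if "x \<in> hecke_carrier n" "y \<in> hecke_carrier n" "z \<in> hecke_carrier n" for x y z
    using l_distr[of x y z] r_distr[of x y z] that by (simp_all add: car add)
  have Ts: "mult R x (T_basis (simple_refl i)) = right_mult i x"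
    if i: "i \<in> {1..<n}" and x: "x \<in> hecke_carrier n" for i x
  proof -
    note s = simple_refl_in_sym_grp[OF i]
    show ?thesis
    proof (rule semilinear_on_eqI[OF _ _ semilinear_right_mult x, of "\<lambda>x. mult R x (T_basis (simple_refl i))"])
      fix v assume v: "v \<in> sym_grp n"
      have asc: "mult R (T_basis v) (T_basis (simple_refl i)) = T_basis (v \<circ> simple_refl i)"
        if "asc v i" "v \<in> sym_grp n" for v
        using TT[OF that(2) s] perm_length_asc[OF that(2) i that(1)] perm_length_simple_refl[OF i] by simp
      show "mult R (T_basis v) (T_basis (simple_refl i)) = right_mult i (T_basis v)"
      proof (cases "asc v i")
        case True
        then show ?thesis
          using asc[OF True v] right_mult_T_asc[OF v True] by simp
      next
        case False
        define w where "w = v \<circ> simple_refl i"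
        have w: "w \<in> sym_grp n" "asc w i" "v = w \<circ> simple_refl i"
          using False v i by (auto simp: w_def comp_simple_refl_iff not_asc_iff[OF sym_grp_inj])
        have "T_basis v = mult R (T_basis w) (T_basis (simple_refl i))"
          using asc[OF w(2,1)] w(3) by simp
        then have "mult R (T_basis v) (T_basis (simple_refl i)) =
            mult R (T_basis w) (mult R (T_basis (simple_refl i)) (T_basis (simple_refl i)))"
          using m_assoc w s by (simp add: car)
        also have "\<dots> = hadd (hscale (qhalf 2 - 1) (T_basis v)) (hscale (qhalf 2) (T_basis w))"
          using w s r_one[of "T_basis w"] asc[OF w(2,1)] by (simp add: TsTs[OF i] distrib scale car one)
        finally show ?thesis
          using right_mult_T_desc[OF v False] by (simp add: w_def hadd_def add.commute)
      qed
    qed (simp_all add: distrib scale s)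
  qed
  show ?thesis
  proof (rule semilinear_on_eqI[OF _ _ semilinear_hmul_right h, of "mult R g"])
    fix w assume "w \<in> sym_grp n"
    then show "mult R g (T_basis w) = hmul n g (T_basis w)"
    proof (induction rule: sym_grp_induct)
      case id
      then show ?case
        using g r_one[of g] by (simp add: hmul_T_id_right car one)
    next
      case (asc w i)
      note s = simple_refl_in_sym_grp[OF asc(2)]
      have Tw: "T_basis (w \<circ> simple_refl i) = right_mult i (T_basis w)"
        using right_mult_T_asc[OF asc(1,3)] by simp
      also have "\<dots> = mult R (T_basis w) (T_basis (simple_refl i))"
        using Ts[OF asc(2)] asc(1) by simp
      finally have "mult R g (T_basis (w \<circ> simple_refl i)) = right_mult i (mult R g (T_basis w))"
        using m_assoc[of g "T_basis w" "T_basis (simple_refl i)"] g asc(1) s Ts[OF asc(2)] closed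
        by (simp add: car)
      then show ?case
        using asc g Tw by (simp add: right_mult_hmul)
    qed
  qed (simp_all add: distrib scale g)
qed

lemma is_hecke_algebra: "is_hecke_algebra n (hecke_algebra n)"
  unfolding hecke_algebra_def using is_hecke_algebra_hecke_ring by (rule someI)

lemma hecke_algebra_simps:
  "ring (hecke_algebra n)" "carrier (hecke_algebra n) = hecke_carrier n"
  "add (hecke_algebra n) = hadd" "one (hecke_algebra n) = T_basis id" "zero (hecke_algebra n) = (\<lambda>u. 0)"
  "g \<in> hecke_carrier n \<Longrightarrow> h \<in> hecke_carrier n \<Longrightarrow> mult (hecke_algebra n) g h = hmul n g h"
  using is_hecke_algebra[of n] is_hecke_algebra_mult[OF is_hecke_algebra]
  by (simp_all add: is_hecke_algebra_def hecke_carrier_def)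

subsection \<open>The bar involution\<close>

text \<open>This is the inverse of the basis element of \<open>inv_into UNIV w\<close>. Passing to
  the inverse permutation reverses the word and inverting the product reverses it back, so the
  letters are those of a word of \<open>w\<close> in the original order.\<close>

definition T_bar :: "nat \<Rightarrow> perm \<Rightarrow> hecke" where
  "T_bar n w = fold right_mult_inv (rword n w) (T_basis id)"

definition hbar :: "nat \<Rightarrow> hecke \<Rightarrow> hecke" where
  "hbar n h = hsum n (\<lambda>w. laurent_bar (h w)) (T_bar n)"

lemma fold_right_mult_inverse:
  assumes "is_word n a" "h \<in> hecke_carrier n"
  shows "fold right_mult_inv a (fold right_mult (rev a) h) = h"
    "fold right_mult (rev a) (fold right_mult_inv a h) = h"
proof -
  show "fold right_mult_inv a (fold right_mult (rev a) h) = h"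
    using assms
  proof (induction a arbitrary: h rule: rev_induct)
    case (snoc i a)
    then show ?case
      by (auto simp: right_mult_inverse right_mult_carrier)
  qed simp
  show "fold right_mult (rev a) (fold right_mult_inv a h) = h"
    using assms
  proof (induction a arbitrary: h)
    case (Cons i a)
    then show ?case
      by (auto simp: right_mult_inverse right_mult_inv_carrier)
  qed simp
qed

lemma T_bar_carrier [simp]: "w \<in> sym_grp n \<Longrightarrow> T_bar n w \<in> hecke_carrier n"
  unfolding T_bar_def by (intro fold_right_mult_inv_carrier is_word_rword) simp_all

lemma word_inverse:
  assumes "reduced_word n a w"
  shows "hmul n (T_basis (inv_into UNIV w)) (fold right_mult_inv a (T_basis id)) = T_basis id"
    "hmul n (fold right_mult_inv a (T_basis id)) (T_basis (inv_into UNIV w)) = T_basis id"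
proof -
  have a: "is_word n a"
    using assms by (simp add: reduced_word_def)
  have T: "fold right_mult (rev a) (T_basis id) = T_basis (inv_into UNIV w)"
    using fold_right_mult_T_id[OF reduced_word_rev[OF assms]] .
  have w: "inv_into UNIV w \<in> sym_grp n"
    using reduced_word_in_sym_grp[OF reduced_word_rev[OF assms]] .
  have x: "fold right_mult_inv a (T_basis id) \<in> hecke_carrier n"
    using a by (simp add: fold_right_mult_inv_carrier)
  show "hmul n (T_basis (inv_into UNIV w)) (fold right_mult_inv a (T_basis id)) = T_basis id"
    using fold_right_mult_inv_hmul[OF a, of "T_basis (inv_into UNIV w)" "T_basis id"] w a
      fold_right_mult_inverse(1)[OF a, of "T_basis id"] T by (simp add: hmul_T_id_right)
  show "hmul n (fold right_mult_inv a (T_basis id)) (T_basis (inv_into UNIV w)) = T_basis id"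
    using hmul_T[OF reduced_word_rev[OF assms] x] fold_right_mult_inverse(2)[OF a, of "T_basis id"]
    by simp
qed

lemma T_bar_inverse:
  assumes "w \<in> sym_grp n"
  shows "hmul n (T_basis (inv_into UNIV w)) (T_bar n w) = T_basis id"
    "hmul n (T_bar n w) (T_basis (inv_into UNIV w)) = T_basis id"
  unfolding T_bar_def using word_inverse[OF reduced_rword[OF assms]] by auto

text \<open>The product along any reduced word is a two-sided inverse of the same basis element, and
  inverses are unique.\<close>

lemma T_bar_eq:
  assumes "reduced_word n a w"
  shows "T_bar n w = fold right_mult_inv a (T_basis id)"
proof -
  have w: "w \<in> sym_grp n" "inv_into UNIV w \<in> sym_grp n"
    using reduced_word_in_sym_grp[OF assms] inv_in_sym_grp by auto
  have x: "fold right_mult_inv a (T_basis id) \<in> hecke_carrier n"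
    using assms by (simp add: fold_right_mult_inv_carrier reduced_word_def)
  have "hmul n (T_bar n w) (hmul n (T_basis (inv_into UNIV w)) (fold right_mult_inv a (T_basis id))) =
      hmul n (hmul n (T_bar n w) (T_basis (inv_into UNIV w))) (fold right_mult_inv a (T_basis id))"
    using w x by (simp add: hmul_assoc)
  then show ?thesis
    using w x by (simp add: word_inverse[OF assms] T_bar_inverse hmul_T_id_left hmul_T_id_right)
qed

lemma hbar_T [simp]: "w \<in> sym_grp n \<Longrightarrow> hbar n (T_basis w) = T_bar n w"
proof -
  assume w: "w \<in> sym_grp n"
  have "(\<lambda>u. laurent_bar (T_basis w u)) = T_basis w"
    by (auto simp: T_basis_def)
  then show ?thesis
    using w by (simp add: hbar_def hsum_T_basis)
qed

lemma T_bar_id: "T_bar n id = T_basis id"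
  using T_bar_eq[OF reduced_word_Nil] by simp

lemma T_bar_asc:
  assumes "w \<in> sym_grp n" "i \<in> {1..<n}" "asc w i"
  shows "T_bar n (w \<circ> simple_refl i) = right_mult_inv i (T_bar n w)"
  using T_bar_eq[OF reduced_word_snoc[OF reduced_rword[OF assms(1)] assms(2,3)]]
  by (simp add: T_bar_def)

lemma semilinear_hbar: "semilinear laurent_bar (hbar n)"
  by (auto simp: semilinear_def hbar_def hsum_def hadd_def hscale_def algebra_simps sum.distrib
      sum_distrib_left)

lemma hbar_carrier [simp]: "hbar n h \<in> hecke_carrier n"
  unfolding hbar_def by (intro hsum_carrier) simp

text \<open>At an ascent this extends the word. At a descent, the image of the quadratic relation of
  T_s under q -> q^(-1) is the quadratic relation of the inverse generator.\<close>

lemma hbar_right_mult: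
  assumes i: "i \<in> {1..<n}" and h: "h \<in> hecke_carrier n"
  shows "hbar n (right_mult i h) = right_mult_inv i (hbar n h)"
proof (rule semilinear_eqI[OF _ _ h])
  show "semilinear laurent_bar (\<lambda>h. hbar n (right_mult i h))"
    "semilinear laurent_bar (\<lambda>h. right_mult_inv i (hbar n h))"
    using semilinear_comp[OF semilinear_hbar semilinear_right_mult]
      semilinear_comp[OF semilinear_right_mult_inv semilinear_hbar] by auto
  fix w assume w: "w \<in> sym_grp n"
  have ws: "w \<circ> simple_refl i \<in> sym_grp n"
    using w i by (simp add: comp_simple_refl_iff)
  show "hbar n (right_mult i (T_basis w)) = right_mult_inv i (hbar n (T_basis w))"
  proof (cases "asc w i")
    case True
    then show ?thesis
      using w ws i by (simp add: right_mult_T_asc T_bar_asc)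
  next
    case False
    define v where "v = w \<circ> simple_refl i"
    have v: "v \<in> sym_grp n" "asc v i" "w = v \<circ> simple_refl i"
      using False w i by (auto simp: v_def comp_simple_refl_iff not_asc_iff[OF sym_grp_inj])
    have T: "T_bar n w = right_mult_inv i (T_bar n v)"
      using T_bar_asc[OF v(1) i v(2)] v(3) by simp
    have "hbar n (right_mult i (T_basis w)) =
        hadd (hscale (qhalf (- 2)) (T_bar n v)) (hscale (qhalf (- 2) - 1) (T_bar n w))"
      unfolding right_mult_T_desc[OF w False] v_def[symmetric] using w v(1)
      by (simp add: semilinear_hadd[OF semilinear_hbar] semilinear_hscale[OF semilinear_hbar])
    also have "\<dots> = right_mult_inv i (T_bar n w)"
      using right_mult_inv_quadratic[OF i T_bar_carrier[OF v(1)]] by (simp add: T)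
    finally show ?thesis
      using w by simp
  qed
qed

lemma hbar_fold_right_mult:
  "is_word n a \<Longrightarrow> h \<in> hecke_carrier n \<Longrightarrow> hbar n (fold right_mult a h) = fold right_mult_inv a (hbar n h)"
  by (induction a arbitrary: h) (auto simp: right_mult_carrier hbar_right_mult)

lemma hbar_right_mult_inv:
  assumes i: "i \<in> {1..<n}" and h: "h \<in> hecke_carrier n"
  shows "hbar n (right_mult_inv i h) = right_mult i (hbar n h)"
  using hbar_right_mult[OF i right_mult_inv_carrier[OF assms]] right_mult_inverse[OF i] h
  by simp

lemma hbar_fold_right_mult_inv:
  "is_word n a \<Longrightarrow> h \<in> hecke_carrier n \<Longrightarrow> hbar n (fold right_mult_inv a h) = fold right_mult a (hbar n h)"
  by (induction a arbitrary: h) (auto simp: right_mult_inv_carrier hbar_right_mult_inv)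

lemma hbar_hmul:
  assumes g: "g \<in> hecke_carrier n" and h: "h \<in> hecke_carrier n"
  shows "hbar n (hmul n g h) = hmul n (hbar n g) (hbar n h)"
proof (rule semilinear_eqI[OF semilinear_comp[OF semilinear_hbar semilinear_hmul_right]
      semilinear_comp[OF semilinear_hmul_right semilinear_hbar] h])
  fix w assume w: "w \<in> sym_grp n"
  have "hbar n (hmul n g (T_basis w)) = fold right_mult_inv (rword n w) (hbar n g)"
    using w g by (simp add: hmul_T[OF reduced_rword] hbar_fold_right_mult is_word_rword)
  also have "\<dots> = hmul n (hbar n g) (T_bar n w)"
    unfolding T_bar_def using w by (simp add: fold_right_mult_inv_hmul is_word_rword hmul_T_id_right)
  finally show "hbar n (hmul n g (T_basis w)) = hmul n (hbar n g) (hbar n (T_basis w))"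
    using w by simp
qed

lemma hbar_hbar:
  assumes h: "h \<in> hecke_carrier n"
  shows "hbar n (hbar n h) = h"
proof -
  have "semilinear (\<lambda>c. c) (\<lambda>h. hbar n (hbar n h))"
    using semilinear_comp[OF semilinear_hbar semilinear_hbar] by simp
  then show ?thesis
  proof (rule semilinear_eqI[OF _ semilinear_ident h])
    fix w assume w: "w \<in> sym_grp n"
    then show "hbar n (hbar n (T_basis w)) = T_basis w"
      by (simp add: T_bar_def hbar_fold_right_mult_inv is_word_rword T_bar_id[unfolded T_bar_def]
          fold_right_mult_T_id[OF reduced_rword] T_bar_id)
  qed
qed

lemma is_bar_involution_hbar: "is_bar_involution n (hbar n)"
proof -
  have "hbar n \<in> ring_hom (hecke_algebra n) (hecke_algebra n)"
    by (rule ring_hom_memI)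
      (auto simp: hecke_algebra_simps hbar_hmul semilinear_hadd[OF semilinear_hbar] hmul_carrier T_bar_id)
  moreover have "bij_betw (hbar n) (hecke_carrier n) (hecke_carrier n)"
    by (rule bij_betwI[of _ _ _ "hbar n"]) (auto simp: hbar_hbar)
  moreover have "hbar n (hscale (qhalf 1) (T_basis id)) = hscale (qhalf (- 1)) (T_basis id)"
    by (simp add: semilinear_hscale[OF semilinear_hbar] T_bar_id)
  moreover have "T_basis (inv_into UNIV w) \<in> Units (hecke_algebra n) \<and>
      hbar n (T_basis w) = m_inv (hecke_algebra n) (T_basis (inv_into UNIV w))" if w: "w \<in> sym_grp n" for w
  proof -
    interpret ring "hecke_algebra n"
      by (rule hecke_algebra_simps)
    have "T_basis (inv_into UNIV w) \<in> hecke_carrier n" "T_bar n w \<in> hecke_carrier n"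
      using w by (auto simp: inv_in_sym_grp)
    then show ?thesis
      using T_bar_inverse[OF w] w
        inv_char[of "T_basis (inv_into UNIV w)" "T_bar n w"]
      by (auto simp: hecke_algebra_simps Units_def)
  qed
  ultimately show ?thesis
    by (simp add: is_bar_involution_def ring_iso_def hecke_algebra_simps)
qed

lemma is_bar_involution: "is_bar_involution n (bar_involution n)"
  unfolding bar_involution_def by (rule someI[of "is_bar_involution n" "hbar n"]) (rule is_bar_involution_hbar)

text \<open>A ring automorphism is only known to be additive and multiplicative, so its
  semilinearity has to be derived. Scalars are embedded as multiples of the unit element; the image
  of q^(1/2) determines those of all its powers, then those of integer multiples, and finally those
  of sums. The values on the basis are inverses and hence unique.\<close>

lemma bar_involution_eq_hbar:
  assumes h: "h \<in> hecke_carrier n"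
  shows "bar_involution n h = hbar n h"
proof -
  let ?\<phi> = "bar_involution n"
  interpret ring "hecke_algebra n"
    by (rule hecke_algebra_simps)
  have hom: "?\<phi> \<in> ring_hom (hecke_algebra n) (hecke_algebra n)"
    and half: "?\<phi> (hscale (qhalf 1) (T_basis id)) = hscale (qhalf (- 1)) (T_basis id)"
    and T: "\<And>w. w \<in> sym_grp n \<Longrightarrow> ?\<phi> (T_basis w) = m_inv (hecke_algebra n) (T_basis (inv_into UNIV w))"
    using is_bar_involution[of n] by (auto simp: is_bar_involution_def ring_iso_def)
  have closed: "?\<phi> x \<in> hecke_carrier n" if "x \<in> hecke_carrier n" for x
    using ring_hom_closed[OF hom] that by (simp add: hecke_algebra_simps)
  have hom_add: "?\<phi> (hadd x y) = hadd (?\<phi> x) (?\<phi> y)" if "x \<in> hecke_carrier n" "y \<in> hecke_carrier n" for x y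
    using ring_hom_add[OF hom] that by (simp add: hecke_algebra_simps)
  have mult: "?\<phi> (hmul n x y) = hmul n (?\<phi> x) (?\<phi> y)" if "x \<in> hecke_carrier n" "y \<in> hecke_carrier n" for x y
    using ring_hom_mult[OF hom, of x y] that by (simp add: hecke_algebra_simps closed)
  have one: "?\<phi> (T_basis id) = T_basis id"
    using ring_hom_one[OF hom] by (simp add: hecke_algebra_simps)
  have T: "?\<phi> (T_basis w) = T_bar n w" if w: "w \<in> sym_grp n" for w
  proof -
    have "T_basis (inv_into UNIV w) \<in> hecke_carrier n" "T_bar n w \<in> hecke_carrier n"
      using w by (auto simp: inv_in_sym_grp)
    then show ?thesis
      using T_bar_inverse[OF w] inv_char[of "T_basis (inv_into UNIV w)" "T_bar n w"] T[OF w]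
      by (auto simp: hecke_algebra_simps)
  qed
  have hom_zero: "?\<phi> (\<lambda>u. 0) = (\<lambda>u. 0)"
  proof -
    have "hadd (\<lambda>u. 0) (\<lambda>u. 0) = (\<lambda>u. 0)" "(\<lambda>u. 0) \<in> hecke_carrier n"
      by (simp_all add: hadd_def hecke_carrier_def)
    then have "hadd (?\<phi> (\<lambda>u. 0)) (?\<phi> (\<lambda>u. 0)) = ?\<phi> (\<lambda>u. 0)"
      using hom_add[of "\<lambda>u. 0" "\<lambda>u. 0"] by simp
    then show ?thesis
      by (simp add: hadd_def fun_eq_iff)
  qed
  define e where "e c = hscale c (T_basis id)" for c
  have e: "e c \<in> hecke_carrier n" for c
    by (simp add: e_def)
  have e_mult: "hmul n (e c) x = hscale c x" if "x \<in> hecke_carrier n" for c x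
    using that by (simp add: e_def semilinear_hscale[OF semilinear_hmul_left] hmul_T_id_left)
  have e_e: "hmul n (e c) (e d) = e (c * d)" for c d
    using e_mult[OF e] by (simp add: e_def)
  have e_add: "e (c + d) = hadd (e c) (e d)" for c d
    by (simp add: e_def hadd_def hscale_def algebra_simps)
  have e_1: "e 1 = T_basis id"
    by (simp add: e_def)
  have plus: "?\<phi> (e (qhalf 1)) = e (qhalf (- 1))"
    using half by (simp add: e_def)
  \<comment> \<open>The image of q^(-1/2) is the inverse of the image of q^(1/2).\<close>
  have minus: "?\<phi> (e (qhalf (- 1))) = e (qhalf 1)"
  proof -
    have "hmul n (e (qhalf (- 1))) (?\<phi> (e (qhalf (- 1)))) = T_basis id"
      using mult[OF e e, of "qhalf 1" "qhalf (- 1)"] by (simp add: plus e_e e_1 one)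
    then have "hmul n (e (qhalf 1)) (hscale (qhalf (- 1)) (?\<phi> (e (qhalf (- 1))))) = e (qhalf 1)"
      using e_mult[OF closed[OF e]] hmul_T_id_right[OF e] by simp
    then show ?thesis
      using closed[OF e] e_mult[OF hscale_carrier] by simp
  qed
  have qh: "?\<phi> (e (qhalf k)) = e (qhalf (- k))" for k
  proof (induction k rule: int_induct[of _ 0])
    case base
    then show ?case by (simp add: e_1 one)
  next
    case (step1 k)
    have "e (qhalf (k + 1)) = hmul n (e (qhalf k)) (e (qhalf 1))"
      by (simp add: e_e)
    then show ?case
      using mult[OF e e, of "qhalf k" "qhalf 1"] step1 by (simp add: plus e_e)
  next
    case (step2 k)
    have "e (qhalf (k - 1)) = hmul n (e (qhalf k)) (e (qhalf (- 1)))"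
      by (simp add: e_e)
    then show ?case
      using mult[OF e e, of "qhalf k" "qhalf (- 1)"] step2 by (simp add: minus e_e)
  qed
  have e_0: "e 0 = (\<lambda>u. 0)"
    by (simp add: e_def hscale_def)
  have single: "?\<phi> (e (Poly_Mapping.single k x)) = e (Poly_Mapping.single (- k) x)" for k and x :: int
  proof (induction x rule: int_induct[of _ 0])
    case base
    then show ?case by (simp add: e_0 hom_zero)
  next
    case (step1 x)
    have "Poly_Mapping.single k (x + 1) = Poly_Mapping.single k x + qhalf k" for k
      by (simp add: single_add qhalf_def)
    then show ?case
      using hom_add[OF e e] by (simp add: e_add step1 qh)
  next
    case (step2 x)
    have *: "Poly_Mapping.single k x = Poly_Mapping.single k (x - 1) + qhalf k" for k
      by (simp add: single_add[symmetric] qhalf_def)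
    have "hadd (?\<phi> (e (Poly_Mapping.single k (x - 1)))) (e (qhalf (- k))) =
        hadd (e (Poly_Mapping.single (- k) (x - 1))) (e (qhalf (- k)))"
      using step2(2) unfolding *[of k] *[of "- k"] e_add hom_add[OF e e] by (simp add: qh)
    then show ?case
      by (simp add: hadd_def fun_eq_iff)
  qed
  have e_bar: "?\<phi> (e c) = e (laurent_bar c)" for c
  proof (induction c rule: laurent_induct)
    case zero
    then show ?case by (simp add: e_0 hom_zero)
  next
    case (add c k x)
    then show ?case
      using hom_add[OF e e]
      by (simp add: e_add single laurent_bar_single)
  qed
  have scale: "?\<phi> (hscale c x) = hscale (laurent_bar c) (?\<phi> x)" if "x \<in> hecke_carrier n" for c x
    using mult[OF e that, of c] that closed[OF that] by (simp add: e_mult e_bar)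
  show ?thesis
    using hom_add scale semilinear_hbar h by (rule semilinear_on_eqI) (simp_all add: T)
qed

section \<open>Integer polynomials in q as Laurent polynomials in q^(1/2)\<close>

abbreviation lookup :: "laurent \<Rightarrow> int \<Rightarrow> int" where
  "lookup \<equiv> Poly_Mapping.lookup"

lemma lookup_single_mult:
  fixes f :: laurent
  shows "lookup (Poly_Mapping.single a x * f) k = x * lookup f (k - a)"
proof (induction f rule: laurent_induct)
  case (add f j y)
  then show ?case
    by (auto simp: distrib_left lookup_add mult_single lookup_single when_def)
qed simp

lemma lookup_qhalf_mult: "lookup (qhalf a * f) k = lookup f (k - a)"
  by (simp add: qhalf_def lookup_single_mult)

lemma of_int_laurent: "(of_int x :: laurent) = Poly_Mapping.single 0 x"
  by (metis single_of_int of_int_eq_id id_apply)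

lemma laurent_bar_of_int [simp]: "laurent_bar (of_int x) = of_int x"
  by (simp only: of_int_laurent laurent_bar_single minus_zero)

lemma laurent_of_poly_0 [simp]: "laurent_of_poly 0 = 0"
  by (simp add: laurent_of_poly_def)

lemma laurent_of_poly_pCons: "laurent_of_poly (pCons a p) = of_int a + qhalf 2 * laurent_of_poly p"
  by (simp add: laurent_of_poly_def map_poly_pCons)

lemma lookup_laurent_of_poly:
  "lookup (laurent_of_poly p) e = (if e \<ge> 0 \<and> even e then coeff p (nat (e div 2)) else 0)"
proof (induction p arbitrary: e)
  case (pCons a p)
  have "lookup (laurent_of_poly (pCons a p)) e =
      (if e = 0 then a else 0) + lookup (laurent_of_poly p) (e - 2)"
    by (simp add: laurent_of_poly_pCons lookup_add lookup_qhalf_mult of_int_laurent lookup_single when_def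
        del: single_of_int)
  also have "\<dots> = (if e \<ge> 0 \<and> even e then coeff (pCons a p) (nat (e div 2)) else 0)"
  proof (cases "e \<ge> 2 \<and> even e")
    case True
    then have "nat (e div 2) = Suc (nat ((e - 2) div 2))"
      by (auto elim!: evenE)
    then show ?thesis
      using True by (simp add: pCons.IH)
  next
    case False
    then have "e = 0 \<or> \<not> (e \<ge> 0 \<and> even e)"
      by presburger
    then show ?thesis
      by (auto simp: pCons.IH)
  qed
  finally show ?case .
qed simp

lemma lookup_laurent_of_poly_double [simp]:
  "lookup (laurent_of_poly p) (2 * int k) = coeff p k"
  by (simp add: lookup_laurent_of_poly)

lemma laurent_of_poly_inject: "laurent_of_poly p = laurent_of_poly p' \<longleftrightarrow> p = p'"
proof
  assume "laurent_of_poly p = laurent_of_poly p'"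
  then have "coeff p k = coeff p' k" for k
    using lookup_laurent_of_poly_double by metis
  then show "p = p'"
    by (rule poly_eqI)
qed simp

lemma laurent_of_poly_add: "laurent_of_poly (p + p') = laurent_of_poly p + laurent_of_poly p'"
  by (rule poly_mapping_eqI) (simp add: lookup_add lookup_laurent_of_poly)

lemma laurent_of_poly_diff: "laurent_of_poly (p - p') = laurent_of_poly p - laurent_of_poly p'"
  by (rule poly_mapping_eqI) (simp add: lookup_minus lookup_laurent_of_poly)

lemma laurent_of_poly_sum: "laurent_of_poly (sum f A) = (\<Sum>z\<in>A. laurent_of_poly (f z))"
  by (induction A rule: infinite_finite_induct) (simp_all add: laurent_of_poly_add)

lemma laurent_of_poly_monom_mult:
  "laurent_of_poly (monom c k * p) = of_int c * (qhalf (2 * int k) * laurent_of_poly p)"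
proof (induction k)
  case 0
  show ?case
    by (rule poly_mapping_eqI)
      (simp add: of_int_laurent lookup_single_mult lookup_laurent_of_poly coeff_monom_mult del: single_of_int)
next
  case (Suc k)
  have "monom c (Suc k) * p = pCons 0 (monom c k * p)"
    by (simp add: monom_Suc)
  then have "laurent_of_poly (monom c (Suc k) * p) = qhalf 2 * (of_int c * (qhalf (2 * int k) * laurent_of_poly p))"
    by (simp only: laurent_of_poly_pCons Suc) simp
  also have "\<dots> = of_int c * (qhalf (2 + 2 * int k) * laurent_of_poly p)"
    by (simp add: mult.left_commute[of "qhalf 2"] del: single_of_int)
  finally show ?case
    by simp
qed

lemma laurent_of_poly_1 [simp]: "laurent_of_poly 1 = 1"
  using laurent_of_poly_pCons[of 1 0] by (simp add: one_pCons)

subsection \<open>Existence of the Kazhdan--Lusztig basis\<close>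

lemma bruhat_le_refl: "w \<in> sym_grp n \<Longrightarrow> bruhat_le n w w"
  by (simp add: bruhat_le_iff)

lemma bruhat_le_trans: "bruhat_le n u v \<Longrightarrow> bruhat_le n v w \<Longrightarrow> bruhat_le n u w"
  using rank_le_trans by (auto simp: bruhat_le_iff)

lemma bruhat_le_id: "bruhat_le n v id \<Longrightarrow> v = id"
  by (auto simp: bruhat_le_def reduced_word_def dest: list_emb_length)

definition kl_elt :: "nat \<Rightarrow> perm \<Rightarrow> (perm \<Rightarrow> int poly) \<Rightarrow> hecke" where
  "kl_elt n w p = (\<lambda>v. qhalf (- int (perm_length n w)) * laurent_of_poly (p v))"

text \<open>One row of a Kazhdan--Lusztig family. The degree bound is expressed through nonzero
  coefficients, so that zero polynomials and sums need no special treatment. The constant term 1 on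
  the Bruhat interval is carried along; it gives the nonvanishing and also
  \<open>kl_row_less\<close>.\<close>

definition kl_row :: "nat \<Rightarrow> perm \<Rightarrow> (perm \<Rightarrow> int poly) \<Rightarrow> bool" where
  "kl_row n w p \<longleftrightarrow> p w = 1 \<and> (\<forall>v. \<not> bruhat_le n v w \<longrightarrow> p v = 0) \<and>
     (\<forall>v k. coeff (p v) k \<noteq> 0 \<longrightarrow> v = w \<or> 2 * k + perm_length n v < perm_length n w) \<and>
     (\<forall>v. bruhat_le n v w \<longrightarrow> coeff (p v) 0 = 1) \<and>
     hbar n (kl_elt n w p) = kl_elt n w p"

lemma kl_elt_carrier:
  assumes "\<And>v. \<not> bruhat_le n v w \<Longrightarrow> p v = 0"
  shows "kl_elt n w p \<in> hecke_carrier n"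
  using assms by (auto simp: hecke_carrier_def kl_elt_def bruhat_le_iff)

text \<open>The constant coefficient is 1, so the degree bound applies to exponent 0 and compares
  the lengths.\<close>

lemma kl_row_less:
  assumes "kl_row n w p" "bruhat_le n v w" "v \<noteq> w"
  shows "perm_length n v < perm_length n w"
  using assms by (auto simp: kl_row_def dest!: spec[of _ v] spec[of _ 0])

text \<open>The factor q^(-1/2) (1 + T_s) is bar invariant, because q^(1/2) (1 + T_s^(-1)) =
  q^(-1/2) (1 + T_s).\<close>

lemma hbar_C_mult:
  assumes i: "i \<in> {1..<n}" and C: "C \<in> hecke_carrier n" "hbar n C = C"
  shows "hbar n (hscale (qhalf (- 1)) (hadd C (right_mult i C))) =
    hscale (qhalf (- 1)) (hadd C (right_mult i C))"
proof -
  have "hbar n (hscale (qhalf (- 1)) (hadd C (right_mult i C))) = hscale (qhalf 1) (hadd C (right_mult_inv i C))"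
    using C by (simp add: semilinear_hscale[OF semilinear_hbar] semilinear_hadd[OF semilinear_hbar]
        hbar_right_mult[OF i])
  also have "\<dots> = hscale (qhalf (- 1)) (hadd C (right_mult i C))"
    by (rule ext) (simp add: hscale_def hadd_def right_mult_def right_mult_inv_def algebra_simps)
  finally show ?thesis .
qed

text \<open>The classical recursion for x = w s with s a descent of x: multiply the invariant
  element of w by q^(-1/2) (1 + T_s), and subtract integer multiples of the invariant elements of
  those z below w that have s as a descent. These multiples remove precisely the coefficients that
  violate the degree bound.\<close>

lemma ex_kl_row: "w \<in> sym_grp n \<Longrightarrow> \<exists>p. kl_row n w p"
proof (induction "perm_length n w" arbitrary: w rule: less_induct)
  case (less x)
  note x = \<open>x \<in> sym_grp n\<close>
  show ?case
  proof (cases "x = id")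
    case True
    have "kl_elt n id (\<lambda>v. if v = id then 1 else 0) = T_basis id"
      by (auto simp: kl_elt_def T_basis_def)
    then have "kl_row n id (\<lambda>v. if v = id then 1 else 0)"
      using bruhat_le_refl[OF id_in_sym_grp] by (auto simp: kl_row_def T_bar_id dest: bruhat_le_id)
    then show ?thesis
      using True by blast
  next
    case False
    then obtain i where i: "i \<in> {1..<n}" "\<not> asc x i"
      using ex_descent x by blast
    let ?l = "perm_length n" and ?s = "\<lambda>v. v \<circ> simple_refl i"
    define w where "w = ?s x"
    have w: "w \<in> sym_grp n" "asc w i" "x = ?s w"
      using x i by (simp_all add: w_def comp_simple_refl_iff not_asc_iff[OF sym_grp_inj])
    have lx: "?l x = Suc (?l w)"
      using perm_length_desc[OF x i] by (simp add: w_def)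
    have wx: "bruhat_le n w x"
      using rank_le_asc[OF w(1) i(1) w(2)] w x by (simp add: bruhat_le_iff)
    have sS: "?s v \<in> sym_grp n \<longleftrightarrow> v \<in> sym_grp n" for v
      using i(1) by (rule comp_simple_refl_iff)
    have asc_s: "asc (?s v) i \<longleftrightarrow> \<not> asc v i" if "v \<in> sym_grp n" for v
      using that by (simp add: not_asc_iff[OF sym_grp_inj])
    have l_asc: "?l (?s v) = Suc (?l v)" if "v \<in> sym_grp n" "asc v i" for v
      using perm_length_asc[OF that(1) i(1) that(2)] .
    obtain P where P: "kl_row n w P"
      using less.hyps[OF _ w(1)] lx by auto
    obtain row where row: "kl_row n z (row z)" if "z \<in> sym_grp n" "?l z < ?l x" for z
      using less.hyps by metis
    define Zs where "Zs = {z \<in> sym_grp n. \<not> asc z i \<and> bruhat_le n z w}"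
    \<comment> \<open>The coefficient of P_{z,w} in the largest degree that the bound permits; it is
      0 if the parity of the lengths excludes that degree.\<close>
    define \<mu> where "\<mu> z = (if odd (?l w - ?l z) then coeff (P z) ((?l w - ?l z - 1) div 2) else 0)" for z
    \<comment> \<open>The power of q that adapts the normalisation q^(-l(z)/2) of the subtracted
      element to q^(-l(x)/2).\<close>
    define e where "e z = (?l x - ?l z) div 2" for z
    \<comment> \<open>The two members of the coset {v, v s}, ordered by length. The product with
      q^(-1/2) (1 + T_s) has the polynomial P(lo v) + q P(hi v) at both of them.\<close>
    define lo where "lo v = (if asc v i then v else ?s v)" for v
    define hi where "hi v = (if asc v i then ?s v else v)" for v
    define p where "p v = P (lo v) + pCons 0 (P (hi v)) - (\<Sum>z\<in>Zs. monom (\<mu> z) (e z) * row z v)" for v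
    have [simp]: "finite Zs"
      by (simp add: Zs_def)
    have P_w: "P w = 1" and P_0: "\<And>v. \<not> bruhat_le n v w \<Longrightarrow> P v = 0"
      and P_deg: "\<And>v k. coeff (P v) k \<noteq> 0 \<Longrightarrow> v = w \<or> 2 * k + ?l v < ?l w"
      and P_1: "\<And>v. bruhat_le n v w \<Longrightarrow> coeff (P v) 0 = 1"
      and P_bar: "hbar n (kl_elt n w P) = kl_elt n w P"
      using P by (auto simp: kl_row_def)
    have Zs: "?l z < ?l w" "z \<noteq> w" "z \<in> sym_grp n" "kl_row n z (row z)" if "z \<in> Zs" for z
    proof -
      show "z \<noteq> w" "z \<in> sym_grp n"
        using that w by (auto simp: Zs_def)
      then show "?l z < ?l w"
        using kl_row_less[OF P] that by (auto simp: Zs_def)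
      then show "kl_row n z (row z)"
        using row[OF \<open>z \<in> sym_grp n\<close>] lx by simp
    qed
    have \<mu>: "?l x - ?l z = 2 * e z" "e z \<ge> 1" "?l z + 2 * e z = ?l x" if "z \<in> Zs" "\<mu> z \<noteq> 0" for z
    proof -
      have "odd (?l w - ?l z)"
        using that(2) by (auto simp: \<mu>_def split: if_splits)
      moreover have "?l x - ?l z = Suc (?l w - ?l z)"
        using Zs(1)[OF that(1)] lx by simp
      ultimately have "even (?l x - ?l z)"
        by simp
      then show *: "?l x - ?l z = 2 * e z"
        unfolding e_def by (rule dvd_mult_div_cancel[symmetric])
      then show "e z \<ge> 1" "?l z + 2 * e z = ?l x"
        using Zs(1)[OF that(1)] lx by auto
    qed
    have row_deg: "v = z \<and> k = 0 \<or> 2 * k + ?l v < ?l z" if "z \<in> Zs" "coeff (row z v) k \<noteq> 0" for z v k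
    proof (cases "v = z")
      case True
      then show ?thesis
        using Zs(4)[OF that(1)] that(2) by (cases k) (auto simp: kl_row_def)
    next
      case False
      then show ?thesis
        using Zs(4)[OF that(1)] that(2) unfolding kl_row_def by blast
    qed
    have not_xw: "\<not> bruhat_le n x z" if "?l z < ?l x" "kl_row n z q" for z q
      using kl_row_less[OF that(2), of x] that(1) by auto
    have "p x = 1"
    proof -
      have "P x = 0"
        using P_0[OF not_xw[OF _ P]] lx by simp
      moreover have "row z x = 0" if "z \<in> Zs" for z
        using Zs[OF that] not_xw[of z "row z"] lx by (auto simp: kl_row_def)
      ultimately show ?thesis
        using i(2) by (simp add: p_def lo_def hi_def P_w flip: w_def)
    qed
    moreover have "p v = 0" if v: "\<not> bruhat_le n v x" for v
    proof -
      have "\<not> bruhat_le n (hi v) w"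
      proof
        assume a: "bruhat_le n (hi v) w"
        then have "v \<in> sym_grp n"
          using sS by (auto simp: bruhat_le_iff hi_def split: if_splits)
        then have "bruhat_le n v (hi v)"
          using rank_le_asc[OF _ i(1)] sS by (auto simp: hi_def bruhat_le_iff)
        then show False
          using a wx v bruhat_le_trans by blast
      qed
      moreover have "\<not> bruhat_le n (lo v) w"
      proof
        assume a: "bruhat_le n (lo v) w"
        then have vS: "v \<in> sym_grp n"
          using sS by (auto simp: bruhat_le_iff lo_def split: if_splits)
        have "bruhat_le n (lo v) x"
          using a wx bruhat_le_trans by blast
        moreover have "asc (lo v) i"
          using asc_s[OF vS] by (auto simp: lo_def)
        ultimately have "bruhat_le n (?s (lo v)) x"
          using rank_le_lift(2)[of "lo v" n x i] i sS by (simp add: bruhat_le_iff)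
        then show False
          using v \<open>bruhat_le n (lo v) x\<close> by (auto simp: lo_def split: if_splits)
      qed
      moreover have "row z v = 0" if "z \<in> Zs" for z
      proof (rule ccontr)
        assume "row z v \<noteq> 0"
        then have "bruhat_le n v z"
          using Zs(4)[OF that] by (auto simp: kl_row_def)
        moreover have "bruhat_le n z w"
          using that by (simp add: Zs_def)
        ultimately show False
          using wx v bruhat_le_trans by blast
      qed
      ultimately show ?thesis
        by (simp add: p_def P_0)
    qed
    \<comment> \<open>Only P(lo v) contributes: the second summand has a factor q, and so has each
      correction since its exponent \<open>e z\<close> is at least 1. Lifting gives that
      \<open>lo v\<close> lies below \<open>w\<close>.\<close>
    moreover have "coeff (p v) 0 = 1" if v: "bruhat_le n v x" for v
    proof -
      have vS: "v \<in> sym_grp n" and vx: "rank_le v x"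
        using v by (auto simp: bruhat_le_iff)
      have "bruhat_le n (lo v) w"
        using rank_le_lift(1)[OF vS x i(1) vx] rank_le_both[OF vS x i(1) vx] i(2) vS w(1) sS
        by (auto simp: lo_def bruhat_le_iff simp flip: w_def)
      moreover have "coeff (monom (\<mu> z) (e z) * row z v) 0 = 0" if "z \<in> Zs" for z
        using \<mu>(2)[OF that] by (cases "\<mu> z = 0") (auto simp: coeff_monom_mult)
      ultimately show ?thesis
        by (simp add: p_def P_1 coeff_sum)
    qed
    moreover have "v = x \<or> 2 * k + ?l v < ?l x" if "coeff (p v) k \<noteq> 0" for v k
    proof (rule ccontr)
      assume "\<not> (v = x \<or> 2 * k + ?l v < ?l x)"
      then have vx: "v \<noteq> x" and k: "2 * k + ?l v \<ge> ?l x"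
        by auto
      have "bruhat_le n v x"
        using that \<open>\<And>v. \<not> bruhat_le n v x \<Longrightarrow> p v = 0\<close> by fastforce
      then have v: "v \<in> sym_grp n"
        by (simp add: bruhat_le_iff)
      \<comment> \<open>The degree bound for z, shifted by \<open>e z\<close>, becomes the degree
        bound for x, so only the correction with z = v can reach a forbidden degree.\<close>
      have other: "coeff (monom (\<mu> z) (e z) * row z v) k = 0" if "z \<in> Zs" "z \<noteq> v" for z
      proof (rule ccontr)
        assume "coeff (monom (\<mu> z) (e z) * row z v) k \<noteq> 0"
        then have "\<mu> z \<noteq> 0" "e z \<le> k" "coeff (row z v) (k - e z) \<noteq> 0"
          by (auto simp: coeff_monom_mult split: if_splits)
        then show False
          using row_deg[OF that(1), of v "k - e z"] \<mu>(3)[OF that(1)] that(2) k by auto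
      qed
      have "coeff (p v) k = 0"
      proof (cases "asc v i")
        case True
        have "coeff (P v) k = 0"
        proof (rule ccontr)
          assume "coeff (P v) k \<noteq> 0"
          from P_deg[OF this] show False
            using k lx P_w \<open>coeff (P v) k \<noteq> 0\<close> by (cases k) auto
        qed
        moreover have "coeff (pCons 0 (P (?s v))) k = 0"
        proof (cases k)
          case (Suc k')
          show ?thesis
          proof (rule ccontr)
            assume "coeff (pCons 0 (P (?s v))) k \<noteq> 0"
            then have "coeff (P (?s v)) k' \<noteq> 0"
              by (simp add: Suc)
            from P_deg[OF this] show False
              using k lx l_asc[OF v True] Suc asc_s[OF v] True w(2) by auto
          qed
        qed simp
        moreover have "z \<noteq> v" if "z \<in> Zs" for z
          using that True by (auto simp: Zs_def)
        ultimately show ?thesis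
          using True other by (simp add: p_def lo_def hi_def coeff_sum)
      next
        case False
        have lv: "?l v = Suc (?l (?s v))"
          using perm_length_desc[OF v i(1) False] .
        have "coeff (P (?s v)) k = 0"
        proof (rule ccontr)
          assume "coeff (P (?s v)) k \<noteq> 0"
          from P_deg[OF this] show False
            using k lx lv vx w(3) by auto
        qed
        \<comment> \<open>The factor q can push P(v) beyond the bound in one degree only, namely 2 k
          = l(x) - l(v). The coefficient there is \<open>\<mu> v\<close> and is cancelled by the
          correction with z = v.\<close>
        moreover have "coeff (pCons 0 (P v)) k = (\<Sum>z\<in>Zs. coeff (monom (\<mu> z) (e z) * row z v) k)"
        proof (cases "v \<in> Zs")
          case True
          have "row v v = 1"
            using Zs(4)[OF True] by (simp add: kl_row_def)
          have "(\<Sum>z\<in>Zs. coeff (monom (\<mu> z) (e z) * row z v) k) =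
              (\<Sum>z\<in>{v}. coeff (monom (\<mu> z) (e z) * row z v) k)"
            using other True by (intro sum.mono_neutral_right) auto
          also have "\<dots> = (if e v = k then \<mu> v else 0)"
            by (simp add: \<open>row v v = 1\<close>)
          also have "\<dots> = coeff (pCons 0 (P v)) k"
          proof (cases "2 * k + ?l v = ?l x")
            case eq: True
            then obtain k' where k': "k = Suc k'"
              using Zs(1)[OF True] lx by (cases k) auto
            have "?l w - ?l v = Suc (2 * k')" "?l x - ?l v = 2 * k"
              using eq lx k' by auto
            then show ?thesis
              by (simp add: \<mu>_def e_def k')
          next
            case neq: False
            have "coeff (pCons 0 (P v)) k = 0"
            proof (cases k)
              case (Suc k')
              then show ?thesis
                using P_deg[of v k'] k neq lx Zs(2)[OF True] by auto
            qed simp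
            moreover have "\<mu> v = 0 \<or> e v \<noteq> k"
              using \<mu>(3)[OF True] neq by auto
            ultimately show ?thesis
              by auto
          qed
          finally show ?thesis by simp
        next
          case notin: False
          then have "P v = 0"
            using False v P_0 by (auto simp: Zs_def)
          moreover have "(\<Sum>z\<in>Zs. coeff (monom (\<mu> z) (e z) * row z v) k) = 0"
            using other notin by (intro sum.neutral) auto
          ultimately show ?thesis
            by simp
        qed
        ultimately show ?thesis
          using False by (simp add: p_def lo_def hi_def coeff_sum)
      qed
      with that show False by simp
    qed
    moreover have "hbar n (kl_elt n x p) = kl_elt n x p"
    proof -
      define C where "C = kl_elt n w P"
      define D where "D z = kl_elt n z (row z)" for z
      let ?c = "\<lambda>z. if z \<in> Zs then of_int (\<mu> z) else 0 :: laurent"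
      have C: "C \<in> hecke_carrier n" "hbar n C = C"
        using P_0 P_bar by (simp_all add: C_def kl_elt_carrier)
      have "kl_elt n x p = hadd (hscale (qhalf (- 1)) (hadd C (right_mult i C)))
          (hscale (- 1) (hsum n ?c D))"
      proof
        fix v
        have "qhalf (- int (?l x)) * laurent_of_poly (monom (\<mu> z) (e z) * row z v) =
            of_int (\<mu> z) * D z v" if "z \<in> Zs" for z
        proof (cases "\<mu> z = 0")
          case False
          have "- int (?l x) + 2 * int (e z) = - int (?l z)"
            using \<mu>(3)[OF that False] by linarith
          then show ?thesis
            by (simp add: laurent_of_poly_monom_mult D_def kl_elt_def
                mult.left_commute[of "qhalf (- int (?l x))"] del: single_of_int)
        qed simp
        moreover have "hsum n ?c D v = (\<Sum>z\<in>Zs. of_int (\<mu> z) * D z v)"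
          unfolding hsum_def by (rule sum.mono_neutral_cong_right) (auto simp: Zs_def)
        ultimately have sum: "(\<Sum>z\<in>Zs. qhalf (- int (?l x)) * laurent_of_poly (monom (\<mu> z) (e z) * row z v)) =
            hsum n ?c D v"
          by simp
        have main: "qhalf (- int (?l x)) * (laurent_of_poly (P (lo v)) + qhalf 2 * laurent_of_poly (P (hi v))) =
            hscale (qhalf (- 1)) (hadd C (right_mult i C)) v"
          by (auto simp: C_def kl_elt_def lx right_mult_def hadd_def hscale_def lo_def hi_def algebra_simps)
        have "kl_elt n x p v =
            qhalf (- int (?l x)) * (laurent_of_poly (P (lo v)) + qhalf 2 * laurent_of_poly (P (hi v))) -
            (\<Sum>z\<in>Zs. qhalf (- int (?l x)) * laurent_of_poly (monom (\<mu> z) (e z) * row z v))"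
          by (simp add: kl_elt_def p_def laurent_of_poly_diff laurent_of_poly_add laurent_of_poly_sum
              laurent_of_poly_pCons right_diff_distrib sum_distrib_left)
        then show "kl_elt n x p v = hadd (hscale (qhalf (- 1)) (hadd C (right_mult i C)))
          (hscale (- 1) (hsum n ?c D)) v"
          unfolding sum main by (simp add: hadd_def hscale_def)
      qed
      moreover have "hbar n (hsum n ?c D) = hsum n ?c D"
      proof -
        have "hbar n (hsum n ?c D) = hsum n (\<lambda>z. laurent_bar (?c z)) (\<lambda>z. hbar n (D z))"
          by (rule semilinear_hsum[OF semilinear_hbar])
        also have "\<dots> = hsum n ?c D"
          unfolding hsum_def using Zs(4) by (intro ext sum.cong) (auto simp: D_def kl_row_def simp del: single_of_int)
        finally show ?thesis .
      qed
      then have "hbar n (hscale (- 1) (hsum n ?c D)) = hscale (- 1) (hsum n ?c D)"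
        by (simp only: semilinear_hscale[OF semilinear_hbar] laurent_bar_uminus laurent_bar_1)
      ultimately show ?thesis
        by (simp only: semilinear_hadd[OF semilinear_hbar, of n "hscale _ (hadd _ _)"] hbar_C_mult[OF i(1) C])
    qed
    ultimately have "kl_row n x p"
      by (simp add: kl_row_def)
    then show ?thesis by blast
  qed
qed

section \<open>Uniqueness of the Kazhdan--Lusztig polynomials\<close>

lemma T_bar_triangular:
  assumes "w \<in> sym_grp n"
  shows "T_bar n w w = qhalf (- 2 * int (perm_length n w)) \<and>
    (\<forall>v\<in>sym_grp n. v \<noteq> w \<longrightarrow> perm_length n w \<le> perm_length n v \<longrightarrow> T_bar n w v = 0)"
  using assms
proof (induction rule: sym_grp_induct)
  case id
  then show ?case
    by (auto simp: T_bar_id T_basis_def)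
next
  case (asc w i)
  let ?l = "perm_length n" and ?s = "\<lambda>v. v \<circ> simple_refl i"
  have T: "T_bar n (?s w) = right_mult_inv i (T_bar n w)"
    using T_bar_asc[OF asc(1-3)] .
  have lw: "?l (?s w) = Suc (?l w)"
    using perm_length_asc[OF asc(1-3)] .
  have "T_bar n (?s w) (?s w) = qhalf (- 2 * int (?l (?s w)))"
    using asc by (simp add: T right_mult_inv_def lw)
  moreover have "T_bar n (?s w) v = 0" if v: "v \<in> sym_grp n" "v \<noteq> ?s w" "?l (?s w) \<le> ?l v" for v
  proof -
    have sv: "?s v \<in> sym_grp n"
      using v(1) asc(2) by (simp add: comp_simple_refl_iff)
    have ne: "?s v \<noteq> w"
      using v(2) by auto
    show ?thesis
    proof (cases "asc v i")
      case True
      then have "?l (?s v) = Suc (?l v)"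
        using perm_length_asc[OF v(1) asc(2)] by simp
      then have "T_bar n w (?s v) = 0" "T_bar n w v = 0"
        using asc(4) sv v ne lw by auto
      then show ?thesis
        by (simp add: T right_mult_inv_def)
    next
      case False
      then have "?l v = Suc (?l (?s v))"
        using perm_length_desc[OF v(1) asc(2)] by simp
      then have "T_bar n w (?s v) = 0"
        using asc(4) sv v ne lw by auto
      then show ?thesis
        using False by (simp add: T right_mult_inv_def)
    qed
  qed
  ultimately show ?case by blast
qed

text \<open>The difference of two rows is bar invariant. At a v of maximal length in its support,
  triangularity of the bar involution leaves only the diagonal term, so the difference f of the
  polynomials is symmetric about l(w) - l(v) in exponents of q^(1/2). The degree bounds confine f
  strictly below that centre.\<close>

lemma kl_family_unique:
  assumes P: "is_kl_family n P" and P': "is_kl_family n P'"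
  shows "P = P'"
proof (rule ccontr)
  assume "P \<noteq> P'"
  then obtain v0 w where v0: "P v0 w \<noteq> P' v0 w"
    by (auto simp: fun_eq_iff)
  let ?l = "perm_length n"
  have "bruhat_le n v0 w"
    using v0 P P' unfolding is_kl_family_def by metis
  then have w: "w \<in> sym_grp n"
    by (simp add: bruhat_le_iff)
  have elt: "kl_element n R w = kl_elt n w (\<lambda>v. R v w)" "hbar n (kl_elt n w (\<lambda>v. R v w)) = kl_elt n w (\<lambda>v. R v w)"
    if "is_kl_family n R" for R
  proof -
    show *: "kl_element n R w = kl_elt n w (\<lambda>v. R v w)"
      using that by (auto simp: kl_element_def kl_elt_def is_kl_family_def)
    have "kl_elt n w (\<lambda>v. R v w) \<in> hecke_carrier n"
      using that by (intro kl_elt_carrier) (auto simp: is_kl_family_def)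
    then show "hbar n (kl_elt n w (\<lambda>v. R v w)) = kl_elt n w (\<lambda>v. R v w)"
      using that w bar_involution_eq_hbar * unfolding is_kl_family_def by metis
  qed
  define D where "D = hadd (kl_elt n w (\<lambda>v. P v w)) (hscale (- 1) (kl_elt n w (\<lambda>v. P' v w)))"
  have D: "D v = qhalf (- int (?l w)) * (laurent_of_poly (P v w) - laurent_of_poly (P' v w))" for v
    by (simp add: D_def kl_elt_def hadd_def hscale_def algebra_simps)
  have D_bar: "hbar n D = D"
    using elt[OF P] elt[OF P'] by (simp add: D_def semilinear_hscale[OF semilinear_hbar] semilinear_hadd[OF semilinear_hbar])
  let ?V = "{v \<in> sym_grp n. P v w \<noteq> P' v w}"
  have "v0 \<in> ?V"
    using v0 \<open>bruhat_le n v0 w\<close> by (simp add: bruhat_le_iff)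
  then obtain v where v: "v \<in> ?V" and max: "\<And>u. u \<in> ?V \<Longrightarrow> ?l u \<le> ?l v"
    using obtains_MAX[of ?V ?l] by (metis (no_types, lifting) Max_ge empty_iff finite_imageI
        finite_sym_grp finite_subset image_eqI mem_Collect_eq subsetI)
  have vS: "v \<in> sym_grp n" and vw: "P v w \<noteq> P' v w"
    using v by auto
  have "D v = (\<Sum>u\<in>sym_grp n. laurent_bar (D u) * T_bar n u v)"
    using fun_cong[OF D_bar, of v] by (simp add: hbar_def hsum_def)
  also have "\<dots> = (\<Sum>u\<in>{v}. laurent_bar (D u) * T_bar n u v)"
  proof (rule sum.mono_neutral_right)
    show "\<forall>u\<in>sym_grp n - {v}. laurent_bar (D u) * T_bar n u v = 0"
    proof
      fix u assume u: "u \<in> sym_grp n - {v}"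
      show "laurent_bar (D u) * T_bar n u v = 0"
      proof (cases "P u w = P' u w")
        case True
        then show ?thesis by (simp add: D)
      next
        case False
        then have "?l u \<le> ?l v"
          using u max by simp
        then show ?thesis
          using T_bar_triangular[of u n] u vS by auto
      qed
    qed
  qed (use vS in auto)
  also have "\<dots> = laurent_bar (D v) * qhalf (- 2 * int (?l v))"
    using T_bar_triangular[OF vS] by simp
  finally have eq: "D v = qhalf (- 2 * int (?l v)) * laurent_bar (D v)"
    by (simp add: mult.commute)
  define f where "f = laurent_of_poly (P v w) - laurent_of_poly (P' v w)"
  have "f \<noteq> 0"
    using vw by (simp add: f_def laurent_of_poly_inject)
  then obtain k where k: "lookup f k \<noteq> 0"
    by (metis lookup_zero poly_mapping_eqI)
  have "bruhat_le n v w"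
    using vw P P' unfolding is_kl_family_def by metis
  moreover have "v \<noteq> w"
    using vw P P' w by (auto simp: is_kl_family_def)
  ultimately have deg: "2 * int (degree (R v w)) < int (?l w) - int (?l v)" if "is_kl_family n R" for R
  proof -
    have "real (degree (R v w)) \<le> (real (?l w) - real (?l v) - 1) / 2"
      using that \<open>bruhat_le n v w\<close> \<open>v \<noteq> w\<close> unfolding is_kl_family_def by blast
    then have "2 * real (degree (R v w)) + real (?l v) + 1 \<le> real (?l w)"
      by (simp add: field_simps)
    then have "2 * degree (R v w) + ?l v + 1 \<le> ?l w"
      by linarith
    then show ?thesis by linarith
  qed
  have bound: "j < int (?l w) - int (?l v)" if "lookup f j \<noteq> 0" for j
  proof -
    have "lookup (laurent_of_poly (R v w)) j = 0" if "j \<ge> int (?l w) - int (?l v)" "is_kl_family n R" for R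
    proof (cases "j \<ge> 0 \<and> even j")
      case True
      then obtain m where "j = 2 * int m"
        by (metis evenE nonneg_int_cases zero_le_mult_iff zero_less_numeral not_numeral_le_zero)
      then show ?thesis
        using deg[OF that(2)] that(1) by (simp add: coeff_eq_0)
    qed (auto simp: lookup_laurent_of_poly)
    then show ?thesis
      using that P P' by (force simp: f_def lookup_minus)
  qed
  have "lookup (D v) (k - int (?l w)) = lookup f k"
    by (simp add: D lookup_qhalf_mult f_def)
  \<comment> \<open>Reflection of exponents: invariance sends exponent k of f to 2 (l(w) - l(v)) -
    k.\<close>
  also have "lookup (D v) (k - int (?l w)) = lookup f (- k + 2 * int (?l w) - 2 * int (?l v))"
  proof -
    have "laurent_bar (D v) = qhalf (int (?l w)) * laurent_bar f"
      by (simp add: D f_def)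
    then have "D v = qhalf (int (?l w) - 2 * int (?l v)) * laurent_bar f"
      using eq by simp
    then show ?thesis
      by (simp add: lookup_qhalf_mult) (simp add: algebra_simps)
  qed
  finally have "- k + 2 * int (?l w) - 2 * int (?l v) < int (?l w) - int (?l v)"
    using k bound by metis
  then show False
    using bound[OF k] by linarith
qed

lemma ex_kl_family:
  "\<exists>P. is_kl_family n P \<and> (\<forall>v w. bruhat_le n v w \<longrightarrow> P v w \<noteq> 0)"
proof -
  have "\<forall>w. \<exists>p. w \<in> sym_grp n \<longrightarrow> kl_row n w p"
    using ex_kl_row by blast
  then obtain row where row: "kl_row n w (row w)" if "w \<in> sym_grp n" for w
    by metis
  define P where "P v w = (if w \<in> sym_grp n then row w v else 0)" for v w
  have zero: "P v w = 0" if "\<not> bruhat_le n v w" for v w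
    using row that by (auto simp: P_def kl_row_def)
  have one: "coeff (P v w) 0 = 1" if "bruhat_le n v w" for v w
    using row that by (auto simp: P_def kl_row_def bruhat_le_iff)
  have "real (degree (P v w)) \<le> (real (perm_length n w) - real (perm_length n v) - 1) / 2"
    if "bruhat_le n v w" "v \<noteq> w" for v w
  proof -
    have "coeff (P v w) (degree (P v w)) \<noteq> 0"
      using one[OF that(1)] by (auto simp: leading_coeff_0_iff)
    moreover have w: "w \<in> sym_grp n"
      using that by (simp add: bruhat_le_iff)
    ultimately have "2 * degree (P v w) + perm_length n v < perm_length n w"
      using row[OF w] that(2) unfolding kl_row_def P_def if_P[OF w] by blast
    then show ?thesis
      by (simp add: field_simps)
  qed
  moreover have "bar_involution n (kl_element n P w) = kl_element n P w" if w: "w \<in> sym_grp n" for w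
  proof -
    have "kl_element n P w = kl_elt n w (row w)"
      using row[OF w] w by (auto simp: kl_element_def kl_elt_def P_def kl_row_def)
    moreover have "kl_elt n w (row w) \<in> hecke_carrier n"
      using row[OF w] by (intro kl_elt_carrier) (auto simp: kl_row_def)
    ultimately show ?thesis
      using row[OF w] by (simp add: bar_involution_eq_hbar kl_row_def)
  qed
  ultimately have "is_kl_family n P"
    using row zero by (auto simp: is_kl_family_def P_def kl_row_def)
  moreover have "P v w \<noteq> 0" if "bruhat_le n v w" for v w
    using one[OF that] by auto
  ultimately show ?thesis by blast
qed

lemma kl_poly_nonzero_iff: "kl_poly n v w \<noteq> 0 \<longleftrightarrow> bruhat_le n v w"
proof -
  obtain P where P: "is_kl_family n P" "\<And>v w. bruhat_le n v w \<Longrightarrow> P v w \<noteq> 0"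
    using ex_kl_family by blast
  have "kl_poly n = P"
    unfolding kl_poly_def using P(1) kl_family_unique by blast
  then show ?thesis
    using P by (auto simp: is_kl_family_def)
qed

section \<open>The density as a count of pairs with comparable rank matrices\<close>

definition comparable_pairs :: "nat \<Rightarrow> (perm \<times> perm) set" where
  "comparable_pairs n = {(v, w). v \<in> sym_grp n \<and> w \<in> sym_grp n \<and> rank_le v w}"

lemma den_eq: "den n = real (card (comparable_pairs n)) / (fact n)\<^sup>2"
  by (simp add: den_def comparable_pairs_def kl_poly_nonzero_iff bruhat_le_iff cong: conj_cong)

lemma sym_grp_bij_betw: "w \<in> sym_grp n \<Longrightarrow> bij_betw w {1..n} {1..n}"
  by (simp add: sym_grp_def permutes_imp_bij)

lemma sym_grp_outside: "w \<in> sym_grp n \<Longrightarrow> i > n \<Longrightarrow> w i = i"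
  by (simp add: sym_grp_def permutes_not_in)

lemma bij_betw_restrict_Collect:
  assumes "bij_betw f A B"
  shows "bij_betw f {x \<in> A. P (f x)} {y \<in> B. P y}"
proof -
  have "f ` {x \<in> A. P (f x)} = {y \<in> B. P y}"
    using assms by (auto simp: bij_betw_def)
  then show ?thesis
    using bij_betw_subset[OF assms, of "{x \<in> A. P (f x)}"] by blast
qed

lemma rank_mat_tail:
  assumes "w \<in> sym_grp n" "i \<le> n"
  shows "rank_mat w i j + card {l \<in> {i<..n}. w l \<le> j} = min j n"
proof -
  have "{l \<in> {1..n}. w l \<le> j} = {l \<in> {1..i}. w l \<le> j} \<union> {l \<in> {i<..n}. w l \<le> j}"
    using assms(2) by auto
  then have "card {l \<in> {1..n}. w l \<le> j} = rank_mat w i j + card {l \<in> {i<..n}. w l \<le> j}"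
    unfolding rank_mat_def by (subst card_Un_disjoint[symmetric]) auto
  moreover have "card {l \<in> {1..n}. w l \<le> j} = card {y \<in> {1..n}. y \<le> j}"
    by (rule bij_betw_same_card[OF bij_betw_restrict_Collect[OF sym_grp_bij_betw[OF assms(1)]]])
  moreover have "{y \<in> {1..n}. y \<le> j} = {1..min j n}"
    by auto
  ultimately show ?thesis
    by simp
qed

lemma rank_mat_full: "w \<in> sym_grp n \<Longrightarrow> rank_mat w n j = min j n"
  using rank_mat_tail[of w n n j] by simp

lemma rank_mat_mono: "j \<le> j' \<Longrightarrow> rank_mat w i j \<le> rank_mat w i j'"
  unfolding rank_mat_def by (rule card_mono) auto

text \<open>Row n is the same for all permutations of \<open>{1..n}\<close>, and beyond it both
  arguments fix every position.\<close>

lemma rank_leI: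
  assumes "v \<in> sym_grp n" "w \<in> sym_grp n" "\<And>i j. i \<le> n \<Longrightarrow> rank_mat w i j \<le> rank_mat v i j"
  shows "rank_le v w"
  unfolding rank_le_def
proof (intro allI)
  fix i j
  have "rank_mat w (n + d) j = rank_mat v (n + d) j" for d
    using assms(1,2) by (induction d) (simp_all add: rank_mat_full rank_mat_Suc sym_grp_outside)
  from this[of "i - n"] show "rank_mat w i j \<le> rank_mat v i j"
    using assms(3)[of i j] by (cases "i \<le> n") auto
qed

subsection \<open>Prescribing the last values of a permutation\<close>

text \<open>The first n positions receive the values left over by \<open>a\<close>, in the relative
  order of \<open>v\<close>. The shift by one in \<open>v i - 1\<close> is due to
  \<open>enumerate\<close> counting from 0.\<close>

definition extend_perm :: "nat \<Rightarrow> nat \<Rightarrow> (nat \<Rightarrow> nat) \<Rightarrow> perm \<Rightarrow> perm" where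
  "extend_perm n k a v = (\<lambda>i. if 1 \<le> i \<and> i \<le> n then enumerate ({1..n + k} - a ` {1..k}) (v i - 1)
     else if n < i \<and> i \<le> n + k then a (i - n) else i)"

context
  fixes n k :: nat and a v :: "nat \<Rightarrow> nat"
  assumes a: "a \<in> {1..k} \<rightarrow>\<^sub>E {1..n + k}" "inj_on a {1..k}" and v: "v \<in> sym_grp n"
begin

lemma complement_card: "card ({1..n + k} - a ` {1..k}) = n"
  using a by (subst card_Diff_subset) (auto simp: card_image)

lemma extend_perm_low: "bij_betw (extend_perm n k a v) {1..n} ({1..n + k} - a ` {1..k})"
proof -
  have "bij_betw (\<lambda>x. x - 1) {1..n} {..<n}"
    by (rule bij_betwI[of _ _ _ Suc]) auto
  then have "bij_betw (enumerate ({1..n + k} - a ` {1..k}) \<circ> ((\<lambda>x. x - 1) \<circ> v)) {1..n} ({1..n + k} - a ` {1..k})"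
    using finite_bij_enumerate[of "{1..n + k} - a ` {1..k}"] sym_grp_bij_betw[OF v] complement_card
    by (auto intro!: bij_betw_trans)
  then show ?thesis
    by (rule bij_betw_cong[THEN iffD1, rotated]) (simp add: extend_perm_def o_apply)
qed

lemma extend_perm_high: "bij_betw (extend_perm n k a v) {n<..n + k} (a ` {1..k})"
proof -
  have "bij_betw (\<lambda>i. i - n) {n<..n + k} {1..k}"
    by (rule bij_betwI[of _ _ _ "\<lambda>i. i + n"]) auto
  then have "bij_betw (a \<circ> (\<lambda>i. i - n)) {n<..n + k} (a ` {1..k})"
    using a(2) by (intro bij_betw_trans[of _ _ "{1..k}"]) (auto simp: bij_betw_def)
  then show ?thesis
    by (rule bij_betw_cong[THEN iffD1, rotated]) (simp add: extend_perm_def o_apply)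
qed

lemma extend_perm_in_sym_grp: "extend_perm n k a v \<in> sym_grp (n + k)"
proof -
  have "bij_betw (extend_perm n k a v) ({1..n} \<union> {n<..n + k}) (({1..n + k} - a ` {1..k}) \<union> a ` {1..k})"
    by (intro bij_betw_combine extend_perm_low extend_perm_high) auto
  moreover have "{1..n} \<union> {n<..n + k} = {1..n + k}" "({1..n + k} - a ` {1..k}) \<union> a ` {1..k} = {1..n + k}"
    using a(1) by auto
  ultimately show ?thesis
    unfolding sym_grp_def by (auto intro!: bij_imp_permutes simp: extend_perm_def)
qed

lemma rank_mat_extend_perm_high:
  assumes "t \<le> k"
  shows "rank_mat (extend_perm n k a v) (n + t) j + card {s \<in> {t<..k}. a s \<le> j} = min j (n + k)"
proof -
  have "bij_betw (\<lambda>s. n + s) {s \<in> {t<..k}. a s \<le> j} {l \<in> {n + t<..n + k}. extend_perm n k a v l \<le> j}"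
    by (rule bij_betwI[of _ _ _ "\<lambda>l. l - n"]) (auto simp: extend_perm_def)
  from bij_betw_same_card[OF this] show ?thesis
    using rank_mat_tail[OF extend_perm_in_sym_grp, of "n + t" j] assms by simp
qed

text \<open>Let c be the number of free values up to j. The order-preserving enumeration of the free
  values places an entry at or below j exactly if the entry of \<open>v\<close> is at most c, so
  column j becomes column c of the old rank matrix.\<close>

lemma rank_mat_extend_perm_low:
  assumes "i \<le> n"
  shows "rank_mat (extend_perm n k a v) i j = rank_mat v i (min j (n + k) - card {s \<in> {0<..k}. a s \<le> j})"
proof -
  define M where "M = {1..n + k} - a ` {1..k}"
  define c where "c = rank_mat (extend_perm n k a v) n j"
  have c: "c = min j (n + k) - card {s \<in> {0<..k}. a s \<le> j}"
    using rank_mat_extend_perm_high[of 0 j] by (simp add: c_def)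
  have M: "card M = n" "finite M"
    using complement_card by (simp_all add: M_def)
  have mono: "enumerate M (x - 1) \<le> enumerate M (y - 1) \<longleftrightarrow> x \<le> y" if "x \<in> {1..n}" "y \<in> {1..n}" for x y
    using finite_enumerate_mono_iff[of M "y - 1" "x - 1"] M that by (auto simp: not_less[symmetric])
  have bij: "bij_betw v {1..n} {1..n}"
    using sym_grp_bij_betw[OF v] .
  have "card {l \<in> {1..n}. enumerate M (v l - 1) \<le> j} = card {y \<in> {1..n}. enumerate M (y - 1) \<le> j}"
    by (rule bij_betw_same_card[OF bij_betw_restrict_Collect[OF bij]])
  moreover have "{l \<in> {1..n}. enumerate M (v l - 1) \<le> j} = {l \<in> {1..n}. extend_perm n k a v l \<le> j}"
    by (auto simp: extend_perm_def M_def)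
  ultimately have c_card: "c = card {y \<in> {1..n}. enumerate M (y - 1) \<le> j}"
    by (simp add: c_def rank_mat_def)
  have iff: "enumerate M (x - 1) \<le> j \<longleftrightarrow> x \<le> c" if x: "x \<in> {1..n}" for x
  proof
    assume le: "enumerate M (x - 1) \<le> j"
    have "{1..x} \<subseteq> {y \<in> {1..n}. enumerate M (y - 1) \<le> j}"
    proof
      fix y assume "y \<in> {1..x}"
      then have y: "y \<in> {1..n}" "y \<le> x"
        using x by auto
      then show "y \<in> {y \<in> {1..n}. enumerate M (y - 1) \<le> j}"
        using mono[OF y(1) x] le by auto
    qed
    then have "card {1..x} \<le> c"
      unfolding c_card by (intro card_mono) auto
    then show "x \<le> c" by simp
  next
    assume "x \<le> c"
    show "enumerate M (x - 1) \<le> j"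
    proof (rule ccontr)
      assume gt: "\<not> enumerate M (x - 1) \<le> j"
      have "{y \<in> {1..n}. enumerate M (y - 1) \<le> j} \<subseteq> {1..<x}"
      proof
        fix y assume y: "y \<in> {y \<in> {1..n}. enumerate M (y - 1) \<le> j}"
        then have "\<not> x \<le> y"
          using mono[of x y] x gt by auto
        then show "y \<in> {1..<x}"
          using y by auto
      qed
      then have "c \<le> card {1..<x}"
        unfolding c_card by (intro card_mono) auto
      then show False
        using \<open>x \<le> c\<close> x by auto
    qed
  qed
  have "{l \<in> {1..i}. extend_perm n k a v l \<le> j} = {l \<in> {1..i}. v l \<le> c}"
  proof (rule Collect_cong, rule conj_cong[OF refl])
    fix l assume "l \<in> {1..i}"
    then have l: "l \<in> {1..n}"
      using assms by auto
    then have "v l \<in> {1..n}"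
      using bij by (auto simp: bij_betw_def)
    then show "extend_perm n k a v l \<le> j \<longleftrightarrow> v l \<le> c"
      using iff l by (simp add: extend_perm_def M_def)
  qed
  then show ?thesis
    by (simp only: rank_mat_def c[symmetric])
qed

end

text \<open>The tuple \<open>a\<close> is meant for the smaller permutation: fewer small values in
  each suffix leave more small values in the corresponding prefix, that is, a larger rank
  matrix.\<close>

definition suffix_dominated :: "nat \<Rightarrow> (nat \<Rightarrow> nat) \<Rightarrow> (nat \<Rightarrow> nat) \<Rightarrow> bool" where
  "suffix_dominated k a b \<longleftrightarrow> (\<forall>t j. card {s \<in> {t<..k}. a s \<le> j} \<le> card {s \<in> {t<..k}. b s \<le> j})"

definition dominated_tuples :: "nat \<Rightarrow> nat \<Rightarrow> ((nat \<Rightarrow> nat) \<times> (nat \<Rightarrow> nat)) set" where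
  "dominated_tuples k N = {(a, b). a \<in> {1..k} \<rightarrow>\<^sub>E {1..N} \<and> b \<in> {1..k} \<rightarrow>\<^sub>E {1..N} \<and>
     inj_on a {1..k} \<and> inj_on b {1..k} \<and> suffix_dominated k a b}"

text \<open>Rows beyond n are compared through the suffix counts. For the earlier rows, the whole
  suffix (t = 0) shows that the column translated for \<open>v\<close> is at least the one
  translated for \<open>w\<close>; then monotonicity in the column and the comparability of the old
  pair combine.\<close>

lemma rank_le_extend_perm:
  assumes "(v, w) \<in> comparable_pairs n" "(a, b) \<in> dominated_tuples k (n + k)"
  shows "(extend_perm n k a v, extend_perm n k b w) \<in> comparable_pairs (n + k)"
proof -
  have v: "v \<in> sym_grp n" and w: "w \<in> sym_grp n" and vw: "rank_le v w"
    using assms(1) by (auto simp: comparable_pairs_def)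
  have a: "a \<in> {1..k} \<rightarrow>\<^sub>E {1..n + k}" "inj_on a {1..k}" and b: "b \<in> {1..k} \<rightarrow>\<^sub>E {1..n + k}" "inj_on b {1..k}"
    and dom: "suffix_dominated k a b"
    using assms(2) by (auto simp: dominated_tuples_def)
  note S = extend_perm_in_sym_grp[OF a v] extend_perm_in_sym_grp[OF b w]
  have "rank_mat (extend_perm n k b w) i j \<le> rank_mat (extend_perm n k a v) i j" if "i \<le> n + k" for i j
  proof (cases "i \<le> n")
    case True
    have "min j (n + k) - card {s \<in> {0<..k}. b s \<le> j} \<le> min j (n + k) - card {s \<in> {0<..k}. a s \<le> j}"
      using dom by (simp add: suffix_dominated_def diff_le_mono2)
    then show ?thesis
      using vw rank_mat_mono order_trans
      unfolding rank_mat_extend_perm_low[OF a v True] rank_mat_extend_perm_low[OF b w True] rank_le_def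
      by blast
  next
    case False
    then have t: "i - n \<le> k" "i = n + (i - n)"
      using that by auto
    have "card {s \<in> {i - n<..k}. a s \<le> j} \<le> card {s \<in> {i - n<..k}. b s \<le> j}"
      using dom by (simp add: suffix_dominated_def)
    then show ?thesis
      using rank_mat_extend_perm_high[OF a v t(1), of j] rank_mat_extend_perm_high[OF b w t(1), of j] t(2)
      by simp
  qed
  then show ?thesis
    using S rank_leI[OF S] by (simp add: comparable_pairs_def)
qed

lemma extend_perm_inj:
  assumes a: "a \<in> {1..k} \<rightarrow>\<^sub>E {1..n + k}" "inj_on a {1..k}" and v: "v \<in> sym_grp n"
    and a': "a' \<in> {1..k} \<rightarrow>\<^sub>E {1..n + k}" "inj_on a' {1..k}" and v': "v' \<in> sym_grp n"
    and eq: "extend_perm n k a v = extend_perm n k a' v'"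
  shows "a = a'" "v = v'"
proof -
  show "a = a'"
  proof (rule PiE_ext[OF a(1) a'(1)])
    fix s assume "s \<in> {1..k}"
    then show "a s = a' s"
      using fun_cong[OF eq, of "n + s"] by (simp add: extend_perm_def)
  qed
  define M where "M = {1..n + k} - a ` {1..k}"
  have M: "card M = n" "finite M"
    using complement_card[OF a v] by (simp_all add: M_def)
  show "v = v'"
  proof
    fix i
    show "v i = v' i"
    proof (cases "i \<in> {1..n}")
      case True
      have vi: "v i \<in> {1..n}" "v' i \<in> {1..n}"
        using sym_grp_bij_betw[OF v] sym_grp_bij_betw[OF v'] True by (auto simp: bij_betw_def)
      have "enumerate M (v i - 1) = enumerate M (v' i - 1)"
        using fun_cong[OF eq, of i] True \<open>a = a'\<close> by (simp add: extend_perm_def M_def)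
      then have "v i - 1 = v' i - 1"
        using finite_bij_enumerate[OF M(2)] M(1) vi unfolding bij_betw_def inj_on_def by auto
      then show ?thesis
        using vi by auto
    next
      case False
      then show ?thesis
        using v v' by (auto simp: sym_grp_def permutes_not_in)
    qed
  qed
qed

lemma finite_comparable_pairs [simp]: "finite (comparable_pairs n)"
  by (rule finite_subset[of _ "sym_grp n \<times> sym_grp n"]) (auto simp: comparable_pairs_def)

lemma finite_dominated_tuples [simp]: "finite (dominated_tuples k N)"
  by (rule finite_subset[of _ "({1..k} \<rightarrow>\<^sub>E {1..N}) \<times> ({1..k} \<rightarrow>\<^sub>E {1..N})"])
    (auto simp: dominated_tuples_def finite_PiE)

lemma card_comparable_pairs_extend:
  "card (comparable_pairs n) * card (dominated_tuples k (n + k)) \<le> card (comparable_pairs (n + k))"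
proof -
  let ?f = "\<lambda>((v, w), (a, b)). (extend_perm n k a v, extend_perm n k b w)"
  have "inj_on ?f (comparable_pairs n \<times> dominated_tuples k (n + k))"
  proof (rule inj_onI)
    fix p p' assume p: "p \<in> comparable_pairs n \<times> dominated_tuples k (n + k)"
      "p' \<in> comparable_pairs n \<times> dominated_tuples k (n + k)" and eq: "?f p = ?f p'"
    obtain v w a b v' w' a' b' where pp: "p = ((v, w), a, b)" "p' = ((v', w'), a', b')"
      by (metis surj_pair)
    have "a = a' \<and> v = v'"
      using p eq extend_perm_inj[of a k n v a' v'] by (auto simp: pp comparable_pairs_def dominated_tuples_def)
    moreover have "b = b' \<and> w = w'"
      using p eq extend_perm_inj[of b k n w b' w'] by (auto simp: pp comparable_pairs_def dominated_tuples_def)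
    ultimately show "p = p'"
      by (simp add: pp)
  qed
  moreover have "?f ` (comparable_pairs n \<times> dominated_tuples k (n + k)) \<subseteq> comparable_pairs (n + k)"
    using rank_le_extend_perm by auto
  ultimately have "card (comparable_pairs n \<times> dominated_tuples k (n + k)) \<le> card (comparable_pairs (n + k))"
    by (rule card_inj_on_le) simp
  then show ?thesis
    by (simp add: card_cartesian_product)
qed

subsection \<open>Counting dominated tuples\<close>

text \<open>The values are chosen one after another, and fewer than k of them have been used up at
  each choice.\<close>

lemma card_inj_PiE_ge:
  assumes "finite S" "card S \<le> k" "\<And>s. s \<in> S \<Longrightarrow> finite (A s) \<and> m \<le> card (A s)"
  shows "(m - k) ^ card S \<le> card {f \<in> Pi\<^sub>E S A. inj_on f S}"
  using assms
proof (induction S rule: finite_induct)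
  case (insert s S)
  let ?F = "{f \<in> Pi\<^sub>E S A. inj_on f S}" and ?G = "{f \<in> Pi\<^sub>E (insert s S) A. inj_on f (insert s S)}"
  have fin: "finite ?F" "finite ?G"
    using insert by (auto intro: finite_subset[of _ "Pi\<^sub>E S A"] finite_subset[of _ "Pi\<^sub>E (insert s S) A"] finite_PiE)
  have "card (SIGMA f:?F. A s - f ` S) \<le> card ?G"
  proof (rule card_inj_on_le[of "\<lambda>(f, c). f(s := c)"])
    show "inj_on (\<lambda>(f, c). f(s := c)) (SIGMA f:?F. A s - f ` S)"
    proof (rule inj_onI, clarify)
      fix f c g d
      assume fg: "f \<in> Pi\<^sub>E S A" "g \<in> Pi\<^sub>E S A" and eq: "f(s := c) = g(s := d)"
      have "f x = g x" for x
        using fun_cong[OF eq, of x] PiE_arb[OF fg(1) insert(2)] PiE_arb[OF fg(2) insert(2)]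
        by (cases "x = s") simp_all
      then show "f = g \<and> c = d"
        using fun_cong[OF eq, of s] by auto
    qed
    show "(\<lambda>(f, c). f(s := c)) ` (SIGMA f:?F. A s - f ` S) \<subseteq> ?G"
    proof clarify
      fix f c assume f: "f \<in> Pi\<^sub>E S A" "inj_on f S" and c: "c \<in> A s" "c \<notin> f ` S"
      have "inj_on (f(s := c)) S" "(f(s := c)) ` S = f ` S"
        using f(2) insert(2) by (auto simp: inj_on_def)
      then have "inj_on (f(s := c)) (insert s S)"
        using c(2) insert(2) by simp
      then show "f(s := c) \<in> Pi\<^sub>E (insert s S) A \<and> inj_on (f(s := c)) (insert s S)"
        using PiE_fun_upd[OF c(1) f(1)] by blast
    qed
  qed (use fin in simp)
  moreover have "card (SIGMA f:?F. A s - f ` S) = (\<Sum>f\<in>?F. card (A s - f ` S))"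
    using fin insert.prems by (intro card_SigmaI) auto
  moreover have "of_nat (card ?F) * (m - k) \<le> (\<Sum>f\<in>?F. card (A s - f ` S))"
  proof (rule sum_bounded_below)
    fix f assume "f \<in> ?F"
    have "card (f ` S) \<le> k"
      using card_image_le[OF insert(1), of f] insert(1,2,4) by simp
    moreover have "m \<le> card (A s)"
      using insert by simp
    ultimately show "m - k \<le> card (A s - f ` S)"
      using diff_card_le_card_Diff[of "f ` S" "A s"] insert(1) by simp
  qed
  moreover have "(m - k) ^ card S * (m - k) \<le> card ?F * (m - k)"
    using insert by (intro mult_le_mono1) simp
  ultimately have "(m - k) ^ card S * (m - k) \<le> card ?G"
    unfolding of_nat_id id_apply by linarith
  then show ?case
    using insert(1,2) by (simp add: mult.commute)
qed simp

text \<open>Nine symbols for ten cells: symbol c denotes cell c + 1 for the smaller permutation and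
  cell c for the larger one.\<close>

definition dominated_words :: "nat \<Rightarrow> ((nat \<Rightarrow> nat) \<times> (nat \<Rightarrow> nat)) set" where
  "dominated_words k = {(x, y). x \<in> {1..k} \<rightarrow>\<^sub>E {..<9} \<and> y \<in> {1..k} \<rightarrow>\<^sub>E {..<9} \<and> suffix_dominated k x y}"

text \<open>
  The values are grouped into ten cells; one permutation avoids the lowest cell and the other one the
  highest cell. The resulting shift by one cell makes domination of the cell numbers sufficient.
\<close>

lemma card_dominated_tuples_ge:
  "card (dominated_words k) * (N div 10 - k) ^ (2 * k) \<le> card (dominated_tuples k N)"
proof -
  define m where "m = N div 10"
  define cell where "cell c = {c * m<..Suc c * m}" for c
  define lift where "lift x = {f \<in> Pi\<^sub>E {1..k} (\<lambda>s. cell (x s)). inj_on f {1..k}}" for x :: "nat \<Rightarrow> nat"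
  have cell_eq: "c = (z - 1) div m" if z: "z \<in> cell c" for z c
  proof -
    from z have "m > 0"
      by (cases m) (auto simp: cell_def)
    moreover have "c * m \<le> z - 1" "z - 1 < Suc c * m"
      using z by (auto simp: cell_def)
    ultimately show ?thesis
      by (metis div_nat_eqI mult.commute)
  qed
  have cell_sub: "cell c \<subseteq> {1..N}" if "c < 10" for c
  proof -
    have "Suc c * m \<le> 10 * m"
      using that by (intro mult_right_mono) auto
    also have "10 * m \<le> N"
      by (simp add: m_def)
    finally show ?thesis
      by (auto simp: cell_def)
  qed
  have lift_card: "(m - k) ^ k \<le> card (lift x)" for x
    using card_inj_PiE_ge[of "{1..k}" k "\<lambda>s. cell (x s)" m] by (simp add: lift_def cell_def)
  have fin_lift: "finite (lift x)" for x
    unfolding lift_def by (rule finite_subset[of _ "Pi\<^sub>E {1..k} (\<lambda>s. cell (x s))"]) (auto intro!: finite_PiE simp: cell_def)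
  have fin: "finite (dominated_words k)"
    by (rule finite_subset[of _ "({1..k} \<rightarrow>\<^sub>E {..<9}) \<times> ({1..k} \<rightarrow>\<^sub>E {..<9})"])
      (auto simp: dominated_words_def intro!: finite_PiE)
  let ?L = "SIGMA (x, y):dominated_words k. lift (\<lambda>s. Suc (x s)) \<times> lift y"
  have "card ?L \<le> card (dominated_tuples k N)"
  proof (rule card_inj_on_le[of snd])
    show "inj_on snd ?L"
    proof (rule inj_onI, clarsimp)
      fix x y x' y' a b
      assume xy: "(x, y) \<in> dominated_words k" "(x', y') \<in> dominated_words k"
        and a: "a \<in> lift (\<lambda>s. Suc (x s))" "a \<in> lift (\<lambda>s. Suc (x' s))" and b: "b \<in> lift y" "b \<in> lift y'"
      have "x s = x' s \<and> y s = y' s" if "s \<in> {1..k}" for s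
      proof -
        have "a s \<in> cell (Suc (x s))" "a s \<in> cell (Suc (x' s))" "b s \<in> cell (y s)" "b s \<in> cell (y' s)"
          using that a b by (auto simp: lift_def PiE_iff)
        from this[THEN cell_eq] show ?thesis by simp
      qed
      then show "x = x' \<and> y = y'"
        using xy PiE_ext[of x "{1..k}" _ x'] PiE_ext[of y "{1..k}" _ y']
        by (auto simp: dominated_words_def)
    qed
    show "snd ` ?L \<subseteq> dominated_tuples k N"
    proof clarsimp
      fix a b x y
      assume xy: "(x, y) \<in> dominated_words k" and a: "a \<in> lift (\<lambda>s. Suc (x s))" and b: "b \<in> lift y"
      have x9: "x s < 9" and y9: "y s < 9" and acell: "a s \<in> cell (Suc (x s))" and bcell: "b s \<in> cell (y s)"
        if "s \<in> {1..k}" for s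
        using that xy a b by (auto simp: dominated_words_def lift_def)
      have "a s \<in> {1..N}" "b s \<in> {1..N}" if "s \<in> {1..k}" for s
        using cell_sub[of "Suc (x s)"] cell_sub[of "y s"] acell[OF that] bcell[OF that] x9[OF that] y9[OF that]
        by auto
      moreover have "a \<in> extensional {1..k}" "b \<in> extensional {1..k}"
        using a b by (auto simp: lift_def PiE_def)
      ultimately have "a \<in> {1..k} \<rightarrow>\<^sub>E {1..N}" "b \<in> {1..k} \<rightarrow>\<^sub>E {1..N}"
        by (auto simp: PiE_def)
      moreover have "inj_on a {1..k}" "inj_on b {1..k}"
        using a b by (auto simp: lift_def)
      moreover have "suffix_dominated k a b"
        unfolding suffix_dominated_def
      proof (intro allI)
        fix t j
        \<comment> \<open>The index of the cell containing j. Values of \<open>a\<close> up to j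
          have cell number at most d, hence symbol at most d - 1; conversely, a symbol of
          \<open>b\<close> at most d - 1 denotes a cell that lies entirely below j. For d = 0 no
          value of \<open>a\<close> is small enough.\<close>
        define d where "d = (j - 1) div m"
        have fin': "finite {s \<in> {t<..k}. P s}" for P
          by simp
        show "card {s \<in> {t<..k}. a s \<le> j} \<le> card {s \<in> {t<..k}. b s \<le> j}"
        proof (cases "d = 0 \<or> m = 0")
          case True
          have "{s \<in> {t<..k}. a s \<le> j} = {}"
          proof (rule ccontr)
            assume "{s \<in> {t<..k}. a s \<le> j} \<noteq> {}"
            then obtain s where "s \<in> {t<..k}" "a s \<le> j"
              by auto
            then have s: "s \<in> {1..k}" "a s \<le> j"
              by auto
            have "m > 0"
              using acell[OF s(1)] by (cases m) (auto simp: cell_def)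
            have "Suc (x s) = (a s - 1) div m"
              using cell_eq[OF acell[OF s(1)]] .
            also have "\<dots> \<le> d"
              unfolding d_def using s(2) by (intro div_le_mono) auto
            finally show False
              using True \<open>m > 0\<close> by simp
          qed
          then show ?thesis by (simp only: card.empty le0)
        next
          case False
          have "card {s \<in> {t<..k}. a s \<le> j} \<le> card {s \<in> {t<..k}. x s \<le> d - 1}"
          proof (rule card_mono[OF fin'], rule subsetI)
            fix s assume "s \<in> {s \<in> {t<..k}. a s \<le> j}"
            then have s: "s \<in> {t<..k}" "a s \<le> j"
              by auto
            have "Suc (x s) = (a s - 1) div m"
              using cell_eq[OF acell] s(1) by simp
            also have "\<dots> \<le> d"
              unfolding d_def using s(2) by (intro div_le_mono) auto
            finally show "s \<in> {s \<in> {t<..k}. x s \<le> d - 1}"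
              using s by simp
          qed
          also have "\<dots> \<le> card {s \<in> {t<..k}. y s \<le> d - 1}"
            using xy by (simp add: dominated_words_def suffix_dominated_def)
          also have "\<dots> \<le> card {s \<in> {t<..k}. b s \<le> j}"
          proof (rule card_mono[OF fin'], rule subsetI)
            fix s assume "s \<in> {s \<in> {t<..k}. y s \<le> d - 1}"
            then have s: "s \<in> {t<..k}" "y s \<le> d - 1"
              by auto
            have "b s \<le> Suc (y s) * m"
              using bcell[of s] s(1) by (simp add: cell_def)
            also have "\<dots> \<le> d * m"
              using s(2) False by (intro mult_right_mono) auto
            also have "\<dots> \<le> j - 1"
              by (simp add: d_def)
            finally show "s \<in> {s \<in> {t<..k}. b s \<le> j}"
              using s by simp
          qed
          finally show ?thesis .
        qed
      qed
      ultimately show "(a, b) \<in> dominated_tuples k N"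
        by (simp add: dominated_tuples_def)
    qed
  qed simp
  moreover have "card ?L = (\<Sum>(x, y)\<in>dominated_words k. card (lift (\<lambda>s. Suc (x s))) * card (lift y))"
    using fin fin_lift by (subst card_SigmaI) (auto simp: card_cartesian_product split_def)
  moreover have "of_nat (card (dominated_words k)) * (m - k) ^ (2 * k) \<le>
      (\<Sum>(x, y)\<in>dominated_words k. card (lift (\<lambda>s. Suc (x s))) * card (lift y))"
  proof (rule sum_bounded_below)
    fix p assume "p \<in> dominated_words k"
    show "(m - k) ^ (2 * k) \<le> (case p of (x, y) \<Rightarrow> card (lift (\<lambda>s. Suc (x s))) * card (lift y))"
      using mult_le_mono[OF lift_card lift_card]
      by (auto simp: power_add mult_2 split: prod.split)
  qed
  ultimately show ?thesis
    by (simp add: m_def id_apply)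
qed


section \<open>A Chernoff bound for words in nine symbols\<close>

definition step_weight :: "real \<Rightarrow> nat \<Rightarrow> nat \<Rightarrow> nat \<Rightarrow> nat \<Rightarrow> real" where
  "step_weight b t c s y = (if t < s \<and> y \<le> c then b else 1)"

lemma prod_step_weight:
  "(\<Prod>s\<in>{1..k}. step_weight b t c s (x s)) = b ^ card {s \<in> {t<..k}. x s \<le> c}"
proof -
  have "(\<Prod>s\<in>{1..k}. step_weight b t c s (x s)) = (\<Prod>s\<in>{s \<in> {t<..k}. x s \<le> c}. b)"
    unfolding step_weight_def by (rule prod.mono_neutral_cong_right) auto
  then show ?thesis
    by simp
qed

lemma sum_step_weight:
  assumes "c < 9"
  shows "(\<Sum>y<9. step_weight b t c s y) = (if t < s then real (Suc c) * b + real (8 - c) else 9)"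
proof -
  have "{..<9} = {..c} \<union> {c<..<9}"
    using assms by auto
  then have "(\<Sum>y<9. step_weight b t c s y) = (\<Sum>y\<le>c. step_weight b t c s y) + (\<Sum>y\<in>{c<..<9}. step_weight b t c s y)"
    by (simp add: sum.union_disjoint[of "{..c}" "{c<..<9}"] ivl_disj_int)
  also have "(\<Sum>y\<le>c. step_weight b t c s y) = real (Suc c) * (if t < s then b else 1)"
    by (simp add: step_weight_def)
  also have "(\<Sum>y\<in>{c<..<9}. step_weight b t c s y) = real (8 - c)"
    by (simp add: step_weight_def)
  finally show ?thesis
    using assms by (auto simp: of_nat_diff)
qed

text \<open>With p = (c + 1) / 9 the product divided by 81 is 1 + p (1 - p) (b - 1)^2 / b for active
  steps, and 1 for the others. As p (1 - p) is at most 20/81, the excess for b = 51/50 stays below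
  1/10000.\<close>

lemma step_weight_product_le:
  fixes b :: real
  assumes "c < 9" and b: "b = 51 / 50"
  shows "(\<Sum>y<9. step_weight b t c s y) * (\<Sum>y<9. step_weight (1 / b) t c s y) \<le> 81 * (10001 / 10000)"
proof -
  have "c \<in> {0, 1, 2, 3, 4, 5, 6, 7, 8}"
    using assms(1) by auto
  then show ?thesis
    unfolding sum_step_weight[OF assms(1)] b by auto
qed

text \<open>
  Chernoff bound: the weight \<open>b\<^bsup>X - Y - j\<^esup>\<close> is at least 1 on the words counted here, where
  \<open>X\<close> and \<open>Y\<close> are the two cardinalities compared.
\<close>

lemma card_bad_words_le:
  fixes c j k t :: nat
  assumes "c < 9"
  defines "W \<equiv> {1..k} \<rightarrow>\<^sub>E {..<9::nat}"
  shows "real (card {(x, y) \<in> W \<times> W. card {s \<in> {t<..k}. y s \<le> c} + j < card {s \<in> {t<..k}. x s \<le> c}}) \<le>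
    (81 * (10001 / 10000)) ^ k / (51 / 50) ^ j"
proof -
  define b where "b = (51 / 50 :: real)"
  define X where "X x = card {s \<in> {t<..k}. x s \<le> c}" for x :: "nat \<Rightarrow> nat"
  have W: "finite W"
    by (auto simp: W_def intro!: finite_PiE)
  have "real (card {(x, y) \<in> W \<times> W. X y + j < X x}) = (\<Sum>(x, y)\<in>{(x, y) \<in> W \<times> W. X y + j < X x}. 1)"
    by simp
  also have "\<dots> \<le> (\<Sum>(x, y)\<in>{(x, y) \<in> W \<times> W. X y + j < X x}. b ^ X x * (1 / b) ^ X y / b ^ j)"
  proof (rule sum_mono, clarify)
    fix x y assume "X y + j < X x"
    then have "b ^ (X y + j) \<le> b ^ X x"
      by (intro power_increasing) (auto simp: b_def)
    then show "1 \<le> b ^ X x * (1 / b) ^ X y / b ^ j"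
      by (simp add: b_def power_add field_simps)
  qed
  also have "\<dots> \<le> (\<Sum>(x, y)\<in>W \<times> W. b ^ X x * (1 / b) ^ X y / b ^ j)"
    using W by (intro sum_mono2) (auto simp: b_def)
  also have "\<dots> = (\<Sum>x\<in>W. b ^ X x) * (\<Sum>y\<in>W. (1 / b) ^ X y) / b ^ j"
    by (simp add: sum.cartesian_product[symmetric] sum_product sum_divide_distrib)
  also have "(\<Sum>x\<in>W. b ^ X x) = (\<Prod>s\<in>{1..k}. \<Sum>y<9. step_weight b t c s y)"
    unfolding W_def X_def prod_step_weight[symmetric] by (rule prod_sum_PiE[symmetric]) auto
  also have "(\<Sum>x\<in>W. (1 / b) ^ X x) = (\<Prod>s\<in>{1..k}. \<Sum>y<9. step_weight (1 / b) t c s y)"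
    unfolding W_def X_def prod_step_weight[symmetric] by (rule prod_sum_PiE[symmetric]) auto
  also have "(\<Prod>s\<in>{1..k}. \<Sum>y<9. step_weight b t c s y) * (\<Prod>s\<in>{1..k}. \<Sum>y<9. step_weight (1 / b) t c s y) =
      (\<Prod>s\<in>{1..k}. (\<Sum>y<9. step_weight b t c s y) * (\<Sum>y<9. step_weight (1 / b) t c s y))"
    by (simp add: prod.distrib)
  also have "\<dots> \<le> (\<Prod>s\<in>{1..k}. 81 * (10001 / 10000))"
    by (intro prod_mono conjI step_weight_product_le[OF assms(1) b_def] mult_nonneg_nonneg sum_nonneg)
      (auto simp: step_weight_def b_def)
  also have "\<dots> = (81 * (10001 / 10000)) ^ k"
    by simp
  finally show ?thesis
    by (simp add: X_def b_def divide_right_mono)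
qed

text \<open>
  Appending \<open>j\<close> steps that use only the extreme cells makes all fluctuations up to \<open>j\<close> of the first
  \<open>50 j\<close> steps harmless.
\<close>

lemma card_dominated_words_ge:
  "81 ^ (50 * j) * (1 - (50 * real j + 1) * 9 * (99 / 100) ^ j) \<le> real (card (dominated_words (51 * j)))"
proof -
  define k where "k = 50 * j"
  define W :: "(nat \<Rightarrow> nat) set" where "W = {1..k} \<rightarrow>\<^sub>E {..<9}"
  define Bad where "Bad t c = {(x, y) \<in> W \<times> W. card {s \<in> {t<..k}. y s \<le> c} + j < card {s \<in> {t<..k}. x s \<le> c}}" for t c
  define push where "push e x = (\<lambda>s. if s \<in> {1..k} then x s else if s \<in> {k<..51 * j} then e else undefined)"
    for e :: nat and x :: "nat \<Rightarrow> nat"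
  have W: "finite W" "card W = 9 ^ k"
    by (auto simp: W_def card_funcsetE intro!: finite_PiE)
  have kj: "k \<le> 51 * j" "51 * j = k + j"
    by (auto simp: k_def)
  have push_W: "push e x \<in> {1..51 * j} \<rightarrow>\<^sub>E {..<9}" if "x \<in> W" "e < 9" for e x
    using that by (auto simp: W_def push_def PiE_iff extensional_def k_def)
  have push_count: "card {s \<in> {t<..51 * j}. push e x s \<le> c} =
      card {s \<in> {t<..k}. x s \<le> c} + (if e \<le> c then j else 0)" if "t \<le> k" for t c e x
  proof -
    have 1: "{s \<in> {t<..51 * j}. push e x s \<le> c} = {s \<in> {t<..k}. x s \<le> c} \<union> (if e \<le> c then {k<..51 * j} else {})"
      using that kj by (auto simp: push_def)
    have 2: "card ({s \<in> {t<..k}. x s \<le> c} \<union> (if e \<le> c then {k<..51 * j} else {})) =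
        card {s \<in> {t<..k}. x s \<le> c} + card (if e \<le> c then {k<..51 * j} else {})"
      by (rule card_Un_disjoint) auto
    have 3: "card (if e \<le> c then {k<..51 * j} else {}) = (if e \<le> c then j else 0)"
      by (simp add: k_def)
    show ?thesis
      by (simp only: 1 2 3)
  qed
  \<comment> \<open>The appended symbols 0 give \<open>y\<close> an advantage of j for every c < 8,
    whereas the symbols 8 add nothing for \<open>x\<close>. A suffix inside the appended part
    contains no small symbol of \<open>x\<close>, and for c at least 8 every symbol of
    \<open>y\<close> is counted.\<close>
  have good: "(push 8 x, push 0 y) \<in> dominated_words (51 * j)"
    if xy: "x \<in> W" "y \<in> W" "\<And>t c. t \<le> k \<Longrightarrow> c < 9 \<Longrightarrow> (x, y) \<notin> Bad t c" for x y
  proof -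
    have "card {s \<in> {t<..51 * j}. push 8 x s \<le> c} \<le> card {s \<in> {t<..51 * j}. push 0 y s \<le> c}" for t c
    proof (cases "c < 8")
      case c: True
      show ?thesis
      proof (cases "t \<le> k")
        case True
        then have "card {s \<in> {t<..k}. x s \<le> c} \<le> card {s \<in> {t<..k}. y s \<le> c} + j"
          using xy(1,2) xy(3)[OF True, of c] c by (auto simp: Bad_def)
        then show ?thesis
          using c by (simp only: push_count[OF True]) simp
      next
        case False
        then have "{s \<in> {t<..51 * j}. push 8 x s \<le> c} = {}"
          using c kj by (auto simp: push_def)
        then show ?thesis
          by (simp only: card.empty le0)
      qed
    next
      case False
      have "{s \<in> {t<..51 * j}. push 8 x s \<le> c} \<subseteq> {s \<in> {t<..51 * j}. push 0 y s \<le> c}"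
      proof
        fix s assume s: "s \<in> {s \<in> {t<..51 * j}. push 8 x s \<le> c}"
        then have "push 0 y s \<in> {..<9}"
          by (intro PiE_mem[OF push_W[OF xy(2)]]) auto
        then show "s \<in> {s \<in> {t<..51 * j}. push 0 y s \<le> c}"
          using s False by auto
      qed
      then show ?thesis
        by (intro card_mono) auto
    qed
    then show ?thesis
      using push_W[OF xy(1), of 8] push_W[OF xy(2), of 0] by (simp add: dominated_words_def suffix_dominated_def)
  qed
  define B where "B = (\<Union>t\<in>{..k}. \<Union>c\<in>{..<9}. Bad t c)"
  have B: "B \<subseteq> W \<times> W"
    by (auto simp: B_def Bad_def)
  have fin: "finite (dominated_words (51 * j))"
    by (rule finite_subset[of _ "({1..51 * j} \<rightarrow>\<^sub>E {..<9}) \<times> ({1..51 * j} \<rightarrow>\<^sub>E {..<9})"])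
      (auto simp: dominated_words_def intro!: finite_PiE)
  have "card (W \<times> W - B) \<le> card (dominated_words (51 * j))"
  proof (rule card_inj_on_le[of "\<lambda>(x, y). (push 8 x, push 0 y)"])
    show "inj_on (\<lambda>(x, y). (push 8 x, push 0 y)) (W \<times> W - B)"
    proof (rule inj_onI)
      fix p p' assume p: "p \<in> W \<times> W - B" "p' \<in> W \<times> W - B"
        and eq: "(case p of (x, y) \<Rightarrow> (push 8 x, push 0 y)) = (case p' of (x, y) \<Rightarrow> (push 8 x, push 0 y))"
      obtain x y x' y' where pp: "p = (x, y)" "p' = (x', y')"
        by (metis surj_pair)
      have inj: "u = u'" if "u \<in> W" "u' \<in> W" "push e u = push e u'" for u u' e
      proof (rule PiE_ext[OF that(1,2)[unfolded W_def]])
        fix s assume "s \<in> {1..k}"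
        then show "u s = u' s"
          using fun_cong[OF that(3), of s] by (simp add: push_def)
      qed
      show "p = p'"
        using p eq inj by (auto simp: pp)
    qed
    show "(\<lambda>(x, y). (push 8 x, push 0 y)) ` (W \<times> W - B) \<subseteq> dominated_words (51 * j)"
      using good by (fastforce simp: B_def)
  qed (rule fin)
  moreover have "card (W \<times> W - B) = 81 ^ k - card B"
    using W B by (subst card_Diff_subset) (auto simp: card_cartesian_product power_mult_distrib[symmetric] intro: finite_subset)
  moreover have "real (card B) \<le> 81 ^ k * ((50 * real j + 1) * 9 * (99 / 100) ^ j)"
  proof -
    have bad: "real (card (Bad t c)) \<le> 81 ^ k * (99 / 100) ^ j" if "c < 9" for t c
    proof -
      have "real (card (Bad t c)) \<le> (81 * (10001 / 10000)) ^ k / (51 / 50) ^ j"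
        unfolding Bad_def W_def by (rule card_bad_words_le[OF that])
      also have "\<dots> = 81 ^ k * (((10001 / 10000) ^ 50 / (51 / 50)) ^ j)"
        by (simp only: power_mult_distrib power_divide k_def power_mult times_divide_eq_right)
      \<comment> \<open>Over a block of 50 steps the weight grows by at most 1.0001^50, about 1.005,
        which is outweighed by the factor 1.02 gained from allowing one more fluctuation.\<close>
      also have "\<dots> \<le> 81 ^ k * (99 / 100) ^ j"
        by (intro mult_left_mono power_mono) (auto simp: field_simps)
      finally show ?thesis .
    qed
    \<comment> \<open>A union bound over the 50 j + 1 suffixes and the nine thresholds; the
      polynomial factor is beaten by (99/100)^j.\<close>
    have "card B \<le> (\<Sum>t\<le>k. \<Sum>c<9. card (Bad t c))"
      unfolding B_def by (intro order_trans[OF card_UN_le] sum_mono card_UN_le) auto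
    then have "real (card B) \<le> (\<Sum>t\<le>k. \<Sum>c<9. real (card (Bad t c)))"
      by (simp only: of_nat_sum[symmetric] of_nat_le_iff)
    also have "\<dots> \<le> (\<Sum>t\<le>k. \<Sum>c<(9::nat). 81 ^ k * (99 / 100) ^ j)"
      using bad by (intro sum_mono) auto
    also have "\<dots> = 81 ^ k * ((50 * real j + 1) * 9 * (99 / 100) ^ j)"
      by (simp add: k_def)
    finally show ?thesis .
  qed
  moreover have "real (81 ^ k) \<le> real (card (dominated_words (51 * j)) + card B)"
    using calculation(1,2) unfolding of_nat_le_iff by linarith
  ultimately show ?thesis
    unfolding k_def[symmetric] right_diff_distrib mult_1_right by simp
qed

subsection \<open>The lower bound\<close>

lemma fact_add_le: "n + k \<le> N \<Longrightarrow> fact (n + k) \<le> fact n * (N :: nat) ^ k"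
proof (induction k)
  case (Suc k)
  then have "(n + Suc k) * fact (n + k) \<le> N * (fact n * N ^ k)"
    by (intro mult_le_mono) auto
  then show ?case
    by (simp add: algebra_simps id_apply)
qed simp

text \<open>The number (n + k)! / n! of injective tuples is replaced by the larger (n + k)^k; for
  fixed k this loses nothing in the limit.\<close>

lemma den_extend_ge:
  assumes "n + k > 0"
  shows "den n * (real (card (dominated_tuples k (n + k))) / real (n + k) ^ (2 * k)) \<le> den (n + k)"
proof -
  let ?N = "n + k" and ?D = "real (card (dominated_tuples k (n + k)))"
  have fact: "(fact ?N :: real) \<le> fact n * real ?N ^ k"
  proof -
    have "real (fact ?N) \<le> real (fact n * ?N ^ k)"
      using fact_add_le[of n k ?N] unfolding of_nat_le_iff by simp
    then show ?thesis
      by simp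
  qed
  have "den n * (?D / real ?N ^ (2 * k)) = real (card (comparable_pairs n) * card (dominated_tuples k ?N)) / (fact n * real ?N ^ k)\<^sup>2"
    by (simp add: den_eq power_mult_distrib power_mult[symmetric] mult.commute)
  also have "\<dots> \<le> real (card (comparable_pairs ?N)) / (fact n * real ?N ^ k)\<^sup>2"
    using card_comparable_pairs_extend[of n k] by (intro divide_right_mono) (auto simp only: of_nat_le_iff zero_le_power2)
  also have "\<dots> \<le> real (card (comparable_pairs ?N)) / (fact ?N)\<^sup>2"
    using fact by (intro divide_left_mono power_mono mult_pos_pos) auto
  finally show ?thesis
    by (simp add: den_eq)
qed

lemma den_growth:
  "\<exists>k>0. \<forall>\<^sub>F n in sequentially. (709 / 1000) ^ k * den n \<le> den (n + k)"
proof -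
  \<comment> \<open>This fixes j so large that fewer than half of the pairs of words are
    bad.\<close>
  have "(\<lambda>j. (50 * real j + 1) * 9 * (99 / 100) ^ j) \<longlonglongrightarrow> 0"
    by real_asymp
  then have "\<forall>\<^sub>F j in sequentially. (50 * real j + 1) * 9 * (99 / 100) ^ j < 1 / 2"
    by (rule order_tendstoD) simp
  then have "\<forall>\<^sub>F j in sequentially. (50 * real j + 1) * 9 * (99 / 100) ^ j < 1 / 2 \<and> j \<ge> 1"
    using eventually_ge_at_top[of 1] by eventually_elim auto
  then obtain j where j: "(50 * real j + 1) * 9 * (99 / 100) ^ j < 1 / 2" "j \<ge> 1"
    using eventually_happens'[OF sequentially_bot] by blast
  define k where "k = 51 * j"
  define G where "G = (81 ^ (50 * j) / 2 :: real)"
  have G: "G \<le> real (card (dominated_words k))"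
  proof -
    have "81 ^ (50 * j) * (1 / 2 :: real) \<le> 81 ^ (50 * j) * (1 - (50 * real j + 1) * 9 * (99 / 100) ^ j)"
      using j(1) by (intro mult_left_mono) auto
    also have "\<dots> \<le> real (card (dominated_words (51 * j)))"
      by (rule card_dominated_words_ge)
    finally show ?thesis
      by (simp add: G_def k_def)
  qed
  have limit: "(\<lambda>n. G * (((real n + real k) / 10 - 1 - real k) / (real n + real k)) ^ (2 * k))
      \<longlonglongrightarrow> G * (1 / 10) ^ (2 * k)"
  proof (intro tendsto_mult_left tendsto_power)
    show "(\<lambda>n. ((real n + real k) / 10 - 1 - real k) / (real n + real k)) \<longlonglongrightarrow> 1 / 10"
      by real_asymp
  qed
  have "(709 / 1000) ^ k < G * (1 / 10) ^ (2 * k)"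
  proof -
    \<comment> \<open>One block of 51 steps: the right-hand side is about 0.743^51. The factor 4
      absorbs the loss of one half in \<open>G\<close> and yields strict inequality.\<close>
    have *: "4 * (709 / 1000) ^ 51 \<le> (81 ^ 50 / 10 ^ 102 :: real)"
      by (simp add: power_divide divide_le_eq le_divide_eq)
    have "2 * (709 / 1000 :: real) ^ k < 4 ^ j * (709 / 1000) ^ k"
    proof -
      have "(2 :: real) < 4 ^ 1"
        by simp
      also have "\<dots> \<le> 4 ^ j"
        using j(2) by (rule power_increasing) simp
      finally show ?thesis
        by (intro mult_strict_right_mono) auto
    qed
    also have "\<dots> = (4 * (709 / 1000) ^ 51) ^ j"
      by (simp only: k_def power_mult power_mult_distrib)
    also have "\<dots> \<le> (81 ^ 50 / 10 ^ 102) ^ j"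
      using * by (rule power_mono) simp
    also have "\<dots> = 2 * (G * (1 / 10) ^ (2 * k))"
    proof -
      have "2 * k = 102 * j"
        by (simp add: k_def)
      then show ?thesis
        by (simp only: G_def power_divide power_mult power_one) simp
    qed
    finally show ?thesis
      by simp
  qed
  then have ev: "\<forall>\<^sub>F n in sequentially. (709 / 1000) ^ k <
      G * (((real n + real k) / 10 - 1 - real k) / (real n + real k)) ^ (2 * k)"
    using order_tendstoD(1)[OF limit] by blast
  have "\<forall>\<^sub>F n in sequentially. (709 / 1000) ^ k * den n \<le> den (n + k)"
    using ev eventually_ge_at_top[of "10 * (k + 1)"]
  proof eventually_elim
    case (elim n)
    define N where "N = n + k"
    have den: "den n \<ge> 0"
      by (simp add: den_def)
    have low: "0 \<le> real N / 10 - 1 - real k" "real N / 10 - 1 - real k \<le> real (N div 10 - k)"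
    proof -
      have "real (10 * (k + 1)) \<le> real n"
        using elim(2) by (simp only: of_nat_le_iff)
      then have "10 + 10 * real k \<le> real n"
        by simp
      then show "0 \<le> real N / 10 - 1 - real k"
        by (simp add: N_def field_simps)
      have "real N < 10 * real (N div 10) + 10"
        by linarith
      then show "real N / 10 - 1 - real k \<le> real (N div 10 - k)"
        by linarith
    qed
    have "(709 / 1000) ^ k \<le> G * ((real N / 10 - 1 - real k) / real N) ^ (2 * k)"
      using elim(1) by (simp add: N_def)
    also have "\<dots> = G * (real N / 10 - 1 - real k) ^ (2 * k) / real N ^ (2 * k)"
      by (simp add: power_divide)
    also have "\<dots> \<le> real (card (dominated_words k)) * real (N div 10 - k) ^ (2 * k) / real N ^ (2 * k)"
      using low G by (intro divide_right_mono mult_mono power_mono) (auto simp: G_def)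
    also have "\<dots> \<le> real (card (dominated_tuples k N)) / real N ^ (2 * k)"
    proof (rule divide_right_mono)
      have "real (card (dominated_words k) * (N div 10 - k) ^ (2 * k)) \<le> real (card (dominated_tuples k N))"
        using card_dominated_tuples_ge[of k N] by (simp only: of_nat_le_iff)
      then show "real (card (dominated_words k)) * real (N div 10 - k) ^ (2 * k) \<le> real (card (dominated_tuples k N))"
        by simp
    qed simp
    finally have "den n * (709 / 1000) ^ k \<le> den n * (real (card (dominated_tuples k N)) / real N ^ (2 * k))"
      using den by (rule mult_left_mono)
    also have "\<dots> \<le> den N"
      unfolding N_def using elim(2) by (intro den_extend_ge) simp
    finally show ?case
      by (simp add: N_def mult.commute)
  qed
  moreover have "k > 0"
    using j(2) by (simp add: k_def)
  ultimately show ?thesis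
    by blast
qed

lemma den_pos: "den n > 0"
proof -
  have "(id, id) \<in> comparable_pairs n"
    by (simp add: comparable_pairs_def)
  then have "card (comparable_pairs n) > 0"
    by (auto simp: card_gt_0_iff)
  then show ?thesis
    by (simp add: den_eq)
qed

text \<open>Iterating steps of length k leads back to the finitely many arguments below
  \<open>n0 + k\<close>, over which \<open>C\<close> is a minimum of positive numbers.\<close>

lemma den_ge: "\<exists>C>0. \<forall>n. C * (709 / 1000) ^ n \<le> den n"
proof -
  let ?r = "709 / 1000 :: real"
  obtain k n0 where k: "k > 0" and step: "\<And>n. n \<ge> n0 \<Longrightarrow> ?r ^ k * den n \<le> den (n + k)"
    using den_growth by (auto simp: eventually_at_top_linorder)
  define C where "C = Min ((\<lambda>m. den m / ?r ^ m) ` {..<n0 + k})"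
  have "C > 0"
    unfolding C_def using k den_pos by (subst Min_gr_iff) auto
  moreover have "C * ?r ^ n \<le> den n" for n
  proof (induction n rule: less_induct)
    case (less n)
    show ?case
    proof (cases "n < n0 + k")
      case True
      then have "C \<le> den n / ?r ^ n"
        unfolding C_def by (intro Min_le) auto
      then show ?thesis
        by (simp add: pos_le_divide_eq)
    next
      case False
      then have "C * ?r ^ (n - k) \<le> den (n - k)"
        using less k by simp
      then have "?r ^ k * (C * ?r ^ (n - k)) \<le> ?r ^ k * den (n - k)"
        by (intro mult_left_mono) auto
      also have "\<dots> \<le> den n"
        using step[of "n - k"] False by simp
      also have "?r ^ k * (C * ?r ^ (n - k)) = C * ?r ^ n"
        using False by (simp add: power_add[symmetric] mult.left_commute)
      finally show ?thesis .
    qed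
  qed
  ultimately show ?thesis by blast
qed

subsection \<open>Ballot pairs\<close>

text \<open>Reading the positions from 1 to m, an element of S is a vote for S and an element of T a
  vote for T, both being possible at once; S never trails.\<close>

definition ballot_pairs :: "nat \<Rightarrow> nat \<Rightarrow> nat \<Rightarrow> (nat set \<times> nat set) set" where
  "ballot_pairs m a b = {(S, T). S \<subseteq> {1..m} \<and> T \<subseteq> {1..m} \<and> card S = a \<and> card T = b \<and>
     (\<forall>j. card (T \<inter> {..j}) \<le> card (S \<inter> {..j}))}"

text \<open>The reflection principle in determinant form: (m choose a) (m choose b) - (m choose a +
  1) (m choose b - 1), where the second product is 0 for b = 0.\<close>

definition ballot_number :: "nat \<Rightarrow> nat \<Rightarrow> nat \<Rightarrow> int" where
  "ballot_number m a b = int (m choose a) * int (m choose b) -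
     (case b of 0 \<Rightarrow> 0 | Suc b' \<Rightarrow> int (m choose Suc a) * int (m choose b'))"

lemma finite_ballot_pairs [simp]: "finite (ballot_pairs m a b)"
  by (rule finite_subset[of _ "Pow {1..m} \<times> Pow {1..m}"]) (auto simp: ballot_pairs_def)

lemma ballot_pairs_le: "(S, T) \<in> ballot_pairs m a b \<Longrightarrow> b \<le> a"
proof -
  assume *: "(S, T) \<in> ballot_pairs m a b"
  then have "S \<inter> {..m} = S" "T \<inter> {..m} = T"
    by (auto simp: ballot_pairs_def)
  with * show ?thesis
    by (auto simp: ballot_pairs_def dest!: spec[of _ m])
qed

lemma ballot_pairs_restrict:
  assumes "(S, T) \<in> ballot_pairs (Suc m) a b"
  shows "(S - {Suc m}, T - {Suc m}) \<in> ballot_pairs m (card (S - {Suc m})) (card (T - {Suc m}))"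
proof -
  have "(U - {Suc m}) \<inter> {..j} = U \<inter> {..min j m}" if "U \<subseteq> {1..Suc m}" for U and j :: nat
    using that by (auto simp: le_Suc_eq)
  with assms show ?thesis
    unfolding ballot_pairs_def by (auto simp: le_Suc_eq)
qed

text \<open>Deleting the position m + 1 maps the ballot pairs to four smaller families, and by
  Pascal's rule the ballot numbers satisfy the same recursion. The hypothesis includes b = a + 1,
  where there are no pairs and the ballot number is 0; this boundary value occurs in the recursion
  at b = a.\<close>

lemma card_ballot_pairs_le: "b \<le> Suc a \<Longrightarrow> int (card (ballot_pairs m a b)) \<le> ballot_number m a b"
proof (induction m arbitrary: a b)
  case 0
  have "ballot_pairs 0 a b \<subseteq> (if a = 0 \<and> b = 0 then {({}, {})} else {})"
    by (auto simp: ballot_pairs_def)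
  then have "card (ballot_pairs 0 a b) \<le> card (if a = 0 \<and> b = 0 then {({}, {})} else {} :: (nat set \<times> nat set) set)"
    by (intro card_mono) auto
  also have "\<dots> = (if a = 0 \<and> b = 0 then 1 else 0)"
    by simp
  finally show ?case
    using 0 by (cases a; cases b) (auto simp: ballot_number_def split: nat.split if_splits)
next
  case (Suc m)
  let ?i = "insert (Suc m)"
  show ?case
  proof (cases "b = Suc a")
    case True
    then have "ballot_pairs (Suc m) a b = {}"
      using ballot_pairs_le by fastforce
    then show ?thesis
      using True by (simp add: ballot_number_def)
  next
    case False
    with Suc.prems have ba: "b \<le> a" by simp
    have cases: "(S - {Suc m} = S \<and> card (S - {Suc m}) = card S) \<or>
        (?i (S - {Suc m}) = S \<and> card S = Suc (card (S - {Suc m})))" if "S \<subseteq> {1..Suc m}" for S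
    proof (cases "Suc m \<in> S")
      case True
      then show ?thesis
        using card_Suc_Diff1[of S "Suc m"] finite_subset[OF that] by (auto simp: insert_absorb)
    qed simp
    show ?thesis
    proof (cases a)
      case 0
      have "ballot_pairs (Suc m) 0 0 \<subseteq> {({}, {})}"
        by (auto simp: ballot_pairs_def card_eq_0_iff dest: finite_subset)
      from card_mono[OF _ this] have "card (ballot_pairs (Suc m) 0 0) \<le> 1"
        by simp
      then show ?thesis
        using 0 ba by (simp add: ballot_number_def)
    next
      case a: (Suc a')
      show ?thesis
      proof (cases b)
        case b: 0
        have "ballot_pairs (Suc m) a b \<subseteq> ballot_pairs m a b \<union> (\<lambda>(S, T). (?i S, T)) ` ballot_pairs m a' b"
        proof clarify
          fix S T assume ST: "(S, T) \<in> ballot_pairs (Suc m) a b" "(S, T) \<notin> (\<lambda>(S, T). (?i S, T)) ` ballot_pairs m a' b"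
          have T: "T = {}"
            using ST b by (auto simp: ballot_pairs_def card_eq_0_iff dest: finite_subset)
          have S: "S \<subseteq> {1..Suc m}" "card S = a"
            using ST by (auto simp: ballot_pairs_def)
          from cases[OF S(1)] show "(S, T) \<in> ballot_pairs m a b"
          proof
            assume "S - {Suc m} = S \<and> card (S - {Suc m}) = card S"
            then show ?thesis
              using ballot_pairs_restrict[OF ST(1)] T S b by simp
          next
            assume *: "?i (S - {Suc m}) = S \<and> card S = Suc (card (S - {Suc m}))"
            then have "(S - {Suc m}, T) \<in> ballot_pairs m a' b"
              using ballot_pairs_restrict[OF ST(1)] T S a b by simp
            then have "(\<lambda>(S, T). (?i S, T)) (S - {Suc m}, T) \<in> (\<lambda>(S, T). (?i S, T)) ` ballot_pairs m a' b"
              by (rule imageI)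
            then show ?thesis
              using * ST(2) by simp
          qed
        qed
        then have "card (ballot_pairs (Suc m) a b) \<le> card (ballot_pairs m a b \<union> (\<lambda>(S, T). (?i S, T)) ` ballot_pairs m a' b)"
          by (intro card_mono) auto
        also have "\<dots> \<le> card (ballot_pairs m a b) + card (ballot_pairs m a' b)"
          by (intro order_trans[OF card_Un_le] add_mono card_image_le) auto
        finally have "int (card (ballot_pairs (Suc m) a b)) \<le> ballot_number m a b + ballot_number m a' b"
          using Suc.IH[of b a] Suc.IH[of b a'] b by simp
        then show ?thesis
          using a b by (simp add: ballot_number_def)
      next
        case b: (Suc b')
        \<comment> \<open>The flags tell whether the deleted position is put back into the first and
          into the second set.\<close>
        define F where "F e1 e2 p = (if e1 then ?i (fst p) else fst p, if e2 then ?i (snd p) else snd p)"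
          for e1 e2 :: bool and p :: "nat set \<times> nat set"
        let ?U = "F False False ` ballot_pairs m a b \<union> (F True False ` ballot_pairs m a' b \<union>
          (F False True ` ballot_pairs m a b' \<union> F True True ` ballot_pairs m a' b'))"
        have "ballot_pairs (Suc m) a b \<subseteq> ?U"
        proof
          fix p assume p: "p \<in> ballot_pairs (Suc m) a b"
          obtain S T where ST: "p = (S, T)"
            by (cases p)
          define p' where "p' = (S - {Suc m}, T - {Suc m})"
          have S: "S \<subseteq> {1..Suc m}" "card S = a" and T: "T \<subseteq> {1..Suc m}" "card T = b"
            using p by (auto simp: ballot_pairs_def ST)
          have p': "p' \<in> ballot_pairs m (card (S - {Suc m})) (card (T - {Suc m}))"
            using ballot_pairs_restrict p by (simp add: ST p'_def)
          have "p \<in> F e1 e2 ` ballot_pairs m (card (S - {Suc m})) (card (T - {Suc m}))" if "F e1 e2 p' = p" for e1 e2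
            using p' that by force
          moreover have "F e1 e2 p' = (if e1 then ?i (S - {Suc m}) else S - {Suc m}, if e2 then ?i (T - {Suc m}) else T - {Suc m})" for e1 e2
            by (simp add: F_def p'_def)
          ultimately have mem: "p \<in> F e1 e2 ` ballot_pairs m (card (S - {Suc m})) (card (T - {Suc m}))"
            if "(if e1 then ?i (S - {Suc m}) else S - {Suc m}) = S" "(if e2 then ?i (T - {Suc m}) else T - {Suc m}) = T" for e1 e2
            using that ST by simp
          show "p \<in> ?U"
            using cases[OF S(1)] cases[OF T(1)]
          proof (elim disjE conjE)
            assume "S - {Suc m} = S" "T - {Suc m} = T"
            then show ?thesis
              using mem[of False False] S T by simp
          next
            assume "S - {Suc m} = S" "?i (T - {Suc m}) = T" "card T = Suc (card (T - {Suc m}))"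
            then show ?thesis
              using mem[of False True] S T b by simp
          next
            assume "?i (S - {Suc m}) = S" "card S = Suc (card (S - {Suc m}))" "T - {Suc m} = T"
            then show ?thesis
              using mem[of True False] S T a by simp
          next
            assume "?i (S - {Suc m}) = S" "card S = Suc (card (S - {Suc m}))"
              "?i (T - {Suc m}) = T" "card T = Suc (card (T - {Suc m}))"
            then show ?thesis
              using mem[of True True] S T a b by simp
          qed
        qed
        then have "card (ballot_pairs (Suc m) a b) \<le> card ?U"
          by (intro card_mono) auto
        also have "\<dots> \<le> card (ballot_pairs m a b) + (card (ballot_pairs m a' b) +
            (card (ballot_pairs m a b') + card (ballot_pairs m a' b')))"
          by (intro order_trans[OF card_Un_le] add_mono card_image_le) auto
        finally have "int (card (ballot_pairs (Suc m) a b)) \<le>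
            ballot_number m a b + (ballot_number m a' b + (ballot_number m a b' + ballot_number m a' b'))"
          using Suc.IH[of b a] Suc.IH[of b a'] Suc.IH[of b' a] Suc.IH[of b' a'] a b ba by simp
        also have "\<dots> = ballot_number (Suc m) a b"
          using a b by (cases b') (simp_all add: ballot_number_def algebra_simps)
        finally show ?thesis .
      qed
    qed
  qed
qed

lemma Suc_times_choose: "Suc a * (m choose Suc a) = (m - a) * (m choose a)"
  by (simp only: binomial_absorption binomial_absorb_comp)

text \<open>Dividing the ballot number by the two binomials gives 1 - (m - a) b / ((a + 1) (m - b +
  1)), whose numerator over the common denominator simplifies to (a - b + 1) (m + 1).\<close>

lemma card_ballot_pairs_ratio:
  assumes "b \<le> a" "a \<le> m"
  shows "real (card (ballot_pairs m a b)) \<le> real (m choose a) * real (m choose b) *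
    (real (a - b + 1) * real (m + 1) / (real (a + 1) * real (m - b + 1)))"
proof -
  have A: "real (a + 1) * real (m choose Suc a) = (real m - real a) * real (m choose a)"
  proof -
    have "real (Suc a * (m choose Suc a)) = real ((m - a) * (m choose a))"
      by (simp only: Suc_times_choose)
    then show ?thesis
      using assms by (simp add: of_nat_diff algebra_simps)
  qed
  have "real_of_int (ballot_number m a b) * (real (a + 1) * real (m - b + 1)) =
      real (m choose a) * real (m choose b) * (real (a - b + 1) * real (m + 1))"
  proof (cases b)
    case 0
    then show ?thesis
      by (simp add: ballot_number_def algebra_simps)
  next
    case (Suc b')
    have B: "real (m - b + 1) * real (m choose b') = real b * real (m choose b)"
    proof -
      have "real (Suc b' * (m choose Suc b')) = real ((m - b') * (m choose b'))"
        by (simp only: Suc_times_choose)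
      then show ?thesis
        using assms Suc by (simp add: of_nat_diff algebra_simps)
    qed
    have "real_of_int (ballot_number m a b) * (real (a + 1) * real (m - b + 1)) =
        real (m choose a) * real (m choose b) * (real (a + 1) * real (m - b + 1)) -
        (real (a + 1) * real (m choose Suc a)) * (real (m - b + 1) * real (m choose b'))"
      using Suc by (simp add: ballot_number_def algebra_simps)
    also have "\<dots> = real (m choose a) * real (m choose b) *
        (real (a + 1) * real (m - b + 1) - (real m - real a) * real b)"
      unfolding A B by (simp add: algebra_simps)
    also have "real (a + 1) * real (m - b + 1) - (real m - real a) * real b = real (a - b + 1) * real (m + 1)"
      using assms by (simp add: of_nat_diff algebra_simps)
    finally show ?thesis .
  qed
  moreover have "real (card (ballot_pairs m a b)) \<le> real_of_int (ballot_number m a b)"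
    using card_ballot_pairs_le[of b a m] assms by linarith
  then have "real (card (ballot_pairs m a b)) * (real (a + 1) * real (m - b + 1)) \<le>
      real_of_int (ballot_number m a b) * (real (a + 1) * real (m - b + 1))"
    by (rule mult_right_mono) simp
  ultimately have "real (card (ballot_pairs m a b)) * (real (a + 1) * real (m - b + 1)) \<le>
      real (m choose a) * real (m choose b) * (real (a - b + 1) * real (m + 1))"
    by linarith
  moreover have "real (a + 1) * real (m - b + 1) > 0"
    by simp
  ultimately show ?thesis
    unfolding times_divide_eq_right by (subst pos_le_divide_eq)
qed

lemma card_ballot_pairs_le_choose: "card (ballot_pairs m a b) \<le> (m choose a) * (m choose b)"
proof -
  have "ballot_pairs m a b \<subseteq> {S. S \<subseteq> {1..m} \<and> card S = a} \<times> {T. T \<subseteq> {1..m} \<and> card T = b}"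
    by (auto simp: ballot_pairs_def)
  then have "card (ballot_pairs m a b) \<le> card ({S. S \<subseteq> {1..m} \<and> card S = a} \<times> {T. T \<subseteq> {1..m} \<and> card T = b})"
    by (intro card_mono) auto
  then show ?thesis
    by (simp add: card_cartesian_product n_subsets)
qed

lemma card_ballot_pairs_min:
  assumes "b \<le> a" "a \<le> m"
  shows "real (card (ballot_pairs m a b)) \<le> real (m choose a) * real (m choose b) *
    min 1 (real (a - b + 1) * real (m + 1) / (real (a + 1) * real (m - b + 1)))"
proof -
  have "real (card (ballot_pairs m a b)) \<le> real (m choose a) * real (m choose b) * 1"
    using card_ballot_pairs_le_choose[of m a b] by (simp only: of_nat_mult[symmetric] of_nat_le_iff mult_1_right)
  then show ?thesis
    using card_ballot_pairs_ratio[OF assms] by (simp only: min_def split: if_split) simp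
qed

subsection \<open>The fourth moment of the hypergeometric distribution\<close>

text \<open>
  The weights \<open>c a = (m choose a)\<^sup>2\<close> satisfy \<open>c a (m - a)\<^sup>2 = c (a + 1) (a + 1)\<^sup>2\<close>. Summation by
  shifting against \<open>(y + 1)\<^sup>p\<close> with \<open>y = 2 a - m\<close> for \<open>p = 1\<close> and \<open>p = 3\<close> yields linear relations between the
  even central moments.
\<close>

context
  fixes m :: nat and c y :: "nat \<Rightarrow> real"
  defines "c \<equiv> \<lambda>a. real (m choose a) ^ 2" and "y \<equiv> \<lambda>a. 2 * real a - real m"
begin

lemma moment_shift:
  assumes "\<And>a. g (Suc a) = f a"
  shows "(\<Sum>a\<le>m. c a * (real m - real a)\<^sup>2 * f a) = (\<Sum>a\<le>m. c a * (real a)\<^sup>2 * g a)"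
proof -
  have step: "c a * (real m - real a)\<^sup>2 * f a = c (Suc a) * (real (Suc a))\<^sup>2 * g (Suc a)" if "a < m" for a
  proof -
    have "real (Suc a * (m choose Suc a)) = real ((m - a) * (m choose a))"
      by (simp only: Suc_times_choose)
    then have "real (Suc a) * real (m choose Suc a) = (real m - real a) * real (m choose a)"
      using that by (simp add: of_nat_diff distrib_right)
    then have "(real (Suc a) * real (m choose Suc a))\<^sup>2 = ((real m - real a) * real (m choose a))\<^sup>2"
      by (rule arg_cong)
    then show ?thesis
      unfolding c_def assms power_mult_distrib by (simp add: mult.commute)
  qed
  \<comment> \<open>The shift has no boundary terms: the factor (m - a)^2 vanishes at a = m and the
    factor a^2 at a = 0.\<close>
  have "(\<Sum>a\<le>m. c a * (real m - real a)\<^sup>2 * f a) = (\<Sum>a<m. c a * (real m - real a)\<^sup>2 * f a)"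
    by (simp flip: lessThan_Suc_atMost)
  also have "\<dots> = (\<Sum>a<m. c (Suc a) * (real (Suc a))\<^sup>2 * g (Suc a))"
    by (rule sum.cong) (simp_all add: step del: of_nat_Suc)
  also have "\<dots> = (\<Sum>a\<le>m. c a * (real a)\<^sup>2 * g a)"
    by (simp add: sum.lessThan_Suc_shift del: sum.lessThan_Suc flip: lessThan_Suc_atMost)
  finally show ?thesis .
qed

lemma second_moment: "(4 * real m - 2) * (\<Sum>a\<le>m. c a * y a ^ 2) = 2 * real m ^ 2 * (\<Sum>a\<le>m. c a)"
proof -
  have "(\<Sum>a\<le>m. c a * (real m - real a)\<^sup>2 * (y a + 1)) = (\<Sum>a\<le>m. c a * (real a)\<^sup>2 * (y a - 1))"
    by (rule moment_shift) (simp add: y_def)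
  \<comment> \<open>The factor 4 clears the denominators of a = (m + y) / 2 and m - a = (m - y) / 2;
    the odd powers of y then cancel.\<close>
  then have "0 = (\<Sum>a\<le>m. 4 * (c a * (real m - real a)\<^sup>2 * (y a + 1)) - 4 * (c a * (real a)\<^sup>2 * (y a - 1)))"
    by (simp add: sum_subtractf flip: sum_distrib_left)
  also have "\<dots> = (\<Sum>a\<le>m. 2 * real m ^ 2 * c a - (4 * real m - 2) * (c a * y a ^ 2))"
    by (rule sum.cong) (simp_all add: y_def power2_eq_square algebra_simps)
  finally show ?thesis
    by (simp add: sum_subtractf flip: sum_distrib_left)
qed

lemma fourth_moment_eq:
  "(4 * real m - 6) * (\<Sum>a\<le>m. c a * y a ^ 4) =
    (6 * real m ^ 2 + 2 - 12 * real m) * (\<Sum>a\<le>m. c a * y a ^ 2) + 2 * real m ^ 2 * (\<Sum>a\<le>m. c a)"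
proof -
  have "(\<Sum>a\<le>m. c a * (real m - real a)\<^sup>2 * (y a + 1) ^ 3) = (\<Sum>a\<le>m. c a * (real a)\<^sup>2 * (y a - 1) ^ 3)"
    by (rule moment_shift, rule arg_cong[of _ _ "\<lambda>x. x ^ 3"]) (simp add: y_def)
  then have "0 = (\<Sum>a\<le>m. 4 * (c a * (real m - real a)\<^sup>2 * (y a + 1) ^ 3) - 4 * (c a * (real a)\<^sup>2 * (y a - 1) ^ 3))"
    by (simp add: sum_subtractf flip: sum_distrib_left)
  also have "\<dots> = (\<Sum>a\<le>m. 2 * real m ^ 2 * c a + (6 * real m ^ 2 + 2 - 12 * real m) * (c a * y a ^ 2) -
      (4 * real m - 6) * (c a * y a ^ 4))"
  proof (rule sum.cong[OF refl])
    fix a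
    have a: "real a = (y a + real m) / 2"
      by (simp add: y_def)
    have "4 * ((real m - real a)\<^sup>2 * (y a + 1) ^ 3) - 4 * ((real a)\<^sup>2 * (y a - 1) ^ 3) =
        2 * real m ^ 2 + (6 * real m ^ 2 + 2 - 12 * real m) * y a ^ 2 - (4 * real m - 6) * y a ^ 4"
      unfolding a by (simp add: power2_eq_square power3_eq_cube power4_eq_xxxx field_simps)
    then have "c a * (4 * ((real m - real a)\<^sup>2 * (y a + 1) ^ 3) - 4 * ((real a)\<^sup>2 * (y a - 1) ^ 3)) =
        c a * (2 * real m ^ 2 + (6 * real m ^ 2 + 2 - 12 * real m) * y a ^ 2 - (4 * real m - 6) * y a ^ 4)"
      by simp
    then show "4 * (c a * (real m - real a)\<^sup>2 * (y a + 1) ^ 3) - 4 * (c a * (real a)\<^sup>2 * (y a - 1) ^ 3) =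
        2 * real m ^ 2 * c a + (6 * real m ^ 2 + 2 - 12 * real m) * (c a * y a ^ 2) -
        (4 * real m - 6) * (c a * y a ^ 4)"
      by (simp only: right_diff_distrib distrib_left mult.left_commute mult.assoc mult.commute)
  qed
  finally show ?thesis
    by (simp add: sum_subtractf sum.distrib flip: sum_distrib_left)
qed

text \<open>The second moment is at most m times the total weight. The condition on m ensures 4 m -
  6 \<ge> m, so the relation for the fourth moment can be divided by m.\<close>

lemma fourth_moment_le:
  assumes m: "m \<ge> 2"
  shows "(\<Sum>a\<le>m. c a * y a ^ 4) \<le> 8 * real m ^ 2 * (\<Sum>a\<le>m. c a)"
proof -
  define M0 M2 M4 r where "M0 = (\<Sum>a\<le>m. c a)" "M2 = (\<Sum>a\<le>m. c a * y a ^ 2)" "M4 = (\<Sum>a\<le>m. c a * y a ^ 4)"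
    "r = real m"
  have r: "r \<ge> 2"
    using m by (simp add: M0_M2_M4_r_def)
  have nonneg: "M0 \<ge> 0" "M2 \<ge> 0" "M4 \<ge> 0"
    by (auto simp: M0_M2_M4_r_def c_def intro!: sum_nonneg)
  have "(4 * r - 2) * M2 = 2 * r ^ 2 * M0"
    using second_moment by (simp add: M0_M2_M4_r_def)
  also have "\<dots> \<le> (4 * r - 2) * (r * M0)"
  proof -
    have "2 * r ^ 2 \<le> (4 * r - 2) * r"
      using r by (simp add: power2_eq_square algebra_simps)
    then show ?thesis
      using nonneg mult_right_mono[of "2 * r ^ 2" "(4 * r - 2) * r" M0] by (simp add: mult.assoc)
  qed
  finally have M2: "M2 \<le> r * M0"
    using r by (simp add: mult_le_cancel_left_pos)
  have "r * M4 \<le> (4 * r - 6) * M4"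
    using r nonneg by (intro mult_right_mono) auto
  also have "\<dots> = (6 * r ^ 2 + 2 - 12 * r) * M2 + 2 * r ^ 2 * M0"
    using fourth_moment_eq by (simp add: M0_M2_M4_r_def)
  also have "\<dots> \<le> 6 * r ^ 2 * (r * M0) + 2 * r ^ 2 * (r * M0)"
  proof (rule add_mono)
    have "(6 * r ^ 2 + 2 - 12 * r) * M2 \<le> 6 * r ^ 2 * M2"
      using r nonneg by (intro mult_right_mono) auto
    also have "\<dots> \<le> 6 * r ^ 2 * (r * M0)"
      using M2 by (intro mult_left_mono) auto
    finally show "(6 * r ^ 2 + 2 - 12 * r) * M2 \<le> 6 * r ^ 2 * (r * M0)" .
    have "1 * M0 \<le> r * M0"
      using r nonneg by (intro mult_right_mono) auto
    then show "2 * r ^ 2 * M0 \<le> 2 * r ^ 2 * (r * M0)"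
      by (intro mult_left_mono) auto
  qed
  also have "\<dots> = r * (8 * r ^ 2 * M0)"
    by (simp add: algebra_simps)
  finally have "M4 \<le> 8 * r ^ 2 * M0"
    using r by (simp add: mult_le_cancel_left_pos)
  then show ?thesis
    by (simp add: M0_M2_M4_r_def)
qed

end

text \<open>The number of m-subsets of \<open>{1..m + N}\<close> that meet \<open>{1..m}\<close> in
  a elements.\<close>

definition hyper_weight :: "nat \<Rightarrow> nat \<Rightarrow> nat \<Rightarrow> real" where
  "hyper_weight m N a = real (m choose a) * real (N choose (m - a))"

lemma sum_hyper_weight: "(\<Sum>a\<le>m. hyper_weight m N a) = real ((m + N) choose m)"
  unfolding hyper_weight_def of_nat_mult[symmetric] of_nat_sum[symmetric] by (simp only: vandermonde)

lemma power4_add_le: "(x + z :: real) ^ 4 \<le> 8 * (x ^ 4 + z ^ 4)"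
proof -
  have "(x + z)\<^sup>2 \<le> 2 * (x\<^sup>2 + z\<^sup>2)"
    using zero_le_power2[of "x - z"] by (simp add: power2_eq_square algebra_simps)
  then have "((x + z)\<^sup>2)\<^sup>2 \<le> (2 * (x\<^sup>2 + z\<^sup>2))\<^sup>2"
    by (rule power_mono) simp
  also have "\<dots> \<le> 8 * ((x\<^sup>2)\<^sup>2 + (z\<^sup>2)\<^sup>2)"
    using zero_le_power2[of "x\<^sup>2 - z\<^sup>2"] by (simp add: power2_eq_square algebra_simps)
  finally show ?thesis
    by simp
qed

text \<open>For N = m the weights are the squared binomials. For N = m + 1, symmetry and Pascal's
  rule add the product of two neighbouring binomials, which is at most the mean of their squares;
  the shifted square is re-centred at the cost of replacing y by y - 2.\<close>

lemma hyper_fourth_moment: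
  assumes m: "m \<ge> 2" and N: "N = m \<or> N = Suc m"
  shows "(\<Sum>a\<le>m. hyper_weight m N a * (2 * real a - real m) ^ 4) \<le> 144 * real m ^ 2 * real ((m + N) choose m)"
proof -
  define c y where "c a = real (m choose a) ^ 2" and "y a = 2 * real a - real m" for a
  define S where "S = (\<Sum>a\<le>m. c a)"
  have four: "(\<Sum>a\<le>m. c a * y a ^ 4) \<le> 8 * real m ^ 2 * S"
    using fourth_moment_le[OF m] by (simp add: c_def y_def S_def)
  have c_hyper: "hyper_weight m m a = c a" if "a \<le> m" for a
    using that binomial_symmetric[OF that] by (simp add: hyper_weight_def c_def power2_eq_square)
  have S_eq: "S = real ((m + m) choose m)"
    unfolding S_def sum_hyper_weight[symmetric] by (rule sum.cong) (simp_all add: c_hyper)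
  show ?thesis
    using N
  proof
    assume [simp]: "N = m"
    have "(\<Sum>a\<le>m. hyper_weight m N a * y a ^ 4) = (\<Sum>a\<le>m. c a * y a ^ 4)"
      by (rule sum.cong) (simp_all add: c_hyper)
    also have "\<dots> \<le> 8 * real m ^ 2 * S"
      by (rule four)
    also have "\<dots> \<le> 144 * real m ^ 2 * S"
      by (intro mult_right_mono) (auto simp: S_eq)
    finally show ?thesis
      by (simp add: y_def S_eq)
  next
    assume N: "N = Suc m"
    have "hyper_weight m N a * y a ^ 4 \<le> 12 * (c a * y a ^ 4) + 4 * (c (Suc a) * (y (Suc a) ^ 4 + 16))"
      if "a \<le> m" for a
    proof -
      have "Suc m choose (m - a) = Suc m choose Suc a"
        using binomial_symmetric[of "Suc a" "Suc m"] that by simp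
      then have "hyper_weight m N a = real (m choose a) * (real (m choose a) + real (m choose Suc a))"
        by (simp add: hyper_weight_def N)
      also have "\<dots> \<le> 3 / 2 * c a + 1 / 2 * c (Suc a)"
        using zero_le_power2[of "real (m choose a) - real (m choose Suc a)"]
        by (simp add: c_def power2_eq_square algebra_simps)
      finally have "hyper_weight m N a * y a ^ 4 \<le> (3 / 2 * c a + 1 / 2 * c (Suc a)) * y a ^ 4"
        by (rule mult_right_mono) simp
      moreover have "c (Suc a) * y a ^ 4 \<le> c (Suc a) * (8 * (y (Suc a) ^ 4 + 16))"
        using power4_add_le[of "y (Suc a)" "- 2"] by (intro mult_left_mono) (auto simp: y_def c_def)
      moreover have "0 \<le> c a * y a ^ 4"
        by (simp add: c_def)
      ultimately show ?thesis
        by (simp add: algebra_simps)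
    qed
    then have "(\<Sum>a\<le>m. hyper_weight m N a * y a ^ 4) \<le>
        (\<Sum>a\<le>m. 12 * (c a * y a ^ 4) + 4 * (c (Suc a) * (y (Suc a) ^ 4 + 16)))"
      by (intro sum_mono) simp
    also have "\<dots> = 12 * (\<Sum>a\<le>m. c a * y a ^ 4) + 4 * (\<Sum>a\<le>m. c (Suc a) * (y (Suc a) ^ 4 + 16))"
      by (simp add: sum.distrib sum_distrib_left)
    also have "(\<Sum>a\<le>m. c (Suc a) * (y (Suc a) ^ 4 + 16)) \<le> (\<Sum>a\<le>Suc m. c a * (y a ^ 4 + 16))"
      by (subst sum.atMost_Suc_shift) (simp add: c_def)
    also have "(\<Sum>a\<le>Suc m. c a * (y a ^ 4 + 16)) = (\<Sum>a\<le>m. c a * y a ^ 4) + 16 * S"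
      by (simp add: c_def S_def binomial_eq_0 distrib_left sum.distrib sum_distrib_left mult.commute)
    \<comment> \<open>The 16 fourth moments give 128 m^2, and 64 is at most 16 m^2 because m \<ge>
      2; together 144 m^2.\<close>
    also have "12 * (\<Sum>a\<le>m. c a * y a ^ 4) + 4 * ((\<Sum>a\<le>m. c a * y a ^ 4) + 16 * S) \<le> 144 * real m ^ 2 * S"
    proof -
      have "2 ^ 2 \<le> real m ^ 2"
        using m by (intro power_mono) auto
      then have "4 * S \<le> real m ^ 2 * S"
        by (intro mult_right_mono) (auto simp: S_eq)
      then show ?thesis
        using four by simp
    qed
    finally have "(\<Sum>a\<le>m. hyper_weight m N a * y a ^ 4) \<le> 144 * real m ^ 2 * S"
      by simp
    also have "\<dots> \<le> 144 * real m ^ 2 * real ((m + N) choose m)"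
    proof -
      obtain m' where "m = Suc m'"
        using m by (cases m) auto
      then have "(m + m) choose m \<le> (m + N) choose m"
        by (simp add: N)
      then show ?thesis
        unfolding S_eq by (intro mult_left_mono) (auto simp: of_nat_le_iff)
    qed
    finally show ?thesis
      by (simp add: y_def)
  qed
qed

subsection \<open>The upper bound\<close>

text \<open>Used twice with the same a and b: for the values at the first m positions and for the
  positions of the first m values. In both cases the intersection with \<open>{..m}\<close> counts
  the entries of the top left m by m block of the permutation matrix.\<close>

definition cut_pairs :: "nat \<Rightarrow> nat \<Rightarrow> nat \<Rightarrow> nat \<Rightarrow> (nat set \<times> nat set) set" where
  "cut_pairs n m a b = {(X, Y). X \<subseteq> {1..n} \<and> Y \<subseteq> {1..n} \<and> card X = m \<and> card Y = m \<and>
     card (X \<inter> {..m}) = a \<and> card (Y \<inter> {..m}) = b \<and> (\<forall>j. card (Y \<inter> {..j}) \<le> card (X \<inter> {..j}))}"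

lemma finite_cut_pairs [simp]: "finite (cut_pairs n m a b)"
  by (rule finite_subset[of _ "Pow {1..n} \<times> Pow {1..n}"]) (auto simp: cut_pairs_def)

text \<open>
  Cutting at \<open>m\<close> and reversing the upper parts splits a dominated pair of \<open>m\<close>-subsets into two
  independent ballot pairs.
\<close>

lemma card_cut_pairs_le:
  assumes "m \<le> n"
  shows "card (cut_pairs n m a b) \<le> card (ballot_pairs m a b) * card (ballot_pairs (n - m) (m - b) (m - a))"
proof -
  define R where "R Z = (\<lambda>x. Suc n - x) ` (Z \<inter> {m<..})" for Z :: "nat set"
  \<comment> \<open>Both sets have m elements, so a lead of X counted from below is a lead of Y
    counted from above; hence the reversed parts appear in exchanged order.\<close>
  define f where "f = (\<lambda>(X, Y). ((X \<inter> {..m}, Y \<inter> {..m}), (R Y, R X)))"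
  have inj: "inj_on (\<lambda>x. Suc n - x) {1..n}"
    by (auto simp: inj_on_def)
  have R_card: "card (R Z \<inter> {..j}) = m - card (Z \<inter> {..max m (n - j)})"
    if Z: "Z \<subseteq> {1..n}" "card Z = m" for Z j
  proof -
    let ?t = "max m (n - j)"
    have "R Z \<inter> {..j} = (\<lambda>x. Suc n - x) ` (Z \<inter> {?t<..})"
      using Z(1) by (auto simp: R_def)
    also have "card \<dots> = card (Z \<inter> {?t<..})"
      using Z(1) by (intro card_image inj_on_subset[OF inj]) auto
    also have "Z \<inter> {?t<..} = Z - Z \<inter> {..?t}"
      by auto
    also have "card \<dots> = m - card (Z \<inter> {..?t})"
      using Z finite_subset[OF Z(1)] by (subst card_Diff_subset) auto
    finally show ?thesis .
  qed
  have R_sub: "R Z \<subseteq> {1..n - m}" if "Z \<subseteq> {1..n}" for Z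
    unfolding R_def
  proof (rule image_subsetI)
    fix x assume "x \<in> Z \<inter> {m<..}"
    then have "x \<in> {1..n}" "m < x"
      using that by auto
    then show "Suc n - x \<in> {1..n - m}"
      by auto
  qed
  have R_card': "card (R Z) = m - card (Z \<inter> {..m})" if "Z \<subseteq> {1..n}" "card Z = m" for Z
  proof -
    have "{1..n - m} \<subseteq> {..n}"
      by auto
    then have "R Z \<inter> {..n} = R Z"
      using R_sub[OF that(1)] by blast
    moreover have "card (R Z \<inter> {..n}) = m - card (Z \<inter> {..max m (n - n)})"
      by (rule R_card[OF that])
    ultimately show ?thesis
      by simp
  qed
  have recover: "Z = (Z \<inter> {..m}) \<union> (\<lambda>x. Suc n - x) ` R Z" if Z: "Z \<subseteq> {1..n}" for Z
  proof -
    have "(\<lambda>x. Suc n - x) ` R Z = (\<lambda>x. x) ` (Z \<inter> {m<..})"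
      unfolding R_def image_image using Z by (intro image_cong) auto
    then show ?thesis
      by auto
  qed
  have "card (cut_pairs n m a b) \<le> card (ballot_pairs m a b \<times> ballot_pairs (n - m) (m - b) (m - a))"
  proof (rule card_inj_on_le[of f])
    show "inj_on f (cut_pairs n m a b)"
    proof (rule inj_onI)
      fix p p' assume p: "p \<in> cut_pairs n m a b" "p' \<in> cut_pairs n m a b" and eq: "f p = f p'"
      obtain X Y X' Y' where pp: "p = (X, Y)" "p' = (X', Y')"
        by (metis surj_pair)
      have "X \<subseteq> {1..n}" "Y \<subseteq> {1..n}" "X' \<subseteq> {1..n}" "Y' \<subseteq> {1..n}"
        using p by (auto simp: cut_pairs_def pp)
      from this[THEN recover] show "p = p'"
        using eq by (simp add: f_def pp)
    qed
    show "f ` cut_pairs n m a b \<subseteq> ballot_pairs m a b \<times> ballot_pairs (n - m) (m - b) (m - a)"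
    proof
      fix r assume "r \<in> f ` cut_pairs n m a b"
      then obtain X Y where XY: "(X, Y) \<in> cut_pairs n m a b" and r: "r = f (X, Y)"
        by auto
      have X: "X \<subseteq> {1..n}" "card X = m" "card (X \<inter> {..m}) = a"
        and Y: "Y \<subseteq> {1..n}" "card Y = m" "card (Y \<inter> {..m}) = b"
        and dom: "\<And>j. card (Y \<inter> {..j}) \<le> card (X \<inter> {..j})"
        using XY by (auto simp: cut_pairs_def)
      have "(X \<inter> {..m}, Y \<inter> {..m}) \<in> ballot_pairs m a b"
      proof -
        have "Z \<inter> {..m} \<inter> {..j} = Z \<inter> {..min m j}" for Z :: "nat set" and j
          by auto
        then have "card (Y \<inter> {..m} \<inter> {..j}) \<le> card (X \<inter> {..m} \<inter> {..j})" for j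
          using dom[of "min m j"] by (simp only:)
        moreover have "X \<inter> {..m} \<subseteq> {1..m}" "Y \<inter> {..m} \<subseteq> {1..m}"
          using X Y by auto
        ultimately show ?thesis
          using X Y by (simp add: ballot_pairs_def)
      qed
      moreover have "(R Y, R X) \<in> ballot_pairs (n - m) (m - b) (m - a)"
        using R_sub[OF X(1)] R_sub[OF Y(1)] R_card'[OF X(1,2)] R_card'[OF Y(1,2)] X(3) Y(3)
          R_card[OF X(1,2)] R_card[OF Y(1,2)] dom
        by (simp add: ballot_pairs_def diff_le_mono2)
      ultimately show "r \<in> ballot_pairs m a b \<times> ballot_pairs (n - m) (m - b) (m - a)"
        by (simp add: r f_def)
    qed
  qed simp
  then show ?thesis
    by (simp add: card_cartesian_product)
qed

section \<open>Permutations with prescribed cut sets\<close>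

lemma card_injective_functions:
  assumes "finite A" "finite B" "card B = card A"
  shows "card {f \<in> A \<rightarrow>\<^sub>E B. inj_on f A} = fact (card A)"
  using card_inj_on_subset_funcset[OF assms(1,2) subset_refl] assms(3)
  by (simp add: fact_prod_rev id_apply)

definition cut_fiber :: "nat \<Rightarrow> nat \<Rightarrow> nat set \<Rightarrow> nat set \<Rightarrow> perm set" where
  "cut_fiber n m X X' = {v \<in> sym_grp n. v ` {1..m} = X \<and> {l \<in> {1..n}. v l \<le> m} = X'}"

text \<open>Cutting the permutation matrix after row and column m gives four blocks with a, m - a, m
  - a and n - 2 m + a entries; each block contributes a factorial.\<close>

definition fiber_size :: "nat \<Rightarrow> nat \<Rightarrow> nat \<Rightarrow> nat" where
  "fiber_size n m a = fact a * fact (m - a) * (fact (m - a) * fact (n - m - (m - a)))"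

lemma finite_cut_fiber [simp]: "finite (cut_fiber n m X X')"
  by (rule finite_subset[OF _ finite_sym_grp[of n]]) (auto simp: cut_fiber_def)

text \<open>Whether a position is at most m, and whether its value is, splits the positions into
  four classes. The sets X and X' determine the class and its image, so the permutation consists of
  four injections between given sets.\<close>

lemma card_cut_fiber_le:
  assumes mn: "m \<le> n"
    and X: "X \<subseteq> {1..n}" "card X = m" "card (X \<inter> {..m}) = a"
    and X': "X' \<subseteq> {1..n}" "card X' = m" "card (X' \<inter> {..m}) = a"
  shows "card (cut_fiber n m X X') \<le> fiber_size n m a"
proof -
  define In where "In Z = Z \<inter> {..m}" for Z
  define Out where "Out Z = Z - {..m}" for Z
  define InC where "InC Z = {1..m} - Z" for Z
  define OutC where "OutC Z = {m<..n} - Z" for Z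
  have cards: "card (In Z) = a" "card (Out Z) = m - a" "card (InC Z) = m - a" "card (OutC Z) = n - m - (m - a)"
    if Z: "Z \<subseteq> {1..n}" "card Z = m" "card (Z \<inter> {..m}) = a" for Z
  proof -
    have fin: "finite Z"
      using Z(1) by (rule finite_subset) simp
    show "card (In Z) = a"
      using Z by (simp add: In_def)
    have "Out Z = Z - Z \<inter> {..m}"
      by (auto simp: Out_def)
    then show out: "card (Out Z) = m - a"
      using Z fin by (simp add: card_Diff_subset)
    have "InC Z = {1..m} - Z \<inter> {..m}"
      by (auto simp: InC_def)
    moreover have "Z \<inter> {..m} \<subseteq> {1..m}"
      using Z(1) by auto
    ultimately show "card (InC Z) = m - a"
      using Z fin by (simp add: card_Diff_subset)
    have "OutC Z = {m<..n} - Out Z" "Out Z \<subseteq> {m<..n}" "finite (Out Z)"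
      using Z(1) fin by (auto simp: OutC_def Out_def)
    then show "card (OutC Z) = n - m - (m - a)"
      using out by (simp add: card_Diff_subset)
  qed
  have fin: "finite (In Z)" "finite (Out Z)" "finite (InC Z)" "finite (OutC Z)" if "Z \<subseteq> {1..n}" for Z
    using finite_subset[OF that] by (auto simp: In_def Out_def InC_def OutC_def)
  define J where "J A B = {f \<in> A \<rightarrow>\<^sub>E B. inj_on f A}" for A B :: "nat set"
  have J_fin: "finite (J A B)" if "finite A" "finite B" for A B
    using that by (auto simp: J_def intro: finite_subset[of _ "A \<rightarrow>\<^sub>E B"] finite_PiE)
  let ?T = "(J (In X') (In X) \<times> J (InC X') (Out X)) \<times> (J (Out X') (InC X) \<times> J (OutC X') (OutC X))"
  let ?f = "\<lambda>v. ((restrict v (In X'), restrict v (InC X')), (restrict v (Out X'), restrict v (OutC X')))"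
  have "card (cut_fiber n m X X') \<le> card ?T"
  proof (rule card_inj_on_le[of ?f])
    show "inj_on ?f (cut_fiber n m X X')"
    proof (rule inj_onI)
      fix v w assume v: "v \<in> cut_fiber n m X X'" and w: "w \<in> cut_fiber n m X X'" and eq: "?f v = ?f w"
      show "v = w"
      proof
        fix x
        have restrict: "restrict v A = restrict w A" if "A \<in> {In X', InC X', Out X', OutC X'}" for A
          using eq that by auto
        have "v x = w x" if "A \<in> {In X', InC X', Out X', OutC X'}" "x \<in> A" for A
          using fun_cong[OF restrict[OF that(1)], of x] that(2) by (simp add: restrict_def)
        moreover have "\<exists>A\<in>{In X', InC X', Out X', OutC X'}. x \<in> A" if "x \<in> {1..n}"
          using that by (auto simp: In_def InC_def Out_def OutC_def)
        moreover have "v x = x" "w x = x" if "x \<notin> {1..n}"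
          using v w that by (auto simp: cut_fiber_def sym_grp_def permutes_not_in)
        ultimately show "v x = w x"
          by (cases "x \<in> {1..n}") (blast, simp)
      qed
    qed
    show "?f ` cut_fiber n m X X' \<subseteq> ?T"
    proof (rule image_subsetI)
      fix v assume "v \<in> cut_fiber n m X X'"
      then have v: "v \<in> sym_grp n" and vX: "v ` {1..m} = X" and vX': "{l \<in> {1..n}. v l \<le> m} = X'"
        by (auto simp: cut_fiber_def)
      note inj = sym_grp_inj[OF v]
      have range: "v x \<in> {1..n}" if "x \<in> {1..n}" for x
        using sym_grp_bij_betw[OF v] that by (auto simp: bij_betw_def)
      have mem_X: "v x \<in> X \<longleftrightarrow> x \<in> {1..m}" for x
        unfolding vX[symmetric] by (rule inj_image_mem_iff[OF inj])
      have mem_X': "v x \<le> m \<longleftrightarrow> x \<in> X'" if "x \<in> {1..n}" for x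
        using vX' that by auto
      have J: "restrict v A \<in> J A B" if "\<And>x. x \<in> A \<Longrightarrow> v x \<in> B" for A B
        using that inj_on_subset[OF inj] by (auto simp: J_def inj_on_restrict_eq)
      have "v x \<in> In X" if "x \<in> In X'" for x
        using that X'(1) mem_X mem_X' by (auto simp: In_def)
      moreover have "v x \<in> Out X" if "x \<in> InC X'" for x
        using that mn mem_X[of x] mem_X'[of x] by (auto simp: InC_def Out_def)
      moreover have "v x \<in> InC X" if "x \<in> Out X'" for x
        using that X'(1) mem_X[of x] mem_X'[of x] range[of x] by (auto simp: InC_def Out_def)
      moreover have "v x \<in> OutC X" if "x \<in> OutC X'" for x
        using that mem_X[of x] mem_X'[of x] range[of x] by (auto simp: OutC_def)
      ultimately show "?f v \<in> ?T"
        by (auto intro!: J)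
    qed
    show "finite ?T"
      using J_fin fin[OF X(1)] fin[OF X'(1)] by simp
  qed
  moreover have "card (J A B) = fact (card A)" if "finite A" "finite B" "card B = card A" for A B
    unfolding J_def using that by (rule card_injective_functions)
  ultimately show ?thesis
    using fin[OF X(1)] fin[OF X'(1)] cards[OF X] cards[OF X']
    by (simp add: card_cartesian_product fiber_size_def)
qed

text \<open>Row m of the rank matrix is the counting function of the values at the first m
  positions, and column m that of the positions of the first m values. Only the comparison of this
  row and this column is kept.\<close>

lemma comparable_pairs_cut:
  assumes mn: "m \<le> n" and vw: "(v, w) \<in> comparable_pairs n"
  shows "\<exists>a\<le>m. \<exists>b\<le>a. \<exists>X Y X' Y'. (X, Y) \<in> cut_pairs n m a b \<and> (X', Y') \<in> cut_pairs n m a b \<and>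
    v \<in> cut_fiber n m X X' \<and> w \<in> cut_fiber n m Y Y'"
proof -
  have v: "v \<in> sym_grp n" and w: "w \<in> sym_grp n" and le: "\<And>i j. rank_mat w i j \<le> rank_mat v i j"
    using vw by (auto simp: comparable_pairs_def rank_le_def)
  define top where "top u = u ` {1..m}" for u :: perm
  define left where "left u = {l \<in> {1..n}. u l \<le> m}" for u :: perm
  have top: "top u \<subseteq> {1..n}" "card (top u) = m" "\<And>j. card (top u \<inter> {..j}) = rank_mat u m j"
    if u: "u \<in> sym_grp n" for u
  proof -
    note inj = sym_grp_inj[OF u]
    show "top u \<subseteq> {1..n}"
      using sym_grp_bij_betw[OF u] mn by (auto simp: top_def bij_betw_def)
    show "card (top u) = m"
      using inj by (simp add: top_def card_image inj_on_subset)
    fix j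
    have "top u \<inter> {..j} = u ` {l \<in> {1..m}. u l \<le> j}"
      by (auto simp: top_def)
    then show "card (top u \<inter> {..j}) = rank_mat u m j"
      using inj unfolding rank_mat_def by (simp only: card_image inj_on_subset[OF inj subset_UNIV])
  qed
  have left: "left u \<subseteq> {1..n}" "card (left u) = m" "\<And>i. card (left u \<inter> {..i}) = rank_mat u (min i n) m"
    if u: "u \<in> sym_grp n" for u
  proof -
    show "left u \<subseteq> {1..n}"
      by (auto simp: left_def)
    show *: "card (left u \<inter> {..i}) = rank_mat u (min i n) m" for i
    proof -
      have "left u \<inter> {..i} = {l \<in> {1..min i n}. u l \<le> m}"
        by (auto simp: left_def)
      then show ?thesis
        by (simp only: rank_mat_def)
    qed
    have "left u \<inter> {..n} = left u"
      by (auto simp: left_def)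
    then show "card (left u) = m"
      using *[of n] mn by (simp add: rank_mat_full[OF u])
  qed
  define a b where "a = rank_mat v m m" and "b = rank_mat w m m"
  have "a \<le> m" "b \<le> a"
    using rank_mat_le le by (auto simp: a_def b_def)
  moreover have "(top v, top w) \<in> cut_pairs n m a b"
    using top[OF v] top[OF w] le by (simp add: cut_pairs_def a_def b_def)
  moreover have "(left v, left w) \<in> cut_pairs n m a b"
    using left[OF v] left[OF w] le mn by (simp add: cut_pairs_def a_def b_def)
  moreover have "v \<in> cut_fiber n m (top v) (left v)" "w \<in> cut_fiber n m (top w) (left w)"
    using v w by (auto simp: cut_fiber_def top_def left_def)
  ultimately show ?thesis
    by blast
qed

lemma card_comparable_pairs_cut_le:
  assumes mn: "m \<le> n"
  shows "card (comparable_pairs n) \<le>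
    (\<Sum>a\<le>m. \<Sum>b\<le>a. card (cut_pairs n m a b) ^ 2 * (fiber_size n m a * fiber_size n m b))"
proof -
  define V where "V p = cut_fiber n m (fst (fst p)) (fst (snd p)) \<times> cut_fiber n m (snd (fst p)) (snd (snd p))"
    for p :: "(nat set \<times> nat set) \<times> (nat set \<times> nat set)"
  define U where "U a b = (\<Union>p\<in>cut_pairs n m a b \<times> cut_pairs n m a b. V p)" for a b
  have fin: "finite (U a b)" for a b
    by (auto simp: U_def V_def)
  have "comparable_pairs n \<subseteq> (\<Union>a\<in>{..m}. \<Union>b\<in>{..a}. U a b)"
  proof
    fix p assume p: "p \<in> comparable_pairs n"
    obtain v w where vw: "p = (v, w)"
      by (cases p)
    obtain a b X Y X' Y' where *: "a \<le> m" "b \<le> a" "(X, Y) \<in> cut_pairs n m a b" "(X', Y') \<in> cut_pairs n m a b"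
        "v \<in> cut_fiber n m X X'" "w \<in> cut_fiber n m Y Y'"
      using comparable_pairs_cut[OF mn p[unfolded vw]] by blast
    then have "p \<in> U a b"
      unfolding U_def vw by (intro UN_I[of "((X, Y), (X', Y'))"]) (auto simp: V_def)
    then show "p \<in> (\<Union>a\<in>{..m}. \<Union>b\<in>{..a}. U a b)"
      using * by blast
  qed
  then have "card (comparable_pairs n) \<le> card (\<Union>a\<in>{..m}. \<Union>b\<in>{..a}. U a b)"
    using fin by (intro card_mono) auto
  also have "\<dots> \<le> (\<Sum>a\<le>m. \<Sum>b\<le>a. card (U a b))"
    by (intro order_trans[OF card_UN_le] sum_mono card_UN_le) auto
  also have "\<dots> \<le> (\<Sum>a\<le>m. \<Sum>b\<le>a. card (cut_pairs n m a b) ^ 2 * (fiber_size n m a * fiber_size n m b))"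
  proof (intro sum_mono)
    fix a b
    have "card (U a b) \<le> (\<Sum>p\<in>cut_pairs n m a b \<times> cut_pairs n m a b. card (V p))"
      unfolding U_def by (rule card_UN_le) simp
    also have "\<dots> \<le> of_nat (card (cut_pairs n m a b \<times> cut_pairs n m a b)) * (fiber_size n m a * fiber_size n m b)"
    proof (rule sum_bounded_above)
      fix p assume p: "p \<in> cut_pairs n m a b \<times> cut_pairs n m a b"
      obtain X Y X' Y' where pp: "p = ((X, Y), (X', Y'))"
        by (metis surj_pair)
      have "card (cut_fiber n m X X') \<le> fiber_size n m a" "card (cut_fiber n m Y Y') \<le> fiber_size n m b"
        using p by (simp_all add: pp cut_pairs_def card_cut_fiber_le[OF mn])
      then show "card (V p) \<le> fiber_size n m a * fiber_size n m b"
        by (simp add: V_def pp card_cartesian_product mult_le_mono)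
    qed
    finally show "card (U a b) \<le> card (cut_pairs n m a b) ^ 2 * (fiber_size n m a * fiber_size n m b)"
      by (simp add: card_cartesian_product power2_eq_square id_apply)
  qed
  finally show ?thesis .
qed

text \<open>If a \<ge> m / 4 and b \<le> 3 m / 4, both denominators are at least m / 4, and a - b is
  half the difference of the two deviations. Otherwise one deviation is at least m / 2 in absolute
  value, and the right-hand side exceeds 1.\<close>

lemma min_one_power4_bound:
  fixes m a b :: nat
  assumes m: "m \<ge> 1" and ab: "b \<le> a" "a \<le> m"
  defines "\<kappa> \<equiv> real (a - b + 1) * real (m + 2) / (real (a + 1) * real (m - b + 1))"
  shows "(min 1 \<kappa>) ^ 4 \<le> 64 * 48 ^ 4 * (1 + (2 * real a - real m) ^ 4 + (2 * real b - real m) ^ 4) / real m ^ 4"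
proof -
  define x z r where "x = 2 * real a - real m" and "z = 2 * real b - real m" and "r = real m"
  have r: "r \<ge> 1"
    using m by (simp add: r_def)
  have \<kappa>: "\<kappa> \<ge> 0"
    by (simp add: \<kappa>_def)
  have x4: "x ^ 4 \<ge> 0" "z ^ 4 \<ge> 0"
    by simp_all
  have "(min 1 \<kappa>) ^ 4 \<le> 64 * 48 ^ 4 * (1 + x ^ 4 + z ^ 4) / r ^ 4"
  proof (cases "- r / 2 \<le> x \<and> z \<le> r / 2")
    case True
    have den: "r / 4 \<le> real (a + 1)" "r / 4 \<le> real (m - b + 1)"
      using True ab by (auto simp: x_def z_def r_def of_nat_diff)
    have num: "real (m + 2) \<le> 3 * r"
      using r by (simp add: r_def)
    have d: "real (a - b + 1) = 1 + (x / 2 + (- z) / 2)"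
      using ab by (simp add: x_def z_def of_nat_diff field_simps)
    \<comment> \<open>The constant 48 is 3 divided by (1/4)^2, with m + 2 bounded by 3 m.\<close>
    have "\<kappa> \<le> real (a - b + 1) * (3 * r) / (r / 4 * (r / 4))"
      unfolding \<kappa>_def using den num r by (intro frac_le mult_mono mult_left_mono mult_pos_pos) auto
    also have "\<dots> = 48 * real (a - b + 1) / r"
      using r by (simp add: field_simps)
    finally have "min 1 \<kappa> \<le> 48 * real (a - b + 1) / r"
      by simp
    then have "(min 1 \<kappa>) ^ 4 \<le> (48 * real (a - b + 1) / r) ^ 4"
      using \<kappa> by (intro power_mono) auto
    also have "\<dots> = 48 ^ 4 * real (a - b + 1) ^ 4 / r ^ 4"
      by (simp only: power_divide power_mult_distrib)
    also have "real (a - b + 1) ^ 4 \<le> 64 * (1 + x ^ 4 + z ^ 4)"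
    proof -
      have "real (a - b + 1) ^ 4 \<le> 8 * (1 ^ 4 + (x / 2 + (- z) / 2) ^ 4)"
        unfolding d by (rule power4_add_le)
      also have "(x / 2 + (- z) / 2) ^ 4 \<le> 8 * ((x / 2) ^ 4 + ((- z) / 2) ^ 4)"
        by (rule power4_add_le)
      finally have "real (a - b + 1) ^ 4 \<le> 8 * (1 ^ 4 + 8 * ((x / 2) ^ 4 + ((- z) / 2) ^ 4))"
        by simp
      also have "\<dots> = 8 + 4 * x ^ 4 + 4 * z ^ 4"
        by (simp add: power_divide)
      also have "\<dots> \<le> 64 * (1 + x ^ 4 + z ^ 4)"
      proof -
        have "8 + 4 * p + 4 * q \<le> 64 * (1 + p + q)" if "0 \<le> p" "0 \<le> q" for p q :: real
          using that by simp
        then show ?thesis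
          using x4 .
      qed
      finally show ?thesis .
    qed
    finally show ?thesis
      using r by (simp add: divide_right_mono mult_left_mono)
  next
    case False
    then have "r / 2 \<le> \<bar>x\<bar> \<or> r / 2 \<le> \<bar>z\<bar>"
      by auto
    moreover have "(r / 2) ^ 4 \<le> u ^ 4" if "r / 2 \<le> \<bar>u\<bar>" for u
    proof -
      have "(r / 2) ^ 4 \<le> \<bar>u\<bar> ^ 4"
        using that r by (intro power_mono) auto
      then show ?thesis by simp
    qed
    ultimately have "(r / 2) ^ 4 \<le> x ^ 4 \<or> (r / 2) ^ 4 \<le> z ^ 4"
      by blast
    then have "(r / 2) ^ 4 \<le> x ^ 4 + z ^ 4"
      using x4 by linarith
    then have "r ^ 4 \<le> 16 * (x ^ 4 + z ^ 4)"
      by (simp add: power_divide)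
    also have "\<dots> \<le> 64 * 48 ^ 4 * (1 + x ^ 4 + z ^ 4)"
      using x4 by simp
    finally have "1 \<le> 64 * 48 ^ 4 * (1 + x ^ 4 + z ^ 4) / r ^ 4"
      using r by (simp add: le_divide_eq)
    moreover have "(min 1 \<kappa>) ^ 4 \<le> 1"
      using \<kappa> by (intro power_le_one) auto
    ultimately show ?thesis
      by linarith
  qed
  then show ?thesis
    by (simp add: x_def z_def r_def)
qed

text \<open>The factorials of the four blocks turn one of the two hypergeometric weights into m! N!;
  the other weight remains as a probability weight.\<close>

lemma fiber_size_weight:
  assumes "a \<le> m" "m \<le> N"
  shows "(hyper_weight m N a)\<^sup>2 * real (fiber_size (m + N) m a) = fact m * fact N * hyper_weight m N a"
proof -
  have binom: "fact k * fact (M - k) * real (M choose k) = fact M" if "k \<le> M" for k M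
  proof -
    have "real (fact k * fact (M - k) * (M choose k)) = real (fact M)"
      by (simp only: binomial_fact_lemma[OF that])
    then show ?thesis by simp
  qed
  have "fact a * fact (m - a) * real (m choose a) = fact m"
    using assms by (intro binom)
  moreover have "fact (m - a) * fact (N - (m - a)) * real (N choose (m - a)) = fact N"
    using assms by (intro binom) simp
  moreover have "(hyper_weight m N a)\<^sup>2 * real (fiber_size (m + N) m a) =
      (fact a * fact (m - a) * real (m choose a)) * (fact (m - a) * fact (N - (m - a)) * real (N choose (m - a))) *
      hyper_weight m N a"
    by (simp add: hyper_weight_def fiber_size_def power2_eq_square algebra_simps)
  ultimately show ?thesis
    by simp
qed

text \<open>Each cut pair contributes two capped ballot factors, and there are two independent cut
  pairs, which makes the fourth power. Dividing by (n!)^2 leaves the mean of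
  \<open>(min 1 \<kappa>) ^ 4\<close> over two independent hypergeometric variables, restricted to b
  \<le> a.\<close>

lemma den_le_half:
  assumes m: "m \<ge> 2" and N: "N = m \<or> N = Suc m"
  shows "den (m + N) \<le> 289 * (64 * 48 ^ 4) / real m ^ 2"
proof -
  define n where "n = m + N"
  define K :: real where "K = 64 * 48 ^ 4"
  define W where "W = hyper_weight m N"
  define x where "x a = (2 * real a - real m) ^ 4" for a
  define S where "S = real (n choose m)"
  define f :: real where "f = fact m * fact N"
  have mN: "m \<le> N" "n - m = N"
    using N by (auto simp: n_def)
  have W_nonneg: "W a \<ge> 0" for a
    by (simp add: W_def hyper_weight_def)
  have x_nonneg: "x a \<ge> 0" for a
    by (simp add: x_def)
  have term_le: "real (card (cut_pairs n m a b) ^ 2 * (fiber_size n m a * fiber_size n m b)) \<le>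
      f\<^sup>2 * (K / real m ^ 4) * (W a * W b * (1 + x a + x b))" if ab: "b \<le> a" "a \<le> m" for a b
  proof -
    define \<kappa> where "\<kappa> = real (a - b + 1) * real (m + 2) / (real (a + 1) * real (m - b + 1))"
    \<comment> \<open>The m + 2 in \<kappa> covers the numerators m + 1 and N + 1 of the lower and
      the upper part; \<open>q\<close> allows for the larger denominator when N = m + 1.\<close>
    have mono: "min 1 (real (a - b + 1) * real p / (real (a + 1 + q) * real (m - b + 1))) \<le> min 1 \<kappa>"
      if "p \<le> m + 2" for p q
      unfolding \<kappa>_def using that by (intro min.mono frac_le mult_mono mult_pos_pos) auto
    have b1: "real (card (ballot_pairs m a b)) \<le> real (m choose a) * real (m choose b) * min 1 \<kappa>"
      using card_ballot_pairs_min[OF ab] mono[of "m + 1" 0]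
      by (elim order_trans) (simp add: mult_left_mono)
    have b2: "real (card (ballot_pairs N (m - b) (m - a))) \<le> real (N choose (m - b)) * real (N choose (m - a)) * min 1 \<kappa>"
    proof -
      have eq: "m - b - (m - a) + 1 = a - b + 1" "N - (m - a) + 1 = a + 1 + (N - m)"
        using ab mN by auto
      have "real (card (ballot_pairs N (m - b) (m - a))) \<le> real (N choose (m - b)) * real (N choose (m - a)) *
          min 1 (real (m - b - (m - a) + 1) * real (N + 1) / (real (m - b + 1) * real (N - (m - a) + 1)))"
        using ab mN by (intro card_ballot_pairs_min) auto
      also have "\<dots> \<le> real (N choose (m - b)) * real (N choose (m - a)) * min 1 \<kappa>"
        using mono[of "N + 1" "N - m"] N unfolding eq by (intro mult_left_mono) (auto simp: mult.commute)
      finally show ?thesis .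
    qed
    have "real (card (cut_pairs n m a b)) \<le> real (card (ballot_pairs m a b)) * real (card (ballot_pairs N (m - b) (m - a)))"
      using card_cut_pairs_le[of m n a b] mN by (simp add: n_def flip: of_nat_mult)
    also have "\<dots> \<le> (real (m choose a) * real (m choose b) * min 1 \<kappa>) * (real (N choose (m - b)) * real (N choose (m - a)) * min 1 \<kappa>)"
      by (intro mult_mono b1 b2) (auto simp: \<kappa>_def)
    also have "\<dots> = W a * W b * (min 1 \<kappa>)\<^sup>2"
      by (simp add: W_def hyper_weight_def power2_eq_square algebra_simps)
    finally have "real (card (cut_pairs n m a b)) ^ 2 \<le> (W a * W b * (min 1 \<kappa>)\<^sup>2)\<^sup>2"
      by (rule power_mono) simp
    also have "\<dots> = (W a)\<^sup>2 * (W b)\<^sup>2 * (min 1 \<kappa>) ^ 4"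
      by (simp add: power_mult_distrib)
    also have "\<dots> \<le> (W a)\<^sup>2 * (W b)\<^sup>2 * (K * (1 + x a + x b) / real m ^ 4)"
      using min_one_power4_bound[of m b a] ab m unfolding \<kappa>_def K_def x_def
      by (intro mult_left_mono) auto
    finally have "real (card (cut_pairs n m a b)) ^ 2 * (real (fiber_size n m a) * real (fiber_size n m b)) \<le>
        (W a)\<^sup>2 * (W b)\<^sup>2 * (K * (1 + x a + x b) / real m ^ 4) * (real (fiber_size n m a) * real (fiber_size n m b))"
      by (rule mult_right_mono) simp
    also have "\<dots> = ((W a)\<^sup>2 * real (fiber_size n m a)) * ((W b)\<^sup>2 * real (fiber_size n m b)) * (K * (1 + x a + x b) / real m ^ 4)"
      by simp
    also have "\<dots> = (f * W a) * (f * W b) * (K * (1 + x a + x b) / real m ^ 4)"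
      using fiber_size_weight[OF _ mN(1)] ab by (simp add: W_def n_def f_def)
    also have "\<dots> = f\<^sup>2 * (K / real m ^ 4) * (W a * W b * (1 + x a + x b))"
      by (simp add: power2_eq_square)
    finally show ?thesis
      by simp
  qed
  have S: "(\<Sum>a\<le>m. W a) = S"
    unfolding W_def S_def n_def by (rule sum_hyper_weight)
  have M: "(\<Sum>a\<le>m. W a * x a) \<le> 144 * real m ^ 2 * S"
    unfolding W_def x_def S_def n_def using m N by (rule hyper_fourth_moment)
  have S_nonneg: "S \<ge> 0"
    by (simp add: S_def)
  have "real (card (comparable_pairs n)) \<le>
      real (\<Sum>a\<le>m. \<Sum>b\<le>a. card (cut_pairs n m a b) ^ 2 * (fiber_size n m a * fiber_size n m b))"
    using card_comparable_pairs_cut_le[of m n] by (simp only: of_nat_le_iff n_def le_add1)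
  also have "\<dots> = (\<Sum>a\<le>m. \<Sum>b\<le>a. real (card (cut_pairs n m a b) ^ 2 * (fiber_size n m a * fiber_size n m b)))"
    by (simp only: of_nat_sum)
  also have "\<dots> \<le> (\<Sum>a\<le>m. \<Sum>b\<le>a. f\<^sup>2 * (K / real m ^ 4) * (W a * W b * (1 + x a + x b)))"
    by (intro sum_mono term_le) auto
  \<comment> \<open>Extending the sum to all b makes it split into products of single sums.\<close>
  also have "\<dots> \<le> (\<Sum>a\<le>m. \<Sum>b\<le>m. f\<^sup>2 * (K / real m ^ 4) * (W a * W b * (1 + x a + x b)))"
    using W_nonneg x_nonneg by (intro sum_mono sum_mono2) (auto simp: K_def)
  also have "\<dots> = f\<^sup>2 * (K / real m ^ 4) * (\<Sum>a\<le>m. \<Sum>b\<le>m. W a * W b + W a * x a * W b + W a * (W b * x b))"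
    by (simp add: sum_distrib_left algebra_simps)
  finally have upper: "real (card (comparable_pairs n)) \<le>
      f\<^sup>2 * (K / real m ^ 4) * (\<Sum>a\<le>m. \<Sum>b\<le>m. W a * W b + W a * x a * W b + W a * (W b * x b))" .
  have "(\<Sum>a\<le>m. \<Sum>b\<le>m. W a * W b + W a * x a * W b + W a * (W b * x b)) =
      S * S + (\<Sum>a\<le>m. W a * x a) * S + S * (\<Sum>a\<le>m. W a * x a)"
    by (simp add: sum.distrib S flip: sum_distrib_left sum_distrib_right)
  also have "\<dots> \<le> S * S + (144 * real m ^ 2 * S) * S + S * (144 * real m ^ 2 * S)"
    using M S_nonneg by (intro add_mono mult_left_mono mult_right_mono) auto
  also have "\<dots> = S\<^sup>2 * (1 + 288 * real m ^ 2)"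
    by (simp add: power2_eq_square algebra_simps)
  \<comment> \<open>Here 288 is twice 144, one fourth moment for a and one for b.\<close>
  also have "\<dots> \<le> S\<^sup>2 * (289 * real m ^ 2)"
    using m by (intro mult_left_mono) auto
  finally have "f\<^sup>2 * (K / real m ^ 4) * (\<Sum>a\<le>m. \<Sum>b\<le>m. W a * W b + W a * x a * W b + W a * (W b * x b)) \<le>
      f\<^sup>2 * (K / real m ^ 4) * (S\<^sup>2 * (289 * real m ^ 2))"
    by (rule mult_left_mono) (simp add: K_def)
  also have "f\<^sup>2 * (K / real m ^ 4) * (S\<^sup>2 * (289 * real m ^ 2)) = (f * S)\<^sup>2 * (289 * K / real m ^ 2)"
    using m by (simp add: power_mult_distrib power2_eq_square power4_eq_xxxx field_simps)
  also have "f * S = fact n"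
  proof -
    have "real (fact m * fact (n - m) * (n choose m)) = real (fact n)"
      using binomial_fact_lemma[of m n] by (simp only: n_def le_add1)
    then show ?thesis
      by (simp add: f_def S_def mN)
  qed
  finally have "real (card (comparable_pairs n)) \<le> (fact n)\<^sup>2 * (289 * K / real m ^ 2)"
    using upper by linarith
  then have "den n \<le> 289 * K / real m ^ 2"
    by (simp add: den_eq divide_le_eq mult.commute)
  then show ?thesis
    by (simp add: n_def K_def)
qed

lemma den_le: "n \<ge> 4 \<Longrightarrow> den n \<le> 9 * (289 * (64 * 48 ^ 4)) / real n ^ 2"
proof -
  assume n: "n \<ge> 4"
  define m where "m = n div 2"
  have m: "m \<ge> 2" "n - m = m \<or> n - m = Suc m" "m + (n - m) = n" "n \<le> 3 * m"
    using n by (auto simp: m_def)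
  have "(real n)\<^sup>2 \<le> (3 * real m)\<^sup>2"
    using m(4) by (intro power_mono) auto
  then have n2: "(real n)\<^sup>2 \<le> 9 * (real m)\<^sup>2"
    by (simp add: power_mult_distrib)
  have "den n \<le> 289 * (64 * 48 ^ 4) / real m ^ 2"
    using den_le_half[OF m(1,2)] m(3) by simp
  also have "\<dots> \<le> 9 * (289 * (64 * 48 ^ 4)) / real n ^ 2"
    using n2 n m(1) by (simp add: divide_simps)
  finally show ?thesis .
qed

theorem theorem4p0p2:
  fixes \<rho> :: real
  assumes "\<rho> = root 11 (25497938851324213335 / fact 22)"
  shows "708 / 1000 \<le> \<rho> \<and> \<rho> < 709 / 1000 \<and>
         den \<in> O(\<lambda>n. real n powi (- 2)) \<and>
         (\<forall>\<epsilon>. 0 < \<epsilon> \<and> \<epsilon> < \<rho> \<longrightarrow> den \<in> \<Omega>(\<lambda>n. (\<rho> - \<epsilon>) ^ n))"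
proof (intro conjI allI impI)
  have root: "root 11 (c ^ 11) = c" if "c \<ge> 0" for c :: real
    using that by (simp add: real_root_power_cancel)
  \<comment> \<open>Both numerical bounds on \<rho> are rational inequalities between 11th powers,
    transferred by monotonicity of the root.\<close>
  have "(708 / 1000) ^ 11 \<le> (25497938851324213335 / fact 22 :: real)"
    by (simp add: fact_numeral power_divide divide_le_eq le_divide_eq)
  then have "root 11 ((708 / 1000) ^ 11) \<le> \<rho>"
    unfolding assms by simp
  then show "708 / 1000 \<le> \<rho>"
    by (simp only: root)
  have "(25497938851324213335 / fact 22 :: real) < (709 / 1000) ^ 11"
    by (simp add: fact_numeral power_divide divide_less_eq less_divide_eq)
  then have "\<rho> < root 11 ((709 / 1000) ^ 11)"
    unfolding assms by simp
  then show \<rho>: "\<rho> < 709 / 1000"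
    by (simp only: root)
  show "den \<in> O(\<lambda>n. real n powi (- 2))"
  proof (rule bigoI)
    show "\<forall>\<^sub>F n in sequentially. norm (den n) \<le> 9 * (289 * (64 * 48 ^ 4)) * norm (real n powi (- 2))"
      using eventually_ge_at_top[of 4]
    proof eventually_elim
      case (elim n)
      then show ?case
        using den_le[OF elim] den_pos[of n] by (simp add: power_int_minus divide_inverse)
    qed
  qed
  fix \<epsilon> :: real
  assume \<epsilon>: "0 < \<epsilon> \<and> \<epsilon> < \<rho>"
  obtain C where C: "C > 0" "\<And>n. C * (709 / 1000) ^ n \<le> den n"
    using den_ge by blast
  show "den \<in> \<Omega>(\<lambda>n. (\<rho> - \<epsilon>) ^ n)"
  proof (rule landau_omega.bigI[OF C(1)])
    show "\<forall>\<^sub>F n in sequentially. C * norm ((\<rho> - \<epsilon>) ^ n) \<le> norm (den n)"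
    proof (rule always_eventually, rule allI)
      fix n
      have "(\<rho> - \<epsilon>) ^ n \<le> (709 / 1000) ^ n"
        using \<epsilon> \<rho> by (intro power_mono) auto
      then have "C * (\<rho> - \<epsilon>) ^ n \<le> C * (709 / 1000) ^ n"
        using C(1) by (intro mult_left_mono) auto
      then show "C * norm ((\<rho> - \<epsilon>) ^ n) \<le> norm (den n)"
        using C(2)[of n] den_pos[of n] \<epsilon> by (simp add: norm_power)
    qed
  qed
qed

end
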